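(* Let $n$ be a nonnegative integer and suppose $bcd=aq$ and $de=a^2q^{3n+1}$. If $f=a/b$ or $f=a/e$, then \begin{multline*} \sum_{k=0}^n \frac{E(aq^{4k})}{E(a)} \frac{(b,c;q,p)_k}{(aq^3/b,aq^3/c;q^3,p)_k} \frac{(d;q,p)_{2k}}{(aq/d;q,p)_{2k}} \frac{(e,q^{-3n};q^3,p)_k}{(aq/e,aq^{3n+1};q,p)_k}\, q^k \\ =\frac{(aq^3,a^2q^3/bce,a^2q^3/bdef,afq^3/cd;q^3,p)_n} {(a^2q^3/bef,afq^3/c,aq^3/d,a^2q^3/bcde;q^3,p)_n} \,{_{10}\omega_9}(af/c;a/c,fq^3/c,bef/a,d,dq,f,q^{-3n};q^3,p). \end{multline*}
   Context: Let $p$ be a complex number with $|p|<1$, $q$ a nonzero complex number, and all parameters generic so that no denominator vanishes. For nonzero $x$, $E(x)=E(x;p)=\prod_{k\ge 0}(1-xp^k)(1-p^{k+1}/x)$. For a nonzero base $Q$ and integer $m$, $(a;Q,p)_m=\prod_{k=0}^{m-1}E(aQ^k)$ if $m>0$, $=1$ if $m=0$, and $=1/\prod_{k=0}^{-m-1}E(aQ^{m+k})$ if $m<0$; $(a_1,\dots,a_s;Q,p)_m=\prod_{i=1}^s(a_i;Q,p)_m$. For parameters with $(a_4\cdots a_{r+1})^2=a_1^{r-3}Q^{r-5}$ and one of $a_4,\dots,a_{r+1}$ of the form $Q^{-N}$ ($N$ a nonnegative integer), \[{_{r+1}\omega_r}(a_1;a_4,\dots,a_{r+1};Q,p)=\sum_{k\ge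 0}\frac{E(a_1Q^{2k})}{E(a_1)}\frac{(a_1,a_4,\dots,a_{r+1};Q,p)_k\,Q^k}{(Q,a_1Q/a_4,\dots,a_1Q/a_{r+1};Q,p)_k}.\] *)

theory Defs
  imports "HOL-Analysis.Analysis"
begin

definition ellE :: "complex \<Rightarrow> complex \<Rightarrow> complex" where
  "ellE p x = (\<Prod>k. (1 - x * p ^ k) * (1 - p ^ (Suc k) / x))"

definition epoch :: "complex \<Rightarrow> complex \<Rightarrow> complex \<Rightarrow> int \<Rightarrow> complex" where
  "epoch p Q a m =
     (if m \<ge> 0 then (\<Prod>k<nat m. ellE p (a * Q ^ k))
      else 1 / (\<Prod>k<nat (- m). ellE p (a * Q powi (m + int k))))"

definition epochs :: "complex \<Rightarrow> complex \<Rightarrow> complex list \<Rightarrow> int \<Rightarrow> complex" where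
  "epochs p Q as m = prod_list (map (\<lambda>a. epoch p Q a m) as)"

text \<open>The very-well-poised series {r+1}omega{r}(a1; a4,...,a_{r+1}; Q,p), where the list
  as = [a4,...,a_{r+1}] (so r = length as + 2).  It is defined as the series over k >= 0;
  in the terminating case (one a_i = Q^(-N)) all terms with k > N vanish.\<close>
definition omega :: "complex \<Rightarrow> complex \<Rightarrow> complex \<Rightarrow> complex list \<Rightarrow> complex" where
  "omega p Q a1 as =
     (\<Sum>k. ellE p (a1 * Q ^ (2 * k)) / ellE p a1
          * epochs p Q (a1 # as) (int k) * Q ^ k
          / epochs p Q (Q # map (\<lambda>ai. a1 * Q / ai) as) (int k))"

end

theory Submission
  imports Defs "HOL-Complex_Analysis.Complex_Analysis"
begin

text \<open>If \<open>b c = s\<close> is kept fixed, a product of \<open>n\<close> factors \<open>E(x b) E(x c)\<close> is, by Weierstrass'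
  three-term relation, a binary form of degree \<open>n\<close> in two fixed such factors; hence an identity
  between linear combinations of such products holds as soon as it holds at \<open>n + 1\<close> inequivalent
  points \<open>b\<close>. The Frenkel--Turaev sum, Bailey's transformation and the case \<open>f = a / b\<close> of the
  theorem are proved this way by induction on \<open>n\<close>, the values at the interpolation points being
  smaller instances of the same identities. In the cubic case the points are \<open>b = 1\<close>, where only
  the Frenkel--Turaev sum is needed, and \<open>b = a q\<^sup>3\<^sup>m\<close> for \<open>1 \<le> m \<le> n\<close>, where the right side has a
  single term and the left side is a shifted cubic series of length \<open>n - m\<close>. The case \<open>f = a / e\<close>
  follows from the case \<open>f = a / b\<close> by Bailey's transformation. All this needs generic
  parameters; the general case follows by continuity.\<close>

subsection \<open>The theta function\<close>

text \<open>Why \<open>b\<close> is the variable: given \<open>a\<close>, \<open>d\<close>,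
  \<open>n\<close>, the two balancing conditions determine \<open>b c\<close> and \<open>e\<close>.
  For \<open>f = a / b\<close> the parameters \<open>a f / c = a d / q\<close>,
  \<open>f q^3 / c = d q^2\<close> and \<open>b e f / a = e\<close> do not involve \<open>b\<close>,
  which therefore enters the right side only through the pair \<open>a / b\<close>,
  \<open>a / c\<close>. For \<open>f = a / e\<close> the leading parameter
  \<open>a f / c = a^2 / (c e)\<close> does depend on \<open>b\<close>, hence the detour through
  Bailey's transformation. The obstacle in the cubic case is the mixture of bases. In the two
  classical identities \<open>b\<close> and \<open>q^-n\<close> exchange their roles at
  \<open>b = q^-m\<close>; here \<open>b\<close> belongs to base \<open>q\<close> and
  \<open>q^(-3n)\<close> to base \<open>q^3\<close>, so these points are of no use. The points
  \<open>a q^(3m)\<close> are zeros of the common denominator instead: the identity makes sense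
  there only after clearing it, and clearing removes all terms with index below \<open>m\<close>.
  Points count as equivalent when related by \<open>b -> p b\<close> and \<open>b -> s / b\<close>.
  The theorem assumes only that the denominators it displays do not vanish, whereas the inductions
  divide by many other quantities; this is why generic parameters come first.\<close>

locale elliptic_nome =
  fixes p :: complex
  assumes norm_p: "norm p < 1"
begin

abbreviation \<theta> :: "complex \<Rightarrow> complex" where "\<theta> \<equiv> ellE p"

definition half_theta :: "complex \<Rightarrow> complex" where
  "half_theta x = (\<Prod>k. 1 - x * p ^ k)"

lemma convergent_half_theta: "convergent_prod (\<lambda>k. 1 - x * p ^ k)"
proof -
  have "summable (\<lambda>k. norm x * norm p ^ k)"
    using norm_p by (intro summable_mult summable_geometric) auto
  then have "summable (\<lambda>k. norm ((1 - x * p ^ k) - 1))"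
    by (simp add: norm_mult norm_power)
  then show ?thesis
    using abs_convergent_prod_conv_summable abs_convergent_prod_imp_convergent_prod by blast
qed

lemma ellE_eq_half_theta: "\<theta> x = half_theta x * half_theta (p / x)"
proof -
  have "half_theta x * half_theta (p / x) = (\<Prod>k. (1 - x * p ^ k) * (1 - (p / x) * p ^ k))"
    unfolding half_theta_def by (rule prodinf_mult[OF convergent_half_theta convergent_half_theta])
  then show ?thesis
    by (simp add: ellE_def)
qed

lemma half_theta_rec: "half_theta x = (1 - x) * half_theta (p * x)"
\<comment> \<open>For \<open>x = 1\<close> the first factor vanishes and cannot be divided out of
  the infinite product; both sides are then 0.\<close>
proof (cases "x = 1")
  case True
  have "(\<lambda>k. 1 - x * p ^ k) has_prod 0"
    using has_prod_zeroI[OF convergent_prod_has_prod[OF convergent_half_theta[of x]], of 0] True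
      convergent_prod_has_prod[OF convergent_half_theta[of x]]
    by simp
  then show ?thesis
    using True by (simp add: half_theta_def has_prod_iff)
next
  case False
  then show ?thesis
    using prodinf_split_head[OF convergent_half_theta[of x]]
    by (simp add: half_theta_def mult_ac)
qed

lemma half_theta_eq_0D:
  assumes "half_theta x = 0"
  shows "\<exists>k. x * p ^ k = 1"
  using prodinf_nonzero[OF convergent_half_theta[of x]] assms by (auto simp: half_theta_def)

text \<open>On a closed disc of radius 1 about \<open>x\<close> the factors differ from 1 by at most
  \<open>(norm x + 1) * norm p ^ k\<close>, so the partial products converge uniformly
  there.\<close>

lemma holomorphic_half_theta: "half_theta holomorphic_on UNIV"
proof (rule holomorphic_uniform_sequence)
  show "open (UNIV :: complex set)" by simp
  show "(\<lambda>x. \<Prod>k<n. 1 - x * p ^ k) holomorphic_on UNIV" for n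
    by (intro holomorphic_intros)
  fix x :: complex
  let ?K = "cball x 1"
  have sum: "summable (\<lambda>k. (norm x + 1) * norm p ^ k)"
    using norm_p by (intro summable_mult summable_geometric) auto
  have "uniformly_convergent_on ?K (\<lambda>N y. \<Sum>n<N. norm (1 - y * p ^ n - 1))"
  proof (rule Weierstrass_m_test'[OF _ sum])
    fix n y assume "y \<in> ?K"
    then have "norm y \<le> norm x + 1"
      using norm_triangle_ineq4[of x "x - y"] by (simp add: dist_norm)
    then show "norm (norm (1 - y * p ^ n - 1)) \<le> (norm x + 1) * norm p ^ n"
      by (simp add: norm_mult norm_power mult_right_mono)
  qed
  then have "uniformly_convergent_on ?K (\<lambda>N y. \<Prod>n<N. 1 - y * p ^ n)"
    by (intro uniformly_convergent_on_prod') (auto intro!: continuous_intros)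
  then obtain g where g: "uniform_limit ?K (\<lambda>N y. \<Prod>n<N. 1 - y * p ^ n) g sequentially"
    by (auto simp: uniformly_convergent_on_def)
  have "g y = half_theta y" if "y \<in> ?K" for y
  proof (rule LIMSEQ_unique)
    show "(\<lambda>N. \<Prod>n<N. 1 - y * p ^ n) \<longlonglongrightarrow> g y"
      using g that by (rule tendsto_uniform_limitI)
    have "(\<lambda>N. \<Prod>n\<le>N. 1 - y * p ^ n) \<longlonglongrightarrow> half_theta y"
      unfolding half_theta_def by (rule convergent_prod_LIMSEQ[OF convergent_half_theta])
    then show "(\<lambda>N. \<Prod>n<N. 1 - y * p ^ n) \<longlonglongrightarrow> half_theta y"
      by (subst filterlim_sequentially_Suc[symmetric]) (simp add: lessThan_Suc_atMost)
  qed
  then have "uniform_limit ?K (\<lambda>N y. \<Prod>n<N. 1 - y * p ^ n) half_theta sequentially"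
    using g by (metis (no_types, lifting) uniform_limit_cong')
  then show "\<exists>d>0. cball x d \<subseteq> UNIV \<and>
      uniform_limit (cball x d) (\<lambda>n x. \<Prod>k<n. 1 - x * p ^ k) half_theta sequentially"
    by (intro exI[of _ 1]) auto
qed

lemma holomorphic_half_theta_compose [holomorphic_intros]:
  "f holomorphic_on A \<Longrightarrow> (\<lambda>x. half_theta (f x)) holomorphic_on A"
  using holomorphic_on_compose_gen[OF _ holomorphic_half_theta, of f A] by (simp add: o_def)

lemma holomorphic_ellE [holomorphic_intros]:
  "f holomorphic_on A \<Longrightarrow> (\<And>x. x \<in> A \<Longrightarrow> f x \<noteq> 0) \<Longrightarrow> (\<lambda>x. \<theta> (f x)) holomorphic_on A"
  unfolding ellE_eq_half_theta by (intro holomorphic_intros) auto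

lemma ellE_holomorphic: "\<theta> holomorphic_on - {0}"
  using holomorphic_ellE[OF holomorphic_on_ident, of "- {0}"] by simp

lemma isCont_ellE:
  assumes "x \<noteq> 0"
  shows "isCont \<theta> x"
proof -
  have "continuous_on (- {0}) \<theta>"
    using ellE_holomorphic by (rule holomorphic_on_imp_continuous_on)
  then show ?thesis
    using assms by (simp add: continuous_on_eq_continuous_at open_Compl)
qed

lemma tendsto_ellE [tendsto_intros]:
  assumes "(f \<longlongrightarrow> x) F" "x \<noteq> 0"
  shows "((\<lambda>t. \<theta> (f t)) \<longlongrightarrow> \<theta> x) F"
  using isCont_tendsto_compose[OF isCont_ellE assms(1)] assms(2) by simp

lemma ellE_1 [simp]: "\<theta> 1 = 0"
  using half_theta_rec[of 1] by (simp add: ellE_eq_half_theta)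

text \<open>Once the factor \<open>1 - x\<close> is split off, what remains is
  \<open>half_theta (p * x) * half_theta (p / x)\<close>, which is invariant under
  \<open>x -> 1 / x\<close>.\<close>

lemma ellE_inverse: "x \<noteq> 0 \<Longrightarrow> \<theta> (1 / x) = - \<theta> x / x"
proof (cases "x = 1")
  assume "x \<noteq> 0" "x \<noteq> 1"
  moreover have "\<theta> x = (1 - x) * (half_theta (p * x) * half_theta (p / x))"
    using half_theta_rec[of x] by (simp add: ellE_eq_half_theta)
  moreover have "\<theta> (1 / x) = (1 - 1 / x) * (half_theta (p * x) * half_theta (p / x))"
    using half_theta_rec[of "1 / x"] by (simp add: ellE_eq_half_theta mult.commute)
  ultimately show ?thesis
    by (simp only:) (simp add: field_simps)
qed auto

lemma ellE_p_times: "x \<noteq> 0 \<Longrightarrow> p \<noteq> 0 \<Longrightarrow> \<theta> (p * x) = - \<theta> x / x"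
  using ellE_inverse[of x] by (simp add: ellE_eq_half_theta mult.commute)

lemma ellE_over_p: "x \<noteq> 0 \<Longrightarrow> p \<noteq> 0 \<Longrightarrow> \<theta> (x / p) = - (x / p) * \<theta> x"
  using ellE_p_times[of "x / p"] by (simp add: field_simps)

lemma ellE_eq_0D:
  assumes "\<theta> x = 0" "x \<noteq> 0"
  shows "\<exists>k. x * p ^ k = 1 \<or> x = p ^ Suc k"
  using assms half_theta_eq_0D[of x] half_theta_eq_0D[of "p / x"]
  by (auto simp: ellE_eq_half_theta field_simps)

lemma countable_ellE_zeros: "countable {x. x \<noteq> 0 \<and> \<theta> x = 0}"
proof (rule countable_subset)
  show "{x. x \<noteq> 0 \<and> \<theta> x = 0} \<subseteq> range (\<lambda>k. inverse (p ^ k)) \<union> range (\<lambda>k. p ^ Suc k)"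
  proof
    fix x assume "x \<in> {x. x \<noteq> 0 \<and> \<theta> x = 0}"
    then obtain k where "x * p ^ k = 1 \<or> x = p ^ Suc k"
      using ellE_eq_0D by blast
    then have "x = inverse (p ^ k) \<or> x = p ^ Suc k"
      by (metis inverse_unique mult.commute)
    then show "x \<in> range (\<lambda>k. inverse (p ^ k)) \<union> range (\<lambda>k. p ^ Suc k)"
      by blast
  qed
qed auto

section \<open>Simplicity of the zeros\<close>

lemma deriv_ellE_1: "\<exists>D. D \<noteq> 0 \<and> (\<theta> has_field_derivative D) (at 1)"
proof -
  \<comment> \<open>\<open>H\<close> is \<theta> without the factor \<open>1 - x\<close>. It does
    not vanish at 1 because no positive power of \<open>p\<close> equals 1, so the zero at 1 is
    simple.\<close>
  define H where "H x = half_theta (p * x) * half_theta (p / x)" for x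
  have eq: "\<theta> = (\<lambda>x. (1 - x) * H x)"
    by (rule ext, subst ellE_eq_half_theta, subst half_theta_rec) (simp add: H_def)
  have "H holomorphic_on - {0}"
    unfolding H_def by (intro holomorphic_intros) auto
  then have "(H has_field_derivative deriv H 1) (at 1)"
    by (rule holomorphic_derivI) (auto simp: open_Compl)
  then have "(\<theta> has_field_derivative - H 1) (at 1)"
    unfolding eq by (auto intro!: derivative_eq_intros)
  moreover have "H 1 \<noteq> 0"
  proof
    assume "H 1 = 0"
    then obtain k where "p * p ^ k = 1"
      using half_theta_eq_0D[of p] by (auto simp: H_def)
    then have "norm p ^ Suc k = 1"
      by (metis norm_one norm_power power_Suc)
    then show False
      using norm_p power_less_one_iff[of "norm p" "Suc k"] by simp
  qed
  ultimately show ?thesis by (intro exI[of _ "- H 1"]) auto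
qed

text \<open>Differentiate the functional equation: at a zero of \<theta> the derivative of the
  multiplier contributes nothing, so a nonzero derivative stays nonzero.\<close>

lemma deriv_ellE_p_times:
  assumes p: "p \<noteq> 0" and x: "x \<noteq> 0" "\<theta> x = 0" and D: "(\<theta> has_field_derivative D) (at x)"
  shows "(\<theta> has_field_derivative - D / (p * x)) (at (p * x))"
proof -
  have D': "(\<theta> has_field_derivative D) (at (p * x / p))"
    using D p by simp
  have y_der: "((\<lambda>y. y / p) has_field_derivative 1 / p) (at (p * x))"
    using p by (auto intro!: derivative_eq_intros)
  from DERIV_chain2[OF D' this]
  have fd: "((\<lambda>y. \<theta> (y / p)) has_field_derivative D * (1 / p)) (at (p * x))" .
  have der: "((\<lambda>y. - \<theta> (y / p) / (y / p)) has_field_derivative - D / (p * x)) (at (p * x))"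
    using DERIV_divide[OF DERIV_minus[OF fd] y_der] p x by (simp add: field_simps)
  have "eventually (\<lambda>y. y \<noteq> 0) (nhds (p * x))"
    using p x by (intro t1_space_nhds) auto
  then have ev: "eventually (\<lambda>y. - \<theta> (y / p) / (y / p) = \<theta> y) (nhds (p * x))"
  proof eventually_elim
    case (elim y)
    then show ?case using ellE_p_times[of "y / p"] p by simp
  qed
  show ?thesis
    using der DERIV_cong_ev[OF refl ev refl] by simp
qed

lemma deriv_ellE_over_p:
  assumes p: "p \<noteq> 0" and x: "x \<noteq> 0" "\<theta> x = 0" and D: "(\<theta> has_field_derivative D) (at x)"
  shows "(\<theta> has_field_derivative - D * x) (at (x / p))"
proof -
  have D': "(\<theta> has_field_derivative D) (at (p * (x / p)))"
    using D p by simp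
  have "((\<lambda>y. p * y) has_field_derivative p) (at (x / p))"
    by (auto intro!: derivative_eq_intros)
  from DERIV_chain2[OF D' this]
  have fd: "((\<lambda>y. \<theta> (p * y)) has_field_derivative D * p) (at (x / p))" .
  have der: "((\<lambda>y. - \<theta> (p * y) * y) has_field_derivative - D * x) (at (x / p))"
    using DERIV_mult[OF DERIV_minus[OF fd] DERIV_ident] p x by simp
  have "eventually (\<lambda>y. y \<noteq> 0) (nhds (x / p))"
    using p x by (intro t1_space_nhds) auto
  then have ev: "eventually (\<lambda>y. - \<theta> (p * y) * y = \<theta> y) (nhds (x / p))"
  proof eventually_elim
    case (elim y)
    then show ?case using ellE_p_times[of y] p by simp
  qed
  show ?thesis
    using der DERIV_cong_ev[OF refl ev refl] by simp
qed

text \<open>All zeros are integral powers of \<open>p\<close>. Simplicity spreads from 1 upwards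
  over \<open>p ^ k\<close> and downwards over \<open>1 / p ^ k\<close>; vanishing is carried along
  in the same induction because the transport lemmas need it.\<close>

lemma ellE_simple_zero:
  assumes p: "p \<noteq> 0" and x: "x \<noteq> 0" "\<theta> x = 0"
  shows "\<exists>D. D \<noteq> 0 \<and> (\<theta> has_field_derivative D) (at x)"
proof -
  have up: "\<exists>D. D \<noteq> 0 \<and> (\<theta> has_field_derivative D) (at (p ^ k))" "\<theta> (p ^ k) = 0" for k
  proof (induction k)
    case 0
    { case 1 show ?case using deriv_ellE_1 by simp }
    { case 2 show ?case by simp }
  next
    case (Suc k)
    { case 1 
      from Suc(1) obtain D where "D \<noteq> 0" "(\<theta> has_field_derivative D) (at (p ^ k))" by blast
      then have "(\<theta> has_field_derivative - D / (p * p ^ k)) (at (p ^ Suc k))"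
        using deriv_ellE_p_times[OF p, of "p ^ k" D] Suc(2) p by simp
      then show ?case using \<open>D \<noteq> 0\<close> p by (intro exI[of _ "- D / (p * p ^ k)"]) simp }
    { case 2 show ?case using Suc ellE_p_times[of "p ^ k"] p by simp }
  qed
  have down: "\<exists>D. D \<noteq> 0 \<and> (\<theta> has_field_derivative D) (at (1 / p ^ k))" "\<theta> (1 / p ^ k) = 0" for k
  proof (induction k)
    case 0
    { case 1 show ?case using deriv_ellE_1 by simp }
    { case 2 show ?case by simp }
  next
    case (Suc k)
    { case 1 
      from Suc(1) obtain D where "D \<noteq> 0" "(\<theta> has_field_derivative D) (at (1 / p ^ k))" by blast
      then have "(\<theta> has_field_derivative - D * (1 / p ^ k)) (at (1 / p ^ Suc k))"
        using deriv_ellE_over_p[OF p, of "1 / p ^ k" D] Suc(2) p by (simp add: mult.commute)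
      then show ?case using \<open>D \<noteq> 0\<close> p by (intro exI[of _ "- D * (1 / p ^ k)"]) simp }
    { case 2 show ?case using Suc ellE_over_p[of "1 / p ^ k"] p by (simp add: mult.commute) }
  qed
  from ellE_eq_0D[OF x(2,1)] obtain k where "x * p ^ k = 1 \<or> x = p ^ Suc k" by blast
  then have "x = 1 / p ^ k \<or> x = p ^ Suc k"
    using p by (auto simp: field_simps)
  then show ?thesis
    using up(1)[of "Suc k"] down(1)[of k] by blast
qed

end

subsection \<open>Theta functions with equal multipliers\<close>

lemma simple_zero_isolated:
  assumes "(g has_field_derivative D) (at z)" "g z = 0" "D \<noteq> 0"
  shows "eventually (\<lambda>w. g w \<noteq> 0) (at z)"
proof -
  have "((\<lambda>w. (g w - g z) / (w - z)) \<longlongrightarrow> D) (at z)"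
    using assms(1) by (simp add: has_field_derivative_iff)
  then have "eventually (\<lambda>w. (g w - g z) / (w - z) \<noteq> 0) (at z)"
    using assms(3) by (rule tendsto_imp_eventually_ne)
  then show ?thesis
    by eventually_elim (use assms(2) in auto)
qed

lemma entire_quotient:
  fixes F G :: "complex \<Rightarrow> complex"
  assumes F: "F holomorphic_on UNIV" and G: "G holomorphic_on UNIV"
    and simple: "\<And>z. G z = 0 \<Longrightarrow> F z = 0 \<and> deriv G z \<noteq> 0"
  obtains H where "H holomorphic_on UNIV" "\<And>z. F z = H z * G z"
proof -
  \<comment> \<open>At a zero of \<open>G\<close> the value is the limit given by l'Hopital's rule.
    Hence \<open>H\<close> is continuous there, and the isolated singularity is removable.\<close>
  define H where "H z = (if G z = 0 then deriv F z / deriv G z else F z / G z)" for z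
  let ?S = "{z. G z \<noteq> 0}"
  have dF: "(F has_field_derivative deriv F z) (at z)" and dG: "(G has_field_derivative deriv G z) (at z)" for z
    using F G by (auto intro: holomorphic_derivI)
  have contG: "continuous_on UNIV G"
    using G by (rule holomorphic_on_imp_continuous_on)
  have "open ?S"
    using open_Collect_neq[OF contG continuous_on_const, of 0] by simp
  have "(\<lambda>z. F z / G z) holomorphic_on ?S"
    by (intro holomorphic_intros holomorphic_on_subset[OF F] holomorphic_on_subset[OF G]) auto
  then have HS: "H holomorphic_on ?S"
    by (rule holomorphic_transform) (auto simp: H_def)
  have "H field_differentiable (at z)" for z
  proof (cases "G z = 0")
    case False
    then show ?thesis
      using HS \<open>open ?S\<close> by (auto simp: holomorphic_on_open field_differentiable_def)
  next
    case True
    have iso: "eventually (\<lambda>w. G w \<noteq> 0) (at z)"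
      using simple_zero_isolated[OF dG True] simple[OF True] by simp
    then obtain r where r: "r > 0" "\<And>w. w \<in> ball z r \<Longrightarrow> w \<noteq> z \<Longrightarrow> G w \<noteq> 0"
      by (auto simp: eventually_at dist_commute)
    have "((\<lambda>w. F w / G w) \<longlongrightarrow> deriv F z / deriv G z) (at z)"
      using simple[OF True] True by (intro lhopital_complex_simple[OF dF dG]) auto
    moreover have "eventually (\<lambda>w. F w / G w = H w) (at z)"
      using iso by eventually_elim (simp add: H_def)
    ultimately have "(H \<longlongrightarrow> H z) (at z)"
      using tendsto_cong True by (fastforce simp: H_def)
    then have "isCont H z"
      by (simp add: isCont_def)
    moreover have sub: "ball z r - {z} \<subseteq> ?S"
      using r(2) by auto
    moreover have "isCont H w" if "w \<in> ?S" for w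
      using HS \<open>open ?S\<close> that
      by (meson continuous_on_eq_continuous_at holomorphic_on_imp_continuous_on)
    ultimately have "continuous_on (ball z r) H"
      by (intro continuous_at_imp_continuous_on) blast
    then have "H holomorphic_on ball z r"
      using no_isolated_singularity[of "ball z r" H "{z}"] holomorphic_on_subset[OF HS sub] by simp
    then show ?thesis
      using r(1) by (auto simp: holomorphic_on_open field_differentiable_def)
  qed
  then have "H holomorphic_on UNIV"
    by (simp add: holomorphic_on_def)
  moreover have "F z = H z * G z" for z
    using simple by (auto simp: H_def)
  ultimately show ?thesis
    using that by blast
qed

text \<open>The annulus meets every orbit of multiplication by \<open>p\<close>; it supplies the
  compact set on which the quotient of two theta functions has to be bounded.\<close>

lemma scale_into_annulus:
  fixes p x :: complex
  assumes "0 < norm p" "norm p < 1" "x \<noteq> 0"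
  shows "\<exists>k::int. norm p \<le> norm (x * p powi k) \<and> norm (x * p powi k) \<le> 1"
proof -
  define L where "L = - ln (norm p)"
  have L: "L > 0" using assms by (simp add: L_def)
  define k where "k = \<lceil>ln (norm x) / L\<rceil>"
  have k: "ln (norm x) / L \<le> of_int k" "of_int k < ln (norm x) / L + 1"
    by (auto simp: k_def) linarith
  have nz: "norm (x * p powi k) > 0"
    using assms by auto
  have "norm (x * p powi k) = norm x * norm p powr of_int k"
    using assms by (simp add: norm_mult norm_power_int powr_real_of_int')
  then have "ln (norm (x * p powi k)) = ln (norm x) - of_int k * L"
    using assms by (simp add: ln_mult ln_powr L_def)
  moreover have "ln (norm x) - of_int k * L \<le> 0" "ln (norm x) - of_int k * L \<ge> - L"
    using k L by (auto simp: field_simps)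
  ultimately have "ln (norm (x * p powi k)) \<le> ln 1" "ln (norm (x * p powi k)) \<ge> ln (norm p)"
    by (simp_all add: L_def)
  then show ?thesis
    using nz assms by (intro exI[of _ k]) (simp add: ln_le_cancel_iff)
qed

text \<open>The quotient of two theta functions with the same multiplier is constant by Liouville's
  theorem: composed with \<open>exp\<close> it is entire and bounded.\<close>

lemma quasiperiodic_proportional:
  fixes f g :: "complex \<Rightarrow> complex"
  assumes p: "p \<noteq> 0" "norm p < 1"
    and f: "f holomorphic_on - {0}" and g: "g holomorphic_on - {0}"
    and qf: "\<And>x. x \<noteq> 0 \<Longrightarrow> f (p * x) = \<mu> x * f x"
    and qg: "\<And>x. x \<noteq> 0 \<Longrightarrow> g (p * x) = \<mu> x * g x"
    and \<mu>: "\<And>x. x \<noteq> 0 \<Longrightarrow> \<mu> x \<noteq> 0"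
    and simple: "\<And>x. x \<noteq> 0 \<Longrightarrow> g x = 0 \<Longrightarrow> f x = 0 \<and> deriv g x \<noteq> 0"
  shows "\<exists>\<kappa>. \<forall>x. x \<noteq> 0 \<longrightarrow> f x = \<kappa> * g x"
proof -
  have hol: "(\<lambda>w. h (exp w)) holomorphic_on UNIV" if "h holomorphic_on - {0}" for h :: "complex \<Rightarrow> complex"
    using holomorphic_on_compose_gen[OF holomorphic_on_exp that, of UNIV]
      exp_not_eq_zero by (fastforce simp: o_def)
  have dG: "((\<lambda>w. g (exp w)) has_field_derivative deriv g (exp z) * exp z) (at z)" for z
    by (rule DERIV_chain2[OF _ DERIV_exp]) (rule holomorphic_derivI[OF g]; auto)
  have sG: "f (exp z) = 0 \<and> deriv (\<lambda>w. g (exp w)) z \<noteq> 0" if "g (exp z) = 0" for z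
    using simple[of "exp z"] that DERIV_imp_deriv[OF dG] by simp
  obtain H where H: "H holomorphic_on UNIV" "\<And>z. f (exp z) = H z * g (exp z)"
    using entire_quotient[OF hol[OF f] hol[OF g] sG] by blast
  have step: "f (p * x) / g (p * x) = f x / g x" if "x \<noteq> 0" for x
    using qf qg \<mu> that by simp
  have stepn: "f (x * p ^ k) / g (x * p ^ k) = f x / g x" if "x \<noteq> 0" for x k
    using that p
  proof (induction k)
    case (Suc k)
    then show ?case using step[of "x * p ^ k"] by (simp add: mult_ac)
  qed simp
  have stepi: "f (x * p powi k) / g (x * p powi k) = f x / g x" if "x \<noteq> 0" for x and k :: int
  proof (cases "k \<ge> 0")
    case True
    then show ?thesis using stepn[OF that, of "nat k"] by (simp add: power_int_def)
  next
    case False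
    then show ?thesis
      using stepn[of "x * p powi k" "nat (- k)"] that p
      by (simp add: power_int_def field_simps)
  qed
  have g0: "g (p * x) = 0 \<longleftrightarrow> g x = 0" if "x \<noteq> 0" for x
    using qg \<mu> that by simp
  have g0n: "g (x * p ^ k) = 0 \<longleftrightarrow> g x = 0" if "x \<noteq> 0" for x k
    using that p
  proof (induction k)
    case (Suc k)
    then show ?case using g0[of "x * p ^ k"] by (simp add: mult_ac)
  qed simp
  have g0i: "g (x * p powi k) = 0 \<longleftrightarrow> g x = 0" if "x \<noteq> 0" for x and k :: int
  proof (cases "k \<ge> 0")
    case True
    then show ?thesis using g0n[OF that, of "nat k"] by (simp add: power_int_def)
  next
    case False
    then show ?thesis
      using g0n[of "x * p powi k" "nat (- k)"] that p
      by (simp add: power_int_def field_simps)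
  qed
  \<comment> \<open>\<open>Ln\<close> maps the annulus \<open>norm p \<le> norm y \<le> 1\<close>
    into this rectangle, so a bound for \<open>H\<close> on \<open>K\<close> covers a representative
    of every orbit.\<close>
  define K where "K = cbox (Complex (ln (norm p)) (- pi)) (Complex 0 pi)"
  have contH: "continuous_on UNIV H"
    using H(1) by (rule holomorphic_on_imp_continuous_on)
  have "compact (H ` K)"
    unfolding K_def by (intro compact_continuous_image continuous_on_subset[OF contH]) auto
  then obtain M where M: "\<And>w. w \<in> K \<Longrightarrow> norm (H w) \<le> M"
    using compact_imp_bounded bounded_iff by (metis imageI)
  have bound1: "norm (H w) \<le> M" if nz: "g (exp w) \<noteq> 0" for w
  proof -
    let ?x = "exp w"
    obtain k :: int where k: "norm p \<le> norm (?x * p powi k)" "norm (?x * p powi k) \<le> 1"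
      using scale_into_annulus[of p ?x] p by auto
    let ?y = "?x * p powi k"
    have y: "?y \<noteq> 0" using p by simp
    have gy: "g ?y \<noteq> 0" using g0i[of ?x] nz by simp
    have "Ln ?y \<in> K"
      using y k p mpi_less_Im_Ln[OF y] Im_Ln_le_pi[OF y]
      by (auto simp: K_def cbox_complex_eq ln_le_cancel_iff)
    then have "norm (H (Ln ?y)) \<le> M" by (rule M)
    moreover have "H (Ln ?y) = f ?y / g ?y"
      using H(2)[of "Ln ?y"] y gy by simp
    moreover have "\<dots> = H w"
      using H(2)[of w] nz stepi[of ?x k] by simp
    ultimately show ?thesis by simp
  qed
  have "norm (H w) \<le> M" for w
  proof (cases "g (exp w) = 0")
    case True
    \<comment> \<open>Here \<open>H w\<close> is not the quotient \<open>f / g\<close>, but such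
      points are isolated and the bound passes to them by continuity.\<close>
    have "eventually (\<lambda>z. g (exp z) \<noteq> 0) (at w)"
      using simple_zero_isolated[OF dG] True simple[of "exp w"] by simp
    then have "eventually (\<lambda>z. norm (H z) \<le> M) (at w)"
      by eventually_elim (rule bound1)
    moreover have "(H \<longlongrightarrow> H w) (at w)"
      using contH by (simp add: continuous_on_def)
    ultimately show ?thesis
      by (intro Lim_norm_ubound[of "at w" H]) auto
  qed (rule bound1)
  then have "bounded (range H)"
    by (auto simp: bounded_iff)
  then obtain \<kappa> where "\<And>w. H w = \<kappa>"
    using Liouville_theorem[OF H(1)] by (auto simp: constant_on_def)
  then have "f x = \<kappa> * g x" if "x \<noteq> 0" for x
    using H(2)[of "Ln x"] that by simp
  then show ?thesis by blast
qed

context elliptic_nome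
begin

subsection \<open>The three-term relation\<close>

definition theta_pair :: "complex \<Rightarrow> complex \<Rightarrow> complex \<Rightarrow> complex" where
  "theta_pair s x b = \<theta> (x * b) * \<theta> (x * s / b)"

text \<open>The multiplier does not involve \<open>x\<close>. For fixed \<open>s\<close> all theta
  pairs are thus functions of \<open>b\<close> with one and the same multiplier, which makes linear
  relations between them possible.\<close>

lemma theta_pair_p_times:
  assumes "p \<noteq> 0" "s \<noteq> 0" "x \<noteq> 0" "b \<noteq> 0"
  shows "theta_pair s x (p * b) = s / (p * b\<^sup>2) * theta_pair s x b"
proof -
  have "\<theta> (x * (p * b)) = - \<theta> (x * b) / (x * b)"
    using ellE_p_times[of "x * b"] assms by (simp add: mult_ac)
  moreover have "\<theta> (x * s / (p * b)) = - (x * s / (p * b)) * \<theta> (x * s / b)"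
    using ellE_over_p[of "x * s / b"] assms by (simp add: mult_ac)
  ultimately show ?thesis
    using assms by (simp only: theta_pair_def) (simp add: field_simps power2_eq_square)
qed

lemma theta_pair_sym: "s \<noteq> 0 \<Longrightarrow> b \<noteq> 0 \<Longrightarrow> theta_pair s x (s / b) = theta_pair s x b"
  by (simp add: theta_pair_def mult.commute)

lemma tendsto_theta_pair [tendsto_intros]:
  assumes "(x \<longlongrightarrow> x0) F" "(b \<longlongrightarrow> b0) F" "s \<noteq> 0" "x0 \<noteq> 0" "b0 \<noteq> 0"
  shows "((\<lambda>t. theta_pair s (x t) (b t)) \<longlongrightarrow> theta_pair s x0 b0) F"
  unfolding theta_pair_def by (intro tendsto_intros assms) (use assms in auto)

lemma holomorphic_theta_pair [holomorphic_intros]: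
  assumes "s \<noteq> 0" "x \<noteq> 0"
  shows "theta_pair s x holomorphic_on - {0}"
  unfolding theta_pair_def[abs_def] by (intro holomorphic_intros) (use assms in auto)

lemma ellE_zero_mult:
  assumes p: "p \<noteq> 0" and x: "x \<noteq> 0" "\<theta> x = 0" and y: "y \<noteq> 0"
  shows "\<theta> (x * y) = 0 \<longleftrightarrow> \<theta> y = 0"
proof -
  have up: "\<theta> (p ^ k * y) = 0 \<longleftrightarrow> \<theta> y = 0" if "y \<noteq> 0" for k y
    using that
  proof (induction k)
    case (Suc k)
    then show ?case using ellE_p_times[of "p ^ k * y"] p by (simp add: mult_ac)
  qed simp
  from ellE_eq_0D[OF x(2,1)] obtain k where k: "x * p ^ k = 1 \<or> x = p ^ Suc k" by blast
  then show ?thesis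
  proof
    assume "x * p ^ k = 1"
    then have "p ^ k * (x * y) = y" by (metis mult.assoc mult.commute mult_1)
    then show ?thesis using up[of "x * y" k] x y by (metis mult_eq_0_iff)
  next
    assume "x = p ^ Suc k"
    then show ?thesis using up[OF y, of "Suc k"] by simp
  qed
qed

definition weierstrass_defect ::
    "complex \<Rightarrow> complex \<Rightarrow> complex \<Rightarrow> complex \<Rightarrow> complex \<Rightarrow> complex" where
  "weierstrass_defect s x u v b =
     theta_pair s x b * (\<theta> (u * v * s) * \<theta> (u / v))
     - \<theta> (x * v * s) * \<theta> (x / v) * theta_pair s u b
     + u / v * (\<theta> (x * u * s) * \<theta> (x / u)) * theta_pair s v b"

lemma weierstrass_defect_at_u:
  assumes "s \<noteq> 0" "x \<noteq> 0" "u \<noteq> 0" "v \<noteq> 0"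
  shows "weierstrass_defect s x u v (1 / u) = 0"
proof -
  have "\<theta> (v / u) = - (v / u) * \<theta> (u / v)"
    using ellE_inverse[of "u / v"] assms by simp
  then show ?thesis
    using assms by (simp add: weierstrass_defect_def theta_pair_def) (simp add: mult_ac)
qed

lemma weierstrass_defect_at_v:
  assumes "s \<noteq> 0" "x \<noteq> 0" "u \<noteq> 0" "v \<noteq> 0"
  shows "weierstrass_defect s x u v (1 / v) = 0"
  using assms by (simp add: weierstrass_defect_def theta_pair_def field_simps)

text \<open>As a function of \<open>b\<close> the defect has the multiplier of
  \<open>theta_pair s u\<close> and vanishes at all zeros of that function, so it is a constant
  multiple of it. Since the defect also vanishes at \<open>1 / v\<close>, where
  \<open>theta_pair s u\<close> does not, the constant is 0.\<close>

lemma weierstrass_defect_generic: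
  assumes p: "p \<noteq> 0" and nz: "s \<noteq> 0" "x \<noteq> 0" "u \<noteq> 0" "v \<noteq> 0" "b \<noteq> 0"
    and gen: "\<theta> (u * u * s) \<noteq> 0" "\<theta> (u * v * s) \<noteq> 0" "\<theta> (u / v) \<noteq> 0"
  shows "weierstrass_defect s x u v b = 0"
proof -
  let ?W = "weierstrass_defect s x u v" and ?g = "theta_pair s u"
  have qW: "?W (p * y) = s / (p * y\<^sup>2) * ?W y" if "y \<noteq> 0" for y
    unfolding weierstrass_defect_def theta_pair_p_times[OF p nz(1) nz(2) that]
      theta_pair_p_times[OF p nz(1) nz(3) that] theta_pair_p_times[OF p nz(1) nz(4) that]
    by (simp add: algebra_simps)
  have symW: "?W (s / y) = ?W y" if "y \<noteq> 0" for y
    using nz that by (simp add: weierstrass_defect_def theta_pair_sym)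
  have W0: "?W (p * y) = 0 \<longleftrightarrow> ?W y = 0" if "y \<noteq> 0" for y
    using qW[OF that] nz p that by simp
  have W0n: "?W (p ^ k * y) = 0 \<longleftrightarrow> ?W y = 0" if "y \<noteq> 0" for k y
    using that
  proof (induction k)
    case (Suc k)
    then show ?case using W0[of "p ^ k * y"] p by (simp add: mult_ac)
  qed simp
  have zero: "?W y = 0" if y: "y \<noteq> 0" "\<theta> (u * y) = 0" for y
  proof -
    obtain k where k: "u * y * p ^ k = 1 \<or> u * y = p ^ Suc k"
      using ellE_eq_0D[OF y(2)] nz y by auto
    then have "p ^ k * y = 1 / u \<or> y = p ^ Suc k * (1 / u)"
      using nz by (auto simp: field_simps)
    moreover have "?W (1 / u) = 0" "1 / u \<noteq> 0"
      using nz by (auto intro: weierstrass_defect_at_u)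
    ultimately show ?thesis
      using W0n[OF y(1), of k] W0n[of "1 / u" "Suc k"] by auto
  qed
  have simple: "?W y = 0 \<and> deriv ?g y \<noteq> 0" if y: "y \<noteq> 0" "?g y = 0" for y
  proof
    have cases: "\<theta> (u * y) = 0 \<or> \<theta> (u * s / y) = 0"
      using y by (simp add: theta_pair_def)
    then show "?W y = 0"
      using zero[of y] zero[of "s / y"] symW[of y] y nz by auto
    have prod: "(u * y) * (u * s / y) = u * u * s"
      using y by simp
    have d\<theta>: "(\<theta> has_field_derivative deriv \<theta> z) (at z)" if "z \<noteq> 0" for z
      using holomorphic_derivI[OF ellE_holomorphic, of z] that by (auto simp: open_Compl)
    have d1: "((\<lambda>y. \<theta> (u * y)) has_field_derivative deriv \<theta> (u * y) * u) (at y)"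
      by (rule DERIV_chain2[OF d\<theta>]) (use y nz in \<open>auto intro!: derivative_eq_intros\<close>)
    have d2: "((\<lambda>y. \<theta> (u * s / y)) has_field_derivative deriv \<theta> (u * s / y) * (- u * s / y\<^sup>2)) (at y)"
      by (rule DERIV_chain2[OF d\<theta>])
        (use y nz in \<open>auto intro!: derivative_eq_intros simp: power2_eq_square\<close>)
    have dg: "deriv ?g y = deriv \<theta> (u * y) * u * \<theta> (u * s / y)
        + deriv \<theta> (u * s / y) * (- u * s / y\<^sup>2) * \<theta> (u * y)"
      using DERIV_imp_deriv[OF DERIV_mult[OF d1 d2]] by (simp add: theta_pair_def[abs_def])
    have sz: "deriv \<theta> z \<noteq> 0" if "z \<noteq> 0" "\<theta> z = 0" for z
      using ellE_simple_zero[OF p that] DERIV_imp_deriv by metis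
    show "deriv ?g y \<noteq> 0"
    proof (cases "\<theta> (u * y) = 0")
      case True
      \<comment> \<open>The arguments of the two factors have product \<open>u * u * s\<close>. As
        \<theta> does not vanish at this product, the factors have no common zero, and every zero of
        their product is simple.\<close>
      have "\<theta> (u * y * (u * s / y)) = 0 \<longleftrightarrow> \<theta> (u * s / y) = 0"
        using y nz by (intro ellE_zero_mult[OF p _ True]) auto
      then have "\<theta> (u * s / y) \<noteq> 0"
        using gen(1) unfolding prod by blast
      then show ?thesis using dg True sz[of "u * y"] y nz by simp
    next
      case False
      then have "\<theta> (u * s / y) = 0" using cases by simp
      then show ?thesis using dg False sz[of "u * s / y"] y nz by simp
    qed
  qed
  have "?W holomorphic_on - {0}"
    unfolding weierstrass_defect_def[abs_def] by (intro holomorphic_intros) (use nz in auto)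
  then obtain \<kappa> where \<kappa>: "\<And>y. y \<noteq> 0 \<Longrightarrow> ?W y = \<kappa> * ?g y"
    using quasiperiodic_proportional[of p ?W ?g "\<lambda>y. s / (p * y\<^sup>2)"] p norm_p nz qW simple
      theta_pair_p_times[of s u] holomorphic_theta_pair[of s u] by auto
  have "\<kappa> * (\<theta> (u / v) * \<theta> (u * v * s)) = 0"
    using \<kappa>[of "1 / v"] weierstrass_defect_at_v[of s x u v] nz
    by (simp add: theta_pair_def mult_ac)
  then show ?thesis
    using gen \<kappa>[of b] nz by simp
qed

section \<open>Countable exceptional sets and Weierstrass' relation\<close>

lemma countable_ellE_linear:
  assumes "c \<noteq> 0"
  shows "countable {u. u \<noteq> 0 \<and> \<theta> (c * u) = 0}"
proof (rule countable_subset)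
  show "{u. u \<noteq> 0 \<and> \<theta> (c * u) = 0} \<subseteq> (\<lambda>z. z / c) ` {x. x \<noteq> 0 \<and> \<theta> x = 0}"
    using assms by (auto simp: image_iff intro!: exI[of _ "c * _"])
qed (use countable_ellE_zeros in simp)

lemma countable_ellE_square:
  assumes "c \<noteq> 0"
  shows "countable {u. u \<noteq> 0 \<and> \<theta> (u * u * c) = 0}"
proof (rule countable_subset)
  show "{u. u \<noteq> 0 \<and> \<theta> (u * u * c) = 0} \<subseteq>
      (\<Union>z\<in>{x. x \<noteq> 0 \<and> \<theta> x = 0}. {u. u ^ 2 = z / c})"
  proof
    fix u assume "u \<in> {u. u \<noteq> 0 \<and> \<theta> (u * u * c) = 0}"
    then show "u \<in> (\<Union>z\<in>{x. x \<noteq> 0 \<and> \<theta> x = 0}. {u. u ^ 2 = z / c})"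
      using assms by (intro UN_I[of "u * u * c"]) (auto simp: power2_eq_square)
  qed
  show "countable (\<Union>z\<in>{x. x \<noteq> 0 \<and> \<theta> x = 0}. {u. u ^ 2 = z / c})"
    by (intro countable_UN countable_ellE_zeros countable_finite finite_nth_roots) auto
qed

text \<open>Discs are uncountable, so no neighbourhood of \<open>u\<close> lies inside
  \<open>C\<close>. This removes genericity conditions by continuity, both from the three-term
  relation and from the final theorem.\<close>

lemma eq_0_off_countable:
  fixes f :: "complex \<Rightarrow> complex"
  assumes "countable C" "isCont f u" "\<And>w. w \<notin> C \<Longrightarrow> f w = 0"
  shows "f u = 0"
proof (rule ccontr)
  assume "f u \<noteq> 0"
  then obtain r where r: "r > 0" "\<And>w. dist u w < r \<Longrightarrow> f w \<noteq> 0"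
    using continuous_at_avoid[of u f 0] assms(2) by blast
  then have "ball u r \<subseteq> C"
    using assms(3) by force
  then show False
    using uncountable_ball[of r u] r(1) assms(1) countable_subset by blast
qed

lemma weierstrass_three_term:
  assumes nz: "s \<noteq> 0" "x \<noteq> 0" "u \<noteq> 0" "v \<noteq> 0" "b \<noteq> 0"
  shows "theta_pair s x b * (\<theta> (u * v * s) * \<theta> (u / v)) =
     \<theta> (x * v * s) * \<theta> (x / v) * theta_pair s u b
     - u / v * (\<theta> (x * u * s) * \<theta> (x / u)) * theta_pair s v b"
proof -
  have "weierstrass_defect s x u v b = 0"
  proof (cases "p = 0")
    case True
    have E: "\<theta> y = 1 - y" for y
    proof -
      have "(\<lambda>k. (1 - y * p ^ k) * (1 - p ^ Suc k / y)) = (\<lambda>k. if k = 0 then 1 - y else 1)"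
        using True by (auto simp: fun_eq_iff)
      then show ?thesis
        using prodinf_finite[of "{0}" "\<lambda>k. if k = 0 then 1 - y else 1"]
        by (simp add: ellE_def)
    qed
    show ?thesis
      using nz by (simp add: weierstrass_defect_def theta_pair_def E field_simps)
  next
    case False
    \<comment> \<open>The generic lemma excludes only countably many \<open>u\<close>, and the
      defect is continuous in \<open>u\<close>.\<close>
    let ?C = "insert 0 ({u. u \<noteq> 0 \<and> \<theta> (u * u * s) = 0} \<union> {u. u \<noteq> 0 \<and> \<theta> ((v * s) * u) = 0}
      \<union> {u. u \<noteq> 0 \<and> \<theta> ((1 / v) * u) = 0})"
    show ?thesis
    proof (rule eq_0_off_countable[where C = ?C and f = "\<lambda>u. weierstrass_defect s x u v b"])
      show "countable ?C"
        using nz countable_ellE_linear[of "v * s"] countable_ellE_linear[of "1 / v"]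
          countable_ellE_square[of s] by simp
      show "isCont (\<lambda>u. weierstrass_defect s x u v b) u"
        unfolding isCont_def weierstrass_defect_def by (intro tendsto_intros) (use nz in auto)
      fix w assume "w \<notin> ?C"
      then show "weierstrass_defect s x w v b = 0"
        using False nz by (intro weierstrass_defect_generic) (auto simp: mult_ac)
    qed
  qed
  then show ?thesis
    by (simp add: weierstrass_defect_def algebra_simps)
qed

subsection \<open>Interpolation of theta forms\<close>

text \<open>The degree is built into the rules instead of being defined by a multiplier. No
  dimension of a space of theta functions has to be known, and \<open>p = 0\<close> needs no
  separate treatment.\<close>

inductive theta_form :: "complex \<Rightarrow> nat \<Rightarrow> (complex \<Rightarrow> complex) \<Rightarrow> bool" for s where
  const: "theta_form s 0 (\<lambda>b. c)"
| mult_pair: "x \<noteq> 0 \<Longrightarrow> theta_form s n F \<Longrightarrow> theta_form s (Suc n) (\<lambda>b. theta_pair s x b * F b)"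
| add: "theta_form s n F \<Longrightarrow> theta_form s n G \<Longrightarrow> theta_form s n (\<lambda>b. F b + G b)"
| scale: "theta_form s n F \<Longrightarrow> theta_form s n (\<lambda>b. c * F b)"

lemma theta_form_zero: "theta_form s n (\<lambda>b. 0)"
proof (induction n)
  case (Suc n)
  then show ?case
    using theta_form.mult_pair[of 1 s n "\<lambda>b. 0"] by simp
qed (rule theta_form.const)

lemma theta_form_diff: "theta_form s n F \<Longrightarrow> theta_form s n G \<Longrightarrow> theta_form s n (\<lambda>b. F b - G b)"
  using theta_form.add[of s n F "\<lambda>b. (-1) * G b"] theta_form.scale[of s n G "-1"] by simp

lemma theta_form_sum:
  "(\<And>k. k \<in> I \<Longrightarrow> theta_form s n (F k)) \<Longrightarrow> theta_form s n (\<lambda>b. \<Sum>k\<in>I. F k b)"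
proof (induction I rule: infinite_finite_induct)
  case (insert k I)
  then show ?case using theta_form.add[of s n "F k" "\<lambda>b. \<Sum>k\<in>I. F k b"] by simp
qed (auto intro: theta_form_zero)

lemma theta_form_mult:
  assumes "theta_form s m F" "theta_form s n G"
  shows "theta_form s (m + n) (\<lambda>b. F b * G b)"
  using assms(1)
proof induction
  case (const c)
  then show ?case using theta_form.scale[OF assms(2)] by simp
next
  case (mult_pair x m F)
  then show ?case using theta_form.mult_pair[of x s "m + n"] by (simp add: mult.assoc)
next
  case (add m F F')
  then show ?case using theta_form.add by (fastforce simp: algebra_simps)
next
  case (scale m F c)
  then show ?case using theta_form.scale by (fastforce simp: mult.assoc)
qed

text \<open>By the three-term relation any two independent theta pairs span all of them.\<close>

lemma theta_form_split:
  assumes F: "theta_form s n F" and nz: "s \<noteq> 0" "w \<noteq> 0" "v \<noteq> 0"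
    and ind: "\<theta> (w * v * s) \<noteq> 0" "\<theta> (w / v) \<noteq> 0"
  shows "\<exists>\<kappa> G. (n = 0 \<and> G = (\<lambda>_. 0) \<or> (\<exists>m. n = Suc m \<and> theta_form s m G)) \<and>
    (\<forall>b. b \<noteq> 0 \<longrightarrow> F b = theta_pair s w b * G b + \<kappa> * theta_pair s v b ^ n)"
  using F
proof induction
  \<comment> \<open>There is no degree below 0 for the cofactor of \<open>theta_pair s w\<close>,
    hence the disjunct with the zero function.\<close>
  case (const c)
  then show ?case by (intro exI[of _ c] exI[of _ "\<lambda>_. 0"]) simp
next
  case (mult_pair x n F)
  define D where "D = \<theta> (w * v * s) * \<theta> (w / v)"
  have D: "D \<noteq> 0" using ind by (simp add: D_def)
  define \<alpha> where "\<alpha> = \<theta> (x * v * s) * \<theta> (x / v) / D"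
  define \<beta> where "\<beta> = - (w / v * (\<theta> (x * w * s) * \<theta> (x / w))) / D"
  have x: "theta_pair s x b = \<alpha> * theta_pair s w b + \<beta> * theta_pair s v b" if "b \<noteq> 0" for b
  proof -
    have "theta_pair s x b * D = \<theta> (x * v * s) * \<theta> (x / v) * theta_pair s w b
        - w / v * (\<theta> (x * w * s) * \<theta> (x / w)) * theta_pair s v b"
      unfolding D_def using nz mult_pair(1) that by (intro weierstrass_three_term)
    then have "theta_pair s x b = (\<theta> (x * v * s) * \<theta> (x / v) * theta_pair s w b
        - w / v * (\<theta> (x * w * s) * \<theta> (x / w)) * theta_pair s v b) / D"
      by (rule eq_divide_imp[OF D])
    then show ?thesis
      by (simp only: \<alpha>_def \<beta>_def diff_divide_distrib) simp
  qed
  obtain \<kappa> G where S: "(n = 0 \<and> G = (\<lambda>_. 0) \<or> (\<exists>m. n = Suc m \<and> theta_form s m G)) \<and>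
      (\<forall>b. b \<noteq> 0 \<longrightarrow> F b = theta_pair s w b * G b + \<kappa> * theta_pair s v b ^ n)"
    using mult_pair.IH by (elim exE)
  note G = conjunct1[OF S] and F = conjunct2[OF S, rule_format]
  \<comment> \<open>Substitute the combination for \<open>theta_pair s x\<close> and split
    \<open>F\<close> only in the term with \<open>theta_pair s v\<close>: everything divisible by
    \<open>theta_pair s w\<close> is collected in \<open>G'\<close>, the rest is a power of
    \<open>theta_pair s v\<close>.\<close>
  define G' where "G' b = \<alpha> * F b + \<beta> * (theta_pair s v b * G b)" for b
  have "theta_form s n G'"
    using G
  proof
    assume "n = 0 \<and> G = (\<lambda>_. 0)"
    then show ?thesis
      using theta_form.scale[OF mult_pair(2), of \<alpha>] by (simp add: G'_def[abs_def])
  next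
    assume "\<exists>m. n = Suc m \<and> theta_form s m G"
    then obtain m where m: "n = Suc m" "theta_form s m G" by blast
    have "theta_form s n (\<lambda>b. theta_pair s v b * G b)"
      unfolding m(1) by (rule theta_form.mult_pair[OF nz(3) m(2)])
    from theta_form.add[OF theta_form.scale[OF mult_pair(2), of \<alpha>] theta_form.scale[OF this, of \<beta>]]
    show ?thesis
      unfolding G'_def[abs_def] .
  qed
  moreover have "theta_pair s x b * F b = theta_pair s w b * G' b + (\<beta> * \<kappa>) * theta_pair s v b ^ Suc n"
    if "b \<noteq> 0" for b
  proof -
    have "theta_pair s x b * F b = (\<alpha> * theta_pair s w b + \<beta> * theta_pair s v b) * F b"
      by (simp only: x[OF that])
    also have "\<dots> = theta_pair s w b * (\<alpha> * F b) + \<beta> * theta_pair s v b * F b"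
      by (simp add: algebra_simps)
    also have "\<beta> * theta_pair s v b * F b =
        \<beta> * theta_pair s v b * (theta_pair s w b * G b + \<kappa> * theta_pair s v b ^ n)"
      by (simp only: F[OF that])
    finally show ?thesis
      by (simp add: G'_def algebra_simps)
  qed
  ultimately have "theta_form s n G' \<and> (\<forall>b. b \<noteq> 0 \<longrightarrow> theta_pair s x b * F b =
      theta_pair s w b * G' b + (\<beta> * \<kappa>) * theta_pair s v b ^ Suc n)"
    by blast
  then show ?case
    by (intro exI[of _ "\<beta> * \<kappa>"] exI[of _ G']) simp
next
  case (add n F1 F2)
  obtain \<kappa>1 G1 where S1: "(n = 0 \<and> G1 = (\<lambda>_. 0) \<or> (\<exists>m. n = Suc m \<and> theta_form s m G1)) \<and>
      (\<forall>b. b \<noteq> 0 \<longrightarrow> F1 b = theta_pair s w b * G1 b + \<kappa>1 * theta_pair s v b ^ n)"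
    using add.IH(1) by (elim exE)
  note G1 = conjunct1[OF S1] and F1 = conjunct2[OF S1, rule_format]
  obtain \<kappa>2 G2 where S2: "(n = 0 \<and> G2 = (\<lambda>_. 0) \<or> (\<exists>m. n = Suc m \<and> theta_form s m G2)) \<and>
      (\<forall>b. b \<noteq> 0 \<longrightarrow> F2 b = theta_pair s w b * G2 b + \<kappa>2 * theta_pair s v b ^ n)"
    using add.IH(2) by (elim exE)
  note G2 = conjunct1[OF S2] and F2 = conjunct2[OF S2, rule_format]
  have "n = 0 \<and> (\<lambda>b. G1 b + G2 b) = (\<lambda>_. 0) \<or> (\<exists>m. n = Suc m \<and> theta_form s m (\<lambda>b. G1 b + G2 b))"
  proof (cases n)
    case 0
    then show ?thesis using G1 G2 by simp
  next
    case (Suc m)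
    then have "theta_form s m (\<lambda>b. G1 b + G2 b)"
      using G1 G2 by (intro theta_form.add) simp_all
    then show ?thesis using Suc by simp
  qed
  moreover have "F1 b + F2 b = theta_pair s w b * (G1 b + G2 b) + (\<kappa>1 + \<kappa>2) * theta_pair s v b ^ n"
    if "b \<noteq> 0" for b
    using that by (simp add: F1 F2 algebra_simps)
  ultimately show ?case
    by (intro exI[of _ "\<kappa>1 + \<kappa>2"] exI[of _ "\<lambda>b. G1 b + G2 b"]) simp
next
  case (scale n F c)
  obtain \<kappa> G where S: "(n = 0 \<and> G = (\<lambda>_. 0) \<or> (\<exists>m. n = Suc m \<and> theta_form s m G)) \<and>
      (\<forall>b. b \<noteq> 0 \<longrightarrow> F b = theta_pair s w b * G b + \<kappa> * theta_pair s v b ^ n)"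
    using scale.IH by (elim exE)
  note G = conjunct1[OF S] and F = conjunct2[OF S, rule_format]
  have "n = 0 \<and> (\<lambda>b. c * G b) = (\<lambda>_. 0) \<or> (\<exists>m. n = Suc m \<and> theta_form s m (\<lambda>b. c * G b))"
    using G by (auto intro: theta_form.scale)
  moreover have "c * F b = theta_pair s w b * (c * G b) + (c * \<kappa>) * theta_pair s v b ^ n"
    if "b \<noteq> 0" for b
    using that by (simp add: F algebra_simps)
  ultimately show ?case by blast
qed

lemma exists_ellE_nonzero:
  assumes "c \<noteq> 0" "c' \<noteq> 0"
  shows "\<exists>v. v \<noteq> 0 \<and> \<theta> (c * v) \<noteq> 0 \<and> \<theta> (c' * v) \<noteq> 0"
proof -
  define C where "C = {0} \<union> {v. v \<noteq> 0 \<and> \<theta> (c * v) = 0} \<union> {v. v \<noteq> 0 \<and> \<theta> (c' * v) = 0}"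
  have "countable C"
    using countable_ellE_linear[OF assms(1)] countable_ellE_linear[OF assms(2)] by (simp add: C_def)
  then have "C \<noteq> UNIV"
    using uncountable_UNIV_complex by metis
  then obtain v where "v \<notin> C"
    by blast
  then show ?thesis by (intro exI[of _ v]) (auto simp: C_def)
qed

lemma ellE_inverse_eq_0_iff: "x \<noteq> 0 \<Longrightarrow> \<theta> (1 / x) = 0 \<longleftrightarrow> \<theta> x = 0"
  by (simp add: ellE_inverse)

lemma ellE_swap_eq_0_iff: "x \<noteq> 0 \<Longrightarrow> y \<noteq> 0 \<Longrightarrow> \<theta> (x / y) = 0 \<longleftrightarrow> \<theta> (y / x) = 0"
  using ellE_inverse_eq_0_iff[of "x / y"] by simp

text \<open>Split with \<open>w = 1 / t n\<close>, so that \<open>theta_pair s w\<close> vanishes at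
  the last point, and with \<open>v\<close> such that \<open>theta_pair s v\<close> does not.
  Evaluation at \<open>t n\<close> removes the pure power; the cofactor has degree
  \<open>n - 1\<close> and vanishes at the other points, because inequivalence keeps
  \<open>theta_pair s w\<close> nonzero there.\<close>

lemma theta_form_eq_0:
  assumes "theta_form s n F" "s \<noteq> 0" "\<And>i. i \<le> n \<Longrightarrow> t i \<noteq> 0" "\<And>i. i \<le> n \<Longrightarrow> F (t i) = 0"
    and "\<And>i j. i < j \<Longrightarrow> j \<le> n \<Longrightarrow> \<theta> (t i / t j) \<noteq> 0 \<and> \<theta> (t i * t j / s) \<noteq> 0"
    and "b \<noteq> 0"
  shows "F b = 0"
  using assms
proof (induction n arbitrary: F b)
  case 0
  have t0: "t 0 \<noteq> 0" "F (t 0) = 0" using 0(3,4) by auto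
  obtain v where v: "v \<noteq> 0" "\<theta> ((s / t 0) * v) \<noteq> 0" "\<theta> (t 0 * v) \<noteq> 0"
    using exists_ellE_nonzero[of "s / t 0" "t 0"] t0 0(2) by auto
  have "\<theta> (1 / t 0 * v * s) \<noteq> 0" "\<theta> (1 / t 0 / v) \<noteq> 0"
    using v t0 ellE_inverse_eq_0_iff[of "t 0 * v"] by (simp_all add: mult.commute)
  then have "\<exists>\<kappa> G. (0 = (0::nat) \<and> G = (\<lambda>_. 0) \<or> (\<exists>m. 0 = Suc m \<and> theta_form s m G)) \<and>
      (\<forall>b. b \<noteq> 0 \<longrightarrow> F b = theta_pair s (1 / t 0) b * G b + \<kappa> * theta_pair s v b ^ 0)"
    using v(1) t0(1) by (intro theta_form_split[OF 0(1,2)]) auto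
  then obtain \<kappa> G where "(0 = (0::nat) \<and> G = (\<lambda>_. 0) \<or> (\<exists>m. 0 = Suc m \<and> theta_form s m G)) \<and>
      (\<forall>b. b \<noteq> 0 \<longrightarrow> F b = theta_pair s (1 / t 0) b * G b + \<kappa> * theta_pair s v b ^ 0)"
    by (elim exE)
  then have "F b = \<kappa>" if "b \<noteq> 0" for b
    using that by simp
  then show ?case using t0 0(6) by simp
next
  case (Suc n)
  let ?r = "t (Suc n)"
  have r: "?r \<noteq> 0" using Suc.prems(3) by simp
  obtain v where v: "v \<noteq> 0" "\<theta> ((s / ?r) * v) \<noteq> 0" "\<theta> (?r * v) \<noteq> 0"
    using exists_ellE_nonzero[of "s / ?r" "?r"] r Suc.prems(2) by auto
  have "\<theta> (1 / ?r * v * s) \<noteq> 0" "\<theta> (1 / ?r / v) \<noteq> 0"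
    using v r ellE_inverse_eq_0_iff[of "?r * v"] by (simp_all add: mult.commute)
  then have "\<exists>\<kappa> G. (Suc n = 0 \<and> G = (\<lambda>_. 0) \<or> (\<exists>m. Suc n = Suc m \<and> theta_form s m G)) \<and>
      (\<forall>b. b \<noteq> 0 \<longrightarrow> F b = theta_pair s (1 / ?r) b * G b + \<kappa> * theta_pair s v b ^ Suc n)"
    using v(1) r by (intro theta_form_split[OF Suc.prems(1,2)]) auto
  then obtain \<kappa> G where S: "(Suc n = 0 \<and> G = (\<lambda>_. 0) \<or> (\<exists>m. Suc n = Suc m \<and> theta_form s m G)) \<and>
      (\<forall>b. b \<noteq> 0 \<longrightarrow> F b = theta_pair s (1 / ?r) b * G b + \<kappa> * theta_pair s v b ^ Suc n)"
    by (elim exE)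
  have G: "theta_form s n G"
    using conjunct1[OF S] by simp
  note F = conjunct2[OF S, rule_format]
  have "\<kappa> = 0"
    using F[OF r] Suc.prems(4)[of "Suc n"] r v by (simp add: theta_pair_def mult.commute)
  have G0: "G (t i) = 0" if "i \<le> n" for i
  proof -
    have ti: "t i \<noteq> 0" using Suc.prems(3)[of i] that by simp
    have "\<theta> (t i / ?r) \<noteq> 0" "\<theta> (t i * ?r / s) \<noteq> 0"
      using Suc.prems(5)[of i "Suc n"] that by auto
    then have "theta_pair s (1 / ?r) (t i) \<noteq> 0"
      using ellE_swap_eq_0_iff[of "t i * ?r" s] ti r Suc.prems(2)
      by (simp add: theta_pair_def mult.commute)
    then show ?thesis
      using F[OF ti] Suc.prems(4)[of i] that \<open>\<kappa> = 0\<close> by simp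
  qed
  have t0: "t i \<noteq> 0" if "i \<le> n" for i
    using Suc.prems(3) that by simp
  have sep: "\<theta> (t i / t j) \<noteq> 0 \<and> \<theta> (t i * t j / s) \<noteq> 0" if "i < j" "j \<le> n" for i j
    using Suc.prems(5)[of i j] that by simp
  have "G b = 0"
    by (rule Suc.IH[OF G Suc.prems(2) t0 G0 sep Suc.prems(6)])
  then show ?case
    using F[OF Suc.prems(6)] \<open>\<kappa> = 0\<close> by simp
qed

subsection \<open>Shifted factorials\<close>

definition tfac :: "complex \<Rightarrow> complex \<Rightarrow> nat \<Rightarrow> complex" where
  "tfac q x k = (\<Prod>j<k. \<theta> (x * q ^ j))"

lemma tfac_0 [simp]: "tfac q x 0 = 1"
  and tfac_Suc: "tfac q x (Suc k) = tfac q x k * \<theta> (x * q ^ k)"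
  by (simp_all add: tfac_def)

lemma tfac_add: "tfac q x (m + n) = tfac q x m * tfac q (x * q ^ m) n"
  by (induction n) (simp_all add: tfac_Suc power_add mult_ac)

lemma tfac_eq_0: "j < k \<Longrightarrow> \<theta> (x * q ^ j) = 0 \<Longrightarrow> tfac q x k = 0"
  by (auto simp: tfac_def)

lemma tfac_nonzero: "(\<And>j. j < k \<Longrightarrow> \<theta> (x * q ^ j) \<noteq> 0) \<Longrightarrow> tfac q x k \<noteq> 0"
  by (simp add: tfac_def)

lemma tfac_one: "k > 0 \<Longrightarrow> tfac q 1 k = 0"
  by (rule tfac_eq_0[of 0]) auto

lemma tfac_swap: "tfac q x n * tfac q (x * q ^ n) m = tfac q x m * tfac q (x * q ^ m) n"
  using tfac_add[of q x m n] tfac_add[of q x n m] by (simp add: add.commute)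

definition reflect_factor :: "complex \<Rightarrow> complex \<Rightarrow> nat \<Rightarrow> complex" where
  "reflect_factor q x n = (\<Prod>j<n. - 1 / (x * q ^ j))"

text \<open>Reversing the order of the factors makes their arguments reciprocal to those of
  \<open>x\<close>, and \<open>ellE_inverse\<close> applies to each. The guard \<open>n > 0\<close>
  is there because \<open>n - 1\<close> is truncated subtraction.\<close>

lemma tfac_reflect:
  assumes "q \<noteq> 0" "x \<noteq> 0" "n > 0 \<Longrightarrow> x * y * q ^ (n - 1) = 1"
  shows "tfac q y n = reflect_factor q x n * tfac q x n"
proof -
  have "tfac q y n = (\<Prod>j<n. \<theta> (y * q ^ (n - Suc j)))"
    unfolding tfac_def by (rule prod.nat_diff_reindex[symmetric])
  also have "\<dots> = (\<Prod>j<n. - 1 / (x * q ^ j) * \<theta> (x * q ^ j))"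
  proof (rule prod.cong)
    fix j assume "j \<in> {..<n}"
    then have "q ^ (n - 1) = q ^ (n - Suc j) * q ^ j" "n > 0"
      by (auto simp: power_add[symmetric])
    then have "x * y * (q ^ (n - Suc j) * q ^ j) = 1"
      using assms(3) by simp
    then have "y * q ^ (n - Suc j) = 1 / (x * q ^ j)"
      using assms(1,2) by (simp add: eq_divide_eq mult_ac)
    then show "\<theta> (y * q ^ (n - Suc j)) = - 1 / (x * q ^ j) * \<theta> (x * q ^ j)"
      using assms ellE_inverse[of "x * q ^ j"] by simp
  qed simp
  also have "\<dots> = reflect_factor q x n * tfac q x n"
    by (simp only: prod.distrib reflect_factor_def tfac_def)
  finally show ?thesis .
qed

lemma reflect_factor_nonzero: "q \<noteq> 0 \<Longrightarrow> x \<noteq> 0 \<Longrightarrow> reflect_factor q x n \<noteq> 0"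
  by (simp add: reflect_factor_def)

text \<open>Lets the scalars of two reflections cancel against those of two others without
  evaluating any of them.\<close>

lemma reflect_factor_mult:
  assumes "x * y = z * w"
  shows "reflect_factor q x n * reflect_factor q y n = reflect_factor q z n * reflect_factor q w n"
proof -
  have *: "- 1 / (a * q ^ j) * (- 1 / (b * q ^ j)) = 1 / ((a * b) * (q ^ j * q ^ j))" for a b j
    by (simp add: mult_ac)
  show ?thesis
    by (simp only: reflect_factor_def prod.distrib[symmetric] * assms)
qed

text \<open>All integral shifts are included, so the condition passes to every parameter that an
  induction produces, in whichever direction it is shifted.\<close>

definition regular :: "complex \<Rightarrow> complex \<Rightarrow> bool" where
  "regular q x \<longleftrightarrow> (\<forall>m::int. \<theta> (x * q powi m) \<noteq> 0)"

text \<open>The shift is expressed by two natural exponents, which keeps integer powers out of the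
  many side conditions to be checked.\<close>

lemma regular_shift:
  assumes "regular q x" "q \<noteq> 0" "y * q ^ i = x * q ^ j"
  shows "regular q y"
  unfolding regular_def
proof
  fix m :: int
  have "y * q powi m = x * q powi (int j - int i + m)"
    using assms(2,3) by (simp add: power_int_add power_int_diff field_simps)
  then show "\<theta> (y * q powi m) \<noteq> 0"
    using assms(1) by (simp add: regular_def)
qed

lemma regular_inverse:
  assumes "regular q x" "x \<noteq> 0" "q \<noteq> 0"
  shows "regular q (1 / x)"
  unfolding regular_def
proof
  fix m :: int
  have "1 / x * q powi m = 1 / (x * q powi (- m))"
    using assms by (simp add: power_int_minus field_simps)
  then show "\<theta> (1 / x * q powi m) \<noteq> 0"
    using assms ellE_inverse_eq_0_iff[of "x * q powi (- m)"] by (simp add: regular_def)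
qed

lemma regular_swap: "regular q (x / y) \<Longrightarrow> x \<noteq> 0 \<Longrightarrow> y \<noteq> 0 \<Longrightarrow> q \<noteq> 0 \<Longrightarrow> regular q (y / x)"
  using regular_inverse[of q "x / y"] by simp

lemma regularD: "regular q x \<Longrightarrow> \<theta> (x * q ^ j) \<noteq> 0"
  using spec[of "\<lambda>m::int. \<theta> (x * q powi m) \<noteq> 0" "int j"] by (simp add: regular_def)

lemma regularD0: "regular q x \<Longrightarrow> \<theta> x \<noteq> 0"
  using regularD[of q x 0] by simp

lemma regularE:
  assumes "regular q x" "q \<noteq> 0" "y * q ^ i = x * q ^ j"
  shows "\<theta> y \<noteq> 0"
  using regularD0[OF regular_shift[OF assms]] .

lemma regular_tfac:
  assumes "regular q x" "q \<noteq> 0" "y * q ^ i = x * q ^ j"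
  shows "tfac q y k \<noteq> 0"
  by (rule tfac_nonzero) (rule regularD[OF regular_shift[OF assms]])

text \<open>With \<open>c = s / b\<close>, \<open>pairfac q s s b k\<close> is \<open>(b, c; q)\<^sub>k\<close> and \<open>pairfac q s (a * q) b k\<close> is
  \<open>(a q / b, a q / c; q)\<^sub>k\<close>: fixing \<open>b c = s\<close> makes both theta forms in \<open>b\<close>.\<close>

definition pairfac :: "complex \<Rightarrow> complex \<Rightarrow> complex \<Rightarrow> complex \<Rightarrow> nat \<Rightarrow> complex" where
  "pairfac q s u b k = tfac q (u / b) k * tfac q (u * b / s) k"

lemma pairfac_add: "pairfac q s u b (m + n) = pairfac q s u b m * pairfac q s (u * q ^ m) b n"
  by (simp add: pairfac_def tfac_add mult_ac)

text \<open>The factors with exponent \<open>j\<close> form the theta pair with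
  \<open>x = u * q ^ j / s\<close>.\<close>

lemma theta_form_pairfac:
  assumes "q \<noteq> 0" "s \<noteq> 0" "u \<noteq> 0"
  shows "theta_form s k (\<lambda>b. pairfac q s u b k)"
proof (induction k)
  case 0
  then show ?case
    using theta_form.const[of s 1] by (simp add: pairfac_def)
next
  case (Suc k)
  have "pairfac q s u b (Suc k) = theta_pair s (u * q ^ k / s) b * pairfac q s u b k" for b
    using assms by (simp add: pairfac_def theta_pair_def tfac_Suc mult_ac)
  then show ?case
    using theta_form.mult_pair[OF _ Suc, of "u * q ^ k / s"] assms by simp
qed

lemma tfac_Suc_shift: "tfac q x (Suc k) = \<theta> x * tfac q (x * q) k"
  using tfac_add[of q x 1 k] by (simp add: tfac_Suc)

section \<open>Indefinite summation and very-well-poised series\<close>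

lemma telescoping_identity:
  assumes "b \<noteq> 0" "c \<noteq> 0" "d \<noteq> 0" "x \<noteq> 0" "a = b * c * d"
  shows "\<theta> (a * x) * \<theta> (b * x) * \<theta> (c * x) * \<theta> (d * x) =
    \<theta> x * \<theta> (a * x / b) * \<theta> (a * x / c) * \<theta> (a * x / d)
    + x * \<theta> (a * x\<^sup>2) * \<theta> b * \<theta> c * \<theta> d"
proof -
  have "theta_pair (c * d) (b * x) (c * d) * (\<theta> (x * (1 / d) * (c * d)) * \<theta> (x / (1 / d))) =
     \<theta> (b * x * (1 / d) * (c * d)) * \<theta> (b * x / (1 / d)) * theta_pair (c * d) x (c * d)
     - x / (1 / d) * (\<theta> (b * x * x * (c * d)) * \<theta> (b * x / x)) * theta_pair (c * d) (1 / d) (c * d)"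
    by (rule weierstrass_three_term) (use assms in auto)
  moreover have "\<theta> (1 / d) = - \<theta> d / d"
    using assms by (simp add: ellE_inverse)
  ultimately show ?thesis
    using assms by (simp add: theta_pair_def power2_eq_square mult_ac)
qed

text \<open>When \<open>a = b c d\<close> the series can be summed up to any limit \<open>m\<close>,
  without a terminating parameter. The step to \<open>m + 1\<close> is
  \<open>telescoping_identity\<close> at \<open>x = q ^ Suc m\<close>.\<close>

lemma telescoping_sum:
  assumes nz: "q \<noteq> 0" "b \<noteq> 0" "c \<noteq> 0" "d \<noteq> 0" "a = b * c * d" and a: "\<theta> a \<noteq> 0"
    and den: "tfac q q m \<noteq> 0" "tfac q (a * q / b) m \<noteq> 0" "tfac q (a * q / c) m \<noteq> 0"
      "tfac q (a * q / d) m \<noteq> 0"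
  shows "(\<Sum>k\<le>m. \<theta> (a * q ^ (2 * k)) / \<theta> a * q ^ k *
      (tfac q a k * tfac q b k * tfac q c k * tfac q d k) /
      (tfac q q k * tfac q (a * q / b) k * tfac q (a * q / c) k * tfac q (a * q / d) k)) =
    (tfac q (a * q) m * tfac q (b * q) m * tfac q (c * q) m * tfac q (d * q) m) /
      (tfac q q m * tfac q (a * q / b) m * tfac q (a * q / c) m * tfac q (a * q / d) m)"
  using den
proof (induction m)
  case (Suc m)
  define x where "x = q ^ Suc m"
  define N where "N = tfac q (a * q) m * tfac q (b * q) m * tfac q (c * q) m * tfac q (d * q) m"
  define D where "D = tfac q q m * tfac q (a * q / b) m * tfac q (a * q / c) m * tfac q (a * q / d) m"
  define E where "E = \<theta> x * \<theta> (a * x / b) * \<theta> (a * x / c) * \<theta> (a * x / d)"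
  have den': "tfac q q (Suc m) * tfac q (a * q / b) (Suc m) * tfac q (a * q / c) (Suc m) *
      tfac q (a * q / d) (Suc m) = D * E"
    by (simp add: D_def E_def x_def tfac_Suc mult_ac)
  have DE: "D * E \<noteq> 0"
    using Suc.prems den' by (metis mult_eq_0_iff)
  have D: "tfac q q m \<noteq> 0" "tfac q (a * q / b) m \<noteq> 0" "tfac q (a * q / c) m \<noteq> 0"
      "tfac q (a * q / d) m \<noteq> 0"
    using DE by (auto simp: D_def)
  have num: "tfac q (a * q) (Suc m) * tfac q (b * q) (Suc m) * tfac q (c * q) (Suc m) *
      tfac q (d * q) (Suc m) = N * (\<theta> (a * x) * \<theta> (b * x) * \<theta> (c * x) * \<theta> (d * x))"
    by (simp add: N_def x_def tfac_Suc mult_ac)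
  have num': "tfac q a (Suc m) * tfac q b (Suc m) * tfac q c (Suc m) * tfac q d (Suc m) =
      N * (\<theta> a * \<theta> b * \<theta> c * \<theta> d)"
    by (simp add: N_def tfac_Suc_shift mult_ac)
  have "x \<noteq> 0" using nz by (simp add: x_def)
  have "q ^ (2 * Suc m) = x\<^sup>2"
    by (simp only: x_def power_even_eq)
  then have "N / D + \<theta> (a * q ^ (2 * Suc m)) / \<theta> a * x * (N * (\<theta> a * \<theta> b * \<theta> c * \<theta> d)) / (D * E) =
      N * (E + x * \<theta> (a * x\<^sup>2) * \<theta> b * \<theta> c * \<theta> d) / (D * E)"
    using DE a by (simp add: field_simps)
  also have "E + x * \<theta> (a * x\<^sup>2) * \<theta> b * \<theta> c * \<theta> d = \<theta> (a * x) * \<theta> (b * x) * \<theta> (c * x) * \<theta> (d * x)"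
    unfolding E_def by (rule telescoping_identity[symmetric]) (use nz \<open>x \<noteq> 0\<close> in auto)
  finally show ?case
    unfolding sum.atMost_Suc Suc.IH[OF D] num num' den' N_def[symmetric] D_def[symmetric]
      x_def[symmetric] .
qed (simp add: a)

text \<open>A terminating very-well-poised series is written as a sum of \<open>wp_weight * wp_pair\<close>. The
  second factor collects everything that depends on \<open>n\<close> and on one pair \<open>b, s / b\<close> of
  parameters, the first one the remaining parameters.\<close>

definition wp_weight :: "complex \<Rightarrow> complex \<Rightarrow> complex list \<Rightarrow> nat \<Rightarrow> complex" where
  "wp_weight q a xs k = \<theta> (a * q ^ (2 * k)) / \<theta> a * q ^ k * (tfac q a k / tfac q q k) *
     (\<Prod>x\<leftarrow>xs. tfac q x k / tfac q (a * q / x) k)"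

definition wp_pair :: "complex \<Rightarrow> complex \<Rightarrow> complex \<Rightarrow> complex \<Rightarrow> nat \<Rightarrow> nat \<Rightarrow> complex" where
  "wp_pair q a s b n k = tfac q (1 / q ^ n) k * pairfac q s s b k /
     (tfac q (a * q ^ (n + 1)) k * pairfac q s (a * q) b k)"

text \<open>One shape for two products: with \<open>x = a q\<close>, the choice
  \<open>y = a q / d\<close> gives the value of the Frenkel--Turaev sum and \<open>y = l q\<close>
  the prefactor of Bailey's transformation.\<close>

definition wp_prefactor :: "complex \<Rightarrow> complex \<Rightarrow> complex \<Rightarrow> complex \<Rightarrow> complex \<Rightarrow> nat \<Rightarrow> complex" where
  "wp_prefactor q x y s b n = tfac q x n * tfac q (x / s) n * pairfac q s y b n /
     (tfac q y n * tfac q (y / s) n * pairfac q s x b n)"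

lemma tfac_negative_power: "q \<noteq> 0 \<Longrightarrow> n < k \<Longrightarrow> tfac q (1 / q ^ n) k = 0"
  by (rule tfac_eq_0[of n]) auto

text \<open>At \<open>b = q\<^sup>-\<^sup>m\<close> the parameters \<open>b\<close> and \<open>q\<^sup>-\<^sup>n\<close> exchange their roles.\<close>

lemma wp_pair_exchange:
  assumes "q \<noteq> 0" "s \<noteq> 0"
  shows "wp_pair q a s (1 / q ^ m) n k = wp_pair q a (s * q ^ m / q ^ n) (1 / q ^ n) m k"
  using assms by (simp add: wp_pair_def pairfac_def power_add mult_ac)

text \<open>After the exchange the series stops at \<open>m\<close>. A value at
  \<open>b = q^-m\<close> is therefore an instance of length \<open>m\<close>, with \<open>s\<close>
  replaced by \<open>s q^(m-n)\<close>, to which an induction hypothesis applies.\<close>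

lemma sum_wp_pair_exchange:
  assumes "q \<noteq> 0" "s \<noteq> 0" "m \<le> n"
  shows "(\<Sum>k\<le>n. W k * wp_pair q a s (1 / q ^ m) n k) =
    (\<Sum>k\<le>m. W k * wp_pair q a (s * q ^ m / q ^ n) (1 / q ^ n) m k)"
proof -
  have "(\<Sum>k\<le>n. W k * wp_pair q a s (1 / q ^ m) n k) =
      (\<Sum>k\<le>n. W k * wp_pair q a (s * q ^ m / q ^ n) (1 / q ^ n) m k)"
    by (simp only: wp_pair_exchange[OF assms(1,2)])
  also have "\<dots> = (\<Sum>k\<le>m. W k * wp_pair q a (s * q ^ m / q ^ n) (1 / q ^ n) m k)"
    by (rule sum.mono_neutral_right)
      (use assms in \<open>auto simp: wp_pair_def tfac_negative_power\<close>)
  finally show ?thesis .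
qed

text \<open>By \<open>tfac_swap\<close> the quotient of \<open>tfac q z n\<close> by
  \<open>tfac q (z * q ^ m) n\<close> is symmetric in \<open>m\<close> and \<open>n\<close>; the
  factors involving \<open>s\<close> obey the analogous rule with \<open>z / q ^ m\<close>.\<close>

lemma wp_prefactor_exchange:
  assumes nz: "q \<noteq> 0" "s \<noteq> 0" "x \<noteq> 0" "y \<noteq> 0"
    and reg: "regular q x" "regular q y" "regular q (x / s)" "regular q (y / s)"
  shows "wp_prefactor q x y s (1 / q ^ m) n = wp_prefactor q x y (s * q ^ m / q ^ n) (1 / q ^ n) m"
proof -
  have A: "tfac q z n / tfac q (z * q ^ m) n = tfac q z m / tfac q (z * q ^ n) m"
    if "regular q z" for z
    using tfac_swap[of q z n m] regular_tfac[OF that, of "z * q ^ m" 0 m n]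
      regular_tfac[OF that, of "z * q ^ n" 0 n m] nz by (simp add: field_simps)
  have B: "tfac q z n / tfac q (z / q ^ m) n = tfac q (z * q ^ n / q ^ m) m / tfac q (z / q ^ m) m"
    if "regular q z" for z
    using tfac_swap[of q "z / q ^ m" n m] regular_tfac[OF that, of "z / q ^ m" m 0 n]
      regular_tfac[OF that, of "z / q ^ m" m 0 m] nz by (simp add: field_simps)
  have L: "wp_prefactor q x y s (1 / q ^ m) n =
      (tfac q x n / tfac q (x * q ^ m) n) * (tfac q (x / s) n / tfac q (x / s / q ^ m) n) /
      ((tfac q y n / tfac q (y * q ^ m) n) * (tfac q (y / s) n / tfac q (y / s / q ^ m) n))"
    using nz by (simp add: wp_prefactor_def pairfac_def mult_ac)
  have R: "wp_prefactor q x y (s * q ^ m / q ^ n) (1 / q ^ n) m =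
      (tfac q x m / tfac q (x * q ^ n) m) * (tfac q (x / s * q ^ n / q ^ m) m / tfac q (x / s / q ^ m) m) /
      ((tfac q y m / tfac q (y * q ^ n) m) * (tfac q (y / s * q ^ n / q ^ m) m / tfac q (y / s / q ^ m) m))"
    using nz by (simp add: wp_prefactor_def pairfac_def mult_ac)
  show ?thesis
    unfolding L R A[OF reg(1)] A[OF reg(2)] B[OF reg(3)] B[OF reg(4)] ..
qed

subsection \<open>The Frenkel--Turaev sum\<close>

text \<open>For nonzero \<open>p\<close> this says that no positive power of \<open>q\<close> is an
  integral power of \<open>p\<close>. It keeps the points \<open>q^-m\<close> apart and the
  factorials of \<open>q\<close> nonzero.\<close>

definition generic_base :: "complex \<Rightarrow> bool" where
  "generic_base q \<longleftrightarrow> q \<noteq> 0 \<and> (\<forall>k>0. \<theta> (q ^ k) \<noteq> 0)"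

lemma generic_base_tfac: "generic_base q \<Longrightarrow> tfac q q k \<noteq> 0"
  by (rule tfac_nonzero) (simp add: generic_base_def flip: power_Suc)

lemma generic_base_negative_power:
  assumes "generic_base q" "m < n"
  shows "\<theta> (q ^ m / q ^ n) \<noteq> 0"
proof -
  have "q ^ m / q ^ n = 1 / q ^ (n - m)"
    using assms by (simp add: generic_base_def power_diff)
  then show ?thesis
    using assms ellE_inverse_eq_0_iff[of "q ^ (n - m)"] by (simp add: generic_base_def)
qed

text \<open>The form common to both classical identities: \<open>n\<close> points where the
  induction hypothesis gives zeros, and one further point \<open>r\<close> treated directly.
  Products of two of the first points, divided by \<open>s\<close>, are reciprocals of
  \<open>s q^(i+j)\<close>, hence the regularity of \<open>s\<close>.\<close>

lemma interpolation_at_negative_powers: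
  assumes G: "theta_form s n G" and q: "generic_base q" and nz: "s \<noteq> 0" "r \<noteq> 0" "b \<noteq> 0"
    and s: "regular q s"
    and zero: "\<And>m. m < n \<Longrightarrow> G (1 / q ^ m) = 0" "G r = 0"
    and sep: "\<And>m. m < n \<Longrightarrow> \<theta> (r * q ^ m) \<noteq> 0" "\<And>m. m < n \<Longrightarrow> \<theta> (r / (s * q ^ m)) \<noteq> 0"
  shows "G b = 0"
proof -
  define t where "t i = (if i < n then 1 / q ^ i else r)" for i
  have q0: "q \<noteq> 0" using q by (simp add: generic_base_def)
  show ?thesis
  proof (rule theta_form_eq_0[OF G nz(1) _ _ _ nz(3)])
    show "t i \<noteq> 0" "G (t i) = 0" if "i \<le> n" for i
      using that zero q0 nz by (auto simp: t_def)
    fix i j assume ij: "i < j" "j \<le> n"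
    show "\<theta> (t i / t j) \<noteq> 0 \<and> \<theta> (t i * t j / s) \<noteq> 0"
    proof (cases "j = n")
      case True
      then have "t i / t j = 1 / (r * q ^ i)" "t i * t j / s = r / (s * q ^ i)"
        using ij q0 by (simp_all add: t_def)
      then show ?thesis
        using sep[of i] ellE_inverse_eq_0_iff[of "r * q ^ i"] ij True q0 nz by simp
    next
      case False
      then have t: "t i / t j = q ^ (j - i)" "t i * t j / s = 1 / (s * q ^ (i + j))"
        using ij q0 by (simp_all add: t_def power_diff power_add)
      have "\<theta> (q ^ (j - i)) \<noteq> 0"
        using q ij by (simp add: generic_base_def)
      moreover have "\<theta> (1 / (s * q ^ (i + j))) \<noteq> 0"
        using regularD[OF s, of "i + j"] ellE_inverse_eq_0_iff[of "s * q ^ (i + j)"] q0 nz by simp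
      ultimately show ?thesis unfolding t by simp
    qed
  qed
qed

text \<open>The sum of \<open>C k * N k b / pairfac q s u b k\<close>, multiplied by the common
  denominator \<open>pairfac q s u b n\<close> and written without division. It is a theta form in
  \<open>b\<close> and keeps its meaning at zeros of the denominator, where the cubic series has to
  be evaluated.\<close>

definition cleared_sum ::
    "complex \<Rightarrow> complex \<Rightarrow> complex \<Rightarrow> (nat \<Rightarrow> complex \<Rightarrow> complex) \<Rightarrow> (nat \<Rightarrow> complex) \<Rightarrow> nat \<Rightarrow> complex \<Rightarrow> complex"
  where "cleared_sum q s u N C n b = (\<Sum>k\<le>n. C k * (N k b * pairfac q s (u * q ^ k) b (n - k)))"

lemma theta_form_cleared_sum:
  assumes "q \<noteq> 0" "s \<noteq> 0" "u \<noteq> 0" and N: "\<And>k. theta_form s k (N k)"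
  shows "theta_form s n (cleared_sum q s u N C n)"
proof -
  have "theta_form s n (\<lambda>b. N k b * pairfac q s (u * q ^ k) b (n - k))" if "k \<le> n" for k
    using theta_form_mult[OF N[of k] theta_form_pairfac[OF assms(1,2), of "u * q ^ k" "n - k"]]
      assms that by simp
  then show ?thesis
    unfolding cleared_sum_def[abs_def] by (intro theta_form_sum theta_form.scale) auto
qed

lemma pairfac_split:
  "k \<le> n \<Longrightarrow> pairfac q s u b n = pairfac q s u b k * pairfac q s (u * q ^ k) b (n - k)"
  using pairfac_add[of q s u b k "n - k"] by simp

lemma cleared_sum_eq:
  assumes "pairfac q s u b n \<noteq> 0"
  shows "cleared_sum q s u N C n b = pairfac q s u b n * (\<Sum>k\<le>n. C k * (N k b / pairfac q s u b k))"
  unfolding cleared_sum_def sum_distrib_left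
proof (rule sum.cong)
  fix k assume "k \<in> {..n}"
  then have "pairfac q s u b n = pairfac q s u b k * pairfac q s (u * q ^ k) b (n - k)"
    by (intro pairfac_split) simp
  then show "C k * (N k b * pairfac q s (u * q ^ k) b (n - k)) =
      pairfac q s u b n * (C k * (N k b / pairfac q s u b k))"
    using assms by auto
qed simp

lemma wp_sum_eq_cleared_sum:
  assumes "pairfac q s (a * q) b n \<noteq> 0"
  shows "(\<Sum>k\<le>n. W k * wp_pair q a s b n k) = cleared_sum q s (a * q) (\<lambda>k y. pairfac q s s y k)
      (\<lambda>k. W k * (tfac q (1 / q ^ n) k / tfac q (a * q ^ (n + 1)) k)) n b / pairfac q s (a * q) b n"
  unfolding cleared_sum_eq[OF assms] using assms by (simp add: wp_pair_def mult_ac)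

text \<open>At \<open>b = a q / d\<close> the factors of \<open>b\<close> cancel against those of
  \<open>d\<close>. With the partner \<open>g = s / b\<close> the balancing condition turns into
  \<open>a = e g q^-n\<close>, so the series telescopes, and the closed form contains
  \<open>tfac q (q / q ^ n) n\<close>, which has the factor \<open>\<theta> 1\<close>.\<close>

lemma frenkel_turaev_aux:
  assumes q: "generic_base q" and nz: "a \<noteq> 0" "s \<noteq> 0" "d \<noteq> 0" "e \<noteq> 0" and n: "n > 0"
    and bal: "s * d * e = a\<^sup>2 * q ^ (n + 1)"
    and reg: "regular q a" "regular q d" "regular q e" "regular q (a / d)" "regular q (a / e)"
  shows "(\<Sum>k\<le>n. wp_weight q a [d, e] k * wp_pair q a s (a * q / d) n k) = 0"
proof -
  have q0: "q \<noteq> 0" using q by (simp add: generic_base_def)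
  define g where "g = s * d / (a * q)"
  have g: "g \<noteq> 0" "a = e * g * (1 / q ^ n)"
    using nz q0 bal by (auto simp: g_def field_simps power2_eq_square)
  have ag: "a * q * (a * q / d) / s = a * q / g"
    using nz q0 by (simp add: g_def field_simps)
  have sg: "s / (a * q / d) = g"
    by (simp add: g_def)
  have t: "tfac q d k \<noteq> 0" "tfac q (a * q / d) k \<noteq> 0" for k
    using regular_tfac[OF reg(2) q0, of d 0 0] regular_tfac[OF reg(4) q0, of "a * q / d" 0 1] by simp_all
  have "wp_weight q a [d, e] k * wp_pair q a s (a * q / d) n k =
      \<theta> (a * q ^ (2 * k)) / \<theta> a * q ^ k *
      (tfac q a k * tfac q e k * tfac q g k * tfac q (1 / q ^ n) k) /
      (tfac q q k * tfac q (a * q / e) k * tfac q (a * q / g) k * tfac q (a * q / (1 / q ^ n)) k)" for k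
    unfolding wp_weight_def wp_pair_def pairfac_def ag sg using t[of k] nz q0
    by (simp add: mult_ac)
  then have "(\<Sum>k\<le>n. wp_weight q a [d, e] k * wp_pair q a s (a * q / d) n k) =
      (tfac q (a * q) n * tfac q (e * q) n * tfac q (g * q) n * tfac q (1 / q ^ n * q) n) /
      (tfac q q n * tfac q (a * q / e) n * tfac q (a * q / g) n * tfac q (a * q / (1 / q ^ n)) n)"
  proof (simp only:, intro telescoping_sum)
    show "\<theta> a \<noteq> 0" using reg(1) by (rule regularD0)
    show "tfac q q n \<noteq> 0" using q by (rule generic_base_tfac)
    show "tfac q (a * q / e) n \<noteq> 0" by (rule regular_tfac[OF reg(5) q0, of _ 0 1]) simp
    have "a * q / g * q ^ n = e * q ^ 1"
      by (subst g(2)) (use g(1) q0 in simp)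
    then show "tfac q (a * q / g) n \<noteq> 0" by (rule regular_tfac[OF reg(3) q0])
    show "tfac q (a * q / (1 / q ^ n)) n \<noteq> 0"
      by (rule regular_tfac[OF reg(1) q0, of _ 0 "n + 1"]) simp
  qed (use q0 nz g in auto)
  also have "tfac q (1 / q ^ n * q) n = 0"
    using n q0 by (intro tfac_eq_0[of "n - 1"]) (simp_all add: power_Suc[symmetric] del: power_Suc)
  finally show ?thesis by simp
qed

text \<open>Both sides are theta forms in \<open>b\<close> once denominators are cleared. They agree at
  \<open>b = q\<^sup>-\<^sup>m\<close> for \<open>m < n\<close> by induction and vanish at \<open>b = a q / d\<close>, where the sum telescopes.\<close>

lemma frenkel_turaev:
  assumes q: "generic_base q" and nz: "a \<noteq> 0" "s \<noteq> 0" "d \<noteq> 0" "e \<noteq> 0" "b \<noteq> 0"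
    and bal: "s * d * e = a\<^sup>2 * q ^ (n + 1)"
    and reg: "regular q a" "regular q d" "regular q e" "regular q (a / d)" "regular q (a / e)"
    and regs: "regular q s" "regular q (a / s)"
    and den: "pairfac q s (a * q) b n \<noteq> 0"
  shows "(\<Sum>k\<le>n. wp_weight q a [d, e] k * wp_pair q a s b n k) =
    wp_prefactor q (a * q) (a * q / d) s b n"
  using nz(2,5) bal regs den
proof (induction n arbitrary: s b rule: less_induct)
  case (less n)
  note s = less.prems(1) and b = less.prems(2) and bal = less.prems(3)
    and regs = less.prems(4,5) and den = less.prems(6)
  have q0: "q \<noteq> 0" using q by (simp add: generic_base_def)
  show ?case
  proof (cases "n = 0")
    case True
    then show ?thesis
      using regularD0[OF reg(1)] by (simp add: wp_weight_def wp_pair_def wp_prefactor_def pairfac_def)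
  next
    case False
    define C where "C k = wp_weight q a [d, e] k * (tfac q (1 / q ^ n) k / tfac q (a * q ^ (n + 1)) k)" for k
    define K where "K = tfac q (a * q) n * tfac q (a * q / s) n / (tfac q (a * q / d) n * tfac q (a * q / d / s) n)"
    define G where "G y = cleared_sum q s (a * q) (\<lambda>k y. pairfac q s s y k) C n y - K * pairfac q s (a * q / d) y n" for y
    have "theta_form s n (cleared_sum q s (a * q) (\<lambda>k y. pairfac q s s y k) C n)"
      by (rule theta_form_cleared_sum) (use q0 nz s theta_form_pairfac in auto)
    moreover have "theta_form s n (\<lambda>y. K * pairfac q s (a * q / d) y n)"
      by (intro theta_form.scale theta_form_pairfac) (use q0 nz s in auto)
    ultimately have formG: "theta_form s n G"
      unfolding G_def[abs_def] by (rule theta_form_diff)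
    have G0: "G y = 0 \<longleftrightarrow> (\<Sum>k\<le>n. wp_weight q a [d, e] k * wp_pair q a s y n k) =
        wp_prefactor q (a * q) (a * q / d) s y n" if "pairfac q s (a * q) y n \<noteq> 0" for y
      unfolding wp_sum_eq_cleared_sum[OF that] C_def[symmetric]
      using that by (simp add: G_def K_def wp_prefactor_def field_simps)
    \<comment> \<open>The balancing condition expresses \<open>a / (d s)\<close> through
      \<open>e / a\<close>, so its regularity need not be assumed.\<close>
    have ade: "a / (d * s) * q ^ (n + 1) = e / a"
      using bal nz s q0 by (simp add: field_simps power2_eq_square)
    have regds: "regular q (a / (d * s))"
      using regular_shift[OF regular_swap[OF reg(5)] q0, of "a / (d * s)" "n + 1" 0] ade nz q0 by simp
    have "G b = 0"
    proof (rule interpolation_at_negative_powers[OF formG q s _ b regs(1), of "a * q / d"])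
      show "a * q / d \<noteq> 0" using nz q0 by simp
      fix m assume m: "m < n"
      let ?s = "s * q ^ m / q ^ n"
      have ms: "m \<le> n" using m by simp
      have den_m: "pairfac q s (a * q) (1 / q ^ m) n \<noteq> 0"
        using regular_tfac[OF reg(1) q0, of "a * q * q ^ m" 0 "m + 1" n]
          regular_tfac[OF regs(2) q0, of "a * q / (q ^ m * s)" m 1 n] q0 s
        by (simp add: pairfac_def mult_ac)
      have den_n: "pairfac q ?s (a * q) (1 / q ^ n) m \<noteq> 0"
        using regular_tfac[OF reg(1) q0, of "a * q * q ^ n" 0 "n + 1" m]
          regular_tfac[OF regs(2) q0, of "a * q / (q ^ m * s)" m 1 m] q0 s
        by (simp add: pairfac_def mult_ac)
      have "(\<Sum>k\<le>n. wp_weight q a [d, e] k * wp_pair q a s (1 / q ^ m) n k) =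
          (\<Sum>k\<le>m. wp_weight q a [d, e] k * wp_pair q a ?s (1 / q ^ n) m k)"
        using sum_wp_pair_exchange[OF q0 s ms] .
      also have "\<dots> = wp_prefactor q (a * q) (a * q / d) ?s (1 / q ^ n) m"
      proof (rule less.IH[OF m])
        show "?s \<noteq> 0" "1 / q ^ n \<noteq> 0" using s q0 by auto
        show "?s * d * e = a\<^sup>2 * q ^ (m + 1)"
          using bal q0 by (simp add: field_simps)
        show "regular q ?s" by (rule regular_shift[OF regs(1) q0, of _ n m]) (use q0 in simp)
        show "regular q (a / ?s)"
          by (rule regular_shift[OF regs(2) q0, of _ m n]) (use q0 s in simp)
      qed (rule den_n)
      also have "\<dots> = wp_prefactor q (a * q) (a * q / d) s (1 / q ^ m) n"
      proof (rule wp_prefactor_exchange[symmetric, OF q0 s])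
        show "regular q (a * q)" by (rule regular_shift[OF reg(1) q0, of _ 0 1]) simp
        show "regular q (a * q / d)" by (rule regular_shift[OF reg(4) q0, of _ 0 1]) simp
        show "regular q (a * q / s)" by (rule regular_shift[OF regs(2) q0, of _ 0 1]) simp
        show "regular q (a * q / d / s)" by (rule regular_shift[OF regds q0, of _ 0 1]) simp
      qed (use nz q0 in auto)
      finally show "G (1 / q ^ m) = 0" using G0[OF den_m] by simp
      show "\<theta> (a * q / d * q ^ m) \<noteq> 0"
        by (rule regularE[OF reg(4) q0, of _ 0 "m + 1"]) simp
      show "\<theta> (a * q / d / (s * q ^ m)) \<noteq> 0"
        by (rule regularE[OF regds q0, of _ m 1]) (use q0 in simp)
    next
      have "pairfac q s (a * q) (a * q / d) n \<noteq> 0"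
        using regular_tfac[OF reg(2) q0, of d 0 0 n]
          regular_tfac[OF reg(3) q0, of "a * q * (a * q / d) / s" n 1 n] bal nz s q0
        by (simp add: pairfac_def field_simps power2_eq_square)
      \<comment> \<open>The numerator \<open>pairfac q s (a * q / d) (a * q / d) n\<close> contains
        \<open>tfac q 1 n\<close>.\<close>
      moreover have "wp_prefactor q (a * q) (a * q / d) s (a * q / d) n = 0"
        using False nz q0 tfac_one[of n q] by (simp add: wp_prefactor_def pairfac_def)
      ultimately show "G (a * q / d) = 0"
        using G0[of "a * q / d"] frenkel_turaev_aux[OF q nz(1) s nz(3,4) _ bal reg] False by simp
    qed
    then show ?thesis using G0[OF den] by simp
  qed
qed

subsection \<open>Bailey's transformation\<close>

text \<open>At the point \<open>a q / b\<close> half of the pair cancels against the parameter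
  \<open>b\<close> of the weight. The other half is \<open>f\<close>, and the rest is a
  Frenkel--Turaev series with pair \<open>c, d\<close> and parameters \<open>f, g\<close>.\<close>

lemma wp_sum_at_reciprocal:
  assumes q: "generic_base q" and nz: "a \<noteq> 0" "b \<noteq> 0" "c \<noteq> 0" "d \<noteq> 0" "f \<noteq> 0" "g \<noteq> 0"
    and f: "s = a * q * f / b" and bal: "c * d * f * g = a\<^sup>2 * q ^ (n + 1)"
    and reg: "regular q a" "regular q f" "regular q g" "regular q (a / f)" "regular q (a / g)"
      "regular q (c * d)" "regular q (a / (c * d))" "regular q b" "regular q (a / b)"
      "regular q (a / c)" "regular q (a / d)"
  shows "(\<Sum>k\<le>n. wp_weight q a [b, c, d, g] k * wp_pair q a s (a * q / b) n k) =
    wp_prefactor q (a * q) (a * q / f) (c * d) c n"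
proof -
  have q0: "q \<noteq> 0" using q by (simp add: generic_base_def)
  have t: "tfac q b k \<noteq> 0" "tfac q (a * q / b) k \<noteq> 0" for k
    using regular_tfac[OF reg(8) q0, of b 0 0] regular_tfac[OF reg(9) q0, of "a * q / b" 0 1] by simp_all
  have "wp_weight q a [b, c, d, g] k * wp_pair q a s (a * q / b) n k =
      wp_weight q a [f, g] k * wp_pair q a (c * d) c n k" for k
    using t[of k] nz q0 by (simp add: wp_weight_def wp_pair_def pairfac_def f mult_ac)
  then have "(\<Sum>k\<le>n. wp_weight q a [b, c, d, g] k * wp_pair q a s (a * q / b) n k) =
      (\<Sum>k\<le>n. wp_weight q a [f, g] k * wp_pair q a (c * d) c n k)"
    by simp
  also have "\<dots> = wp_prefactor q (a * q) (a * q / f) (c * d) c n"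
  proof (rule frenkel_turaev[OF q])
    show "pairfac q (c * d) (a * q) c n \<noteq> 0"
      using regular_tfac[OF reg(10) q0, of "a * q / c" 0 1] regular_tfac[OF reg(11) q0, of "a * q / d" 0 1] nz
      by (simp add: pairfac_def)
  qed (use nz bal reg in auto)
  finally show ?thesis .
qed

text \<open>The Frenkel--Turaev products that the two sides of Bailey's transformation yield at
  \<open>e = a q / b\<close> differ exactly by its prefactor.\<close>

lemma wp_prefactor_at_reciprocal:
  assumes nz: "q \<noteq> 0" "a \<noteq> 0" "b \<noteq> 0" "c \<noteq> 0" "d \<noteq> 0" "f \<noteq> 0"
    and f: "s = a * q * f / b" and lam: "l = a\<^sup>2 * q / (b * c * d)"
    and reg: "regular q l" "regular q b" "regular q (l / f)" "regular q (a / s)"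
  shows "wp_prefactor q (a * q) (a * q / f) (c * d) c n =
    wp_prefactor q (a * q) (l * q) s (a * q / b) n *
    wp_prefactor q (l * q) (l * q / f) (l * c / a * (l * d / a)) (l * c / a) n"
proof -
  let ?T = "\<lambda>x. tfac q x n"
  have "?T b \<noteq> 0" "?T (l * q) \<noteq> 0" "?T (l * q / f) \<noteq> 0" "?T (b / f) \<noteq> 0"
    using regular_tfac[OF reg(2) nz(1), of b 0 0] regular_tfac[OF reg(1) nz(1), of "l * q" 0 1]
      regular_tfac[OF reg(3) nz(1), of "l * q / f" 0 1] regular_tfac[OF reg(4) nz(1), of "b / f" 0 1] nz
    by (simp_all add: f)
  moreover have "wp_prefactor q (a * q) (a * q / f) (c * d) c n =
      ?T (a * q) * ?T (a * q / (c * d)) * (?T (a * q / (c * f)) * ?T (a * q / (d * f))) /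
      (?T (a * q / f) * ?T (a * q / (c * d * f)) * (?T (a * q / c) * ?T (a * q / d)))"
    using nz by (simp add: wp_prefactor_def pairfac_def mult_ac)
  moreover have "l * q / (l * c / a * (l * d / a)) = b" "l * q / f / (l * c / a * (l * d / a)) = b / f"
    "l * q / f / (l * c / a) = a * q / (c * f)" "l * q / (l * c / a) = a * q / c"
    "l * q / f * (l * c / a) / (l * c / a * (l * d / a)) = a * q / (d * f)"
    "l * q * (l * c / a) / (l * c / a * (l * d / a)) = a * q / d"
    using nz by (simp_all add: lam field_simps power2_eq_square)
  then have "wp_prefactor q (l * q) (l * q / f) (l * c / a * (l * d / a)) (l * c / a) n =
      ?T (l * q) * ?T b * (?T (a * q / (c * f)) * ?T (a * q / (d * f))) /
      (?T (l * q / f) * ?T (b / f) * (?T (a * q / c) * ?T (a * q / d)))"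
    unfolding wp_prefactor_def pairfac_def by simp
  moreover have "a * q / s = b / f" "l * q / s = a * q / (c * d * f)" "l * q / (a * q / b) = a * q / (c * d)"
    "l * q * (a * q / b) / s = l * q / f" "a * q / (a * q / b) = b" "a * q * (a * q / b) / s = a * q / f"
    using nz by (simp_all add: lam f field_simps power2_eq_square)
  then have "wp_prefactor q (a * q) (l * q) s (a * q / b) n =
      ?T (a * q) * ?T (b / f) * (?T (a * q / (c * d)) * ?T (l * q / f)) /
      (?T (l * q) * ?T (a * q / (c * d * f)) * (?T b * ?T (a * q / f)))"
    unfolding wp_prefactor_def pairfac_def by simp
  ultimately show ?thesis
    by (simp add: mult_ac)
qed

text \<open>Bailey's transformation as an identity of theta forms in \<open>e\<close>: at \<open>e = q\<^sup>-\<^sup>m\<close> it holds by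
  induction, and at \<open>e = a q / b\<close> both sides reduce to the Frenkel--Turaev sum.\<close>

lemma bailey_transformation:
  assumes q: "generic_base q" and nz: "a \<noteq> 0" "b \<noteq> 0" "c \<noteq> 0" "d \<noteq> 0" "g \<noteq> 0" "s \<noteq> 0" "e \<noteq> 0"
    and l: "l = a\<^sup>2 * q / (b * c * d)" and bal: "s * g = l * a * q ^ (n + 1)"
    and reg: "regular q a" "regular q l" "regular q g" "regular q (a / g)" "regular q (l / g)"
      "regular q (c * d)" "regular q (a / (c * d))" "regular q b" "regular q (l / b)"
      "regular q (a / b)" "regular q (a / c)" "regular q (a / d)"
    and regs: "regular q s" "regular q (a / s)" "regular q (l / s)" "regular q (s * b / a)"
      "regular q (a\<^sup>2 / (s * b))" "regular q (l * a / (s * b))"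
    and den: "pairfac q s (a * q) e n \<noteq> 0" "pairfac q s (l * q) e n \<noteq> 0"
  shows "(\<Sum>k\<le>n. wp_weight q a [b, c, d, g] k * wp_pair q a s e n k) =
    wp_prefactor q (a * q) (l * q) s e n *
    (\<Sum>k\<le>n. wp_weight q l [l * b / a, l * c / a, l * d / a, g] k * wp_pair q l s e n k)"
  using nz(6,7) bal regs den
proof (induction n arbitrary: s e rule: less_induct)
  case (less n)
  note s = less.prems(1) and e = less.prems(2) and bal = less.prems(3)
    and regs = less.prems(4-9) and den = less.prems(10,11)
  have q0: "q \<noteq> 0" using q by (simp add: generic_base_def)
  have l0: "l \<noteq> 0" using nz q0 l by simp
  let ?W = "wp_weight q a [b, c, d, g]" and ?V = "wp_weight q l [l * b / a, l * c / a, l * d / a, g]"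
  define C where "C k = ?W k * (tfac q (1 / q ^ n) k / tfac q (a * q ^ (n + 1)) k)" for k
  define D where "D k = ?V k * (tfac q (1 / q ^ n) k / tfac q (l * q ^ (n + 1)) k)" for k
  define K where "K = tfac q (a * q) n * tfac q (a * q / s) n / (tfac q (l * q) n * tfac q (l * q / s) n)"
  define G where "G y = cleared_sum q s (a * q) (\<lambda>k y. pairfac q s s y k) C n y - K * cleared_sum q s (l * q) (\<lambda>k y. pairfac q s s y k) D n y" for y
  have "theta_form s n (cleared_sum q s (a * q) (\<lambda>k y. pairfac q s s y k) C n)"
    by (rule theta_form_cleared_sum) (use q0 nz s theta_form_pairfac in auto)
  moreover have "theta_form s n (\<lambda>y. K * cleared_sum q s (l * q) (\<lambda>k y. pairfac q s s y k) D n y)"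
    by (intro theta_form.scale theta_form_cleared_sum) (use q0 l0 s theta_form_pairfac in auto)
  ultimately have formG: "theta_form s n G"
    unfolding G_def[abs_def] by (rule theta_form_diff)
  have G0: "G y = 0 \<longleftrightarrow> (\<Sum>k\<le>n. ?W k * wp_pair q a s y n k) =
      wp_prefactor q (a * q) (l * q) s y n * (\<Sum>k\<le>n. ?V k * wp_pair q l s y n k)"
    if "pairfac q s (a * q) y n \<noteq> 0" "pairfac q s (l * q) y n \<noteq> 0" for y
    unfolding wp_sum_eq_cleared_sum[OF that(1)] wp_sum_eq_cleared_sum[OF that(2)] C_def[symmetric] D_def[symmetric]
    using that by (simp add: G_def K_def wp_prefactor_def field_simps)
  have "G e = 0"
  proof (rule interpolation_at_negative_powers[OF formG q s _ e regs(1), of "a * q / b"])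
    show "a * q / b \<noteq> 0" using nz q0 by simp
    fix m assume m: "m < n"
    let ?s = "s * q ^ m / q ^ n"
    have ms: "m \<le> n" using m by simp
    have den_m: "pairfac q s (x * q) (1 / q ^ m) n \<noteq> 0" and den_n: "pairfac q ?s (x * q) (1 / q ^ n) m \<noteq> 0"
      if "regular q x" "regular q (x / s)" for x
      using regular_tfac[OF that(1) q0, of "x * q * q ^ m" 0 "m + 1" n]
        regular_tfac[OF that(2) q0, of "x * q / (q ^ m * s)" m 1 n]
        regular_tfac[OF that(1) q0, of "x * q * q ^ n" 0 "n + 1" m]
        regular_tfac[OF that(2) q0, of "x * q / (q ^ m * s)" m 1 m] q0 s
      by (simp_all add: pairfac_def mult_ac)
    have "(\<Sum>k\<le>n. ?W k * wp_pair q a s (1 / q ^ m) n k) = (\<Sum>k\<le>m. ?W k * wp_pair q a ?s (1 / q ^ n) m k)"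
      using sum_wp_pair_exchange[OF q0 s ms] .
    also have "\<dots> = wp_prefactor q (a * q) (l * q) ?s (1 / q ^ n) m *
        (\<Sum>k\<le>m. ?V k * wp_pair q l ?s (1 / q ^ n) m k)"
    proof (rule less.IH[OF m])
      show "?s \<noteq> 0" "1 / q ^ n \<noteq> 0" using s q0 by auto
      show "?s * g = l * a * q ^ (m + 1)"
        using bal q0 by (simp add: field_simps)
      show "regular q ?s" by (rule regular_shift[OF regs(1) q0, of _ n m]) (use q0 in simp)
      show "regular q (a / ?s)"
        by (rule regular_shift[OF regs(2) q0, of _ m n]) (use q0 s in simp)
      show "regular q (l / ?s)"
        by (rule regular_shift[OF regs(3) q0, of _ m n]) (use q0 s in simp)
      show "regular q (?s * b / a)"
        by (rule regular_shift[OF regs(4) q0, of _ n m]) (use q0 nz s in simp)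
      show "regular q (a\<^sup>2 / (?s * b))"
        by (rule regular_shift[OF regs(5) q0, of _ m n]) (use q0 nz s in simp)
      show "regular q (l * a / (?s * b))"
        by (rule regular_shift[OF regs(6) q0, of _ m n]) (use q0 nz s in simp)
      show "pairfac q ?s (a * q) (1 / q ^ n) m \<noteq> 0" using reg(1) regs(2) by (rule den_n)
      show "pairfac q ?s (l * q) (1 / q ^ n) m \<noteq> 0" using reg(2) regs(3) by (rule den_n)
    qed
    also have "wp_prefactor q (a * q) (l * q) ?s (1 / q ^ n) m = wp_prefactor q (a * q) (l * q) s (1 / q ^ m) n"
    proof (rule wp_prefactor_exchange[symmetric, OF q0 s])
      show "regular q (a * q)" by (rule regular_shift[OF reg(1) q0, of _ 0 1]) simp
      show "regular q (l * q)" by (rule regular_shift[OF reg(2) q0, of _ 0 1]) simp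
      show "regular q (a * q / s)" by (rule regular_shift[OF regs(2) q0, of _ 0 1]) simp
      show "regular q (l * q / s)" by (rule regular_shift[OF regs(3) q0, of _ 0 1]) simp
    qed (use nz l0 q0 in auto)
    also have "(\<Sum>k\<le>m. ?V k * wp_pair q l ?s (1 / q ^ n) m k) = (\<Sum>k\<le>n. ?V k * wp_pair q l s (1 / q ^ m) n k)"
      using sum_wp_pair_exchange[OF q0 s ms] by (rule sym)
    finally show "G (1 / q ^ m) = 0"
      using G0[OF den_m[OF reg(1) regs(2)] den_m[OF reg(2) regs(3)]] by simp
    show "\<theta> (a * q / b * q ^ m) \<noteq> 0"
      by (rule regularE[OF reg(10) q0, of _ 0 "m + 1"]) simp
    show "\<theta> (a * q / b / (s * q ^ m)) \<noteq> 0"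
      by (rule regularE[OF regular_swap[OF regs(4)] q0, of _ m 1]) (use q0 s nz in simp_all)
  next
    \<comment> \<open>\<open>f\<close> is the partner \<open>s / e\<close> of
      \<open>e = a q / b\<close>. Since \<open>a q / b = l q / (l b / a)\<close>, the same point
      cancels \<open>b\<close> on the left and \<open>l b / a\<close> on the right.\<close>
    define f where "f = s * b / (a * q)"
    have f0: "f \<noteq> 0" using nz s q0 by (simp add: f_def)
    have sf: "s = a * q * f / b" using nz q0 by (simp add: f_def)
    have regf: "regular q f" "regular q (a / f)" "regular q (l / f)"
      by (rule regular_shift[OF regs(4) q0, of _ 1 0] regular_shift[OF regs(5) q0, of _ 0 1]
          regular_shift[OF regs(6) q0, of _ 0 1]; use nz s q0 in \<open>simp add: f_def power2_eq_square\<close>)+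
    have regb': "regular q (l * b / a)"
      by (rule regular_shift[OF reg(7) q0, of _ 0 1]) (use nz in \<open>simp add: l power2_eq_square\<close>)
    have "(\<Sum>k\<le>n. ?W k * wp_pair q a s (a * q / b) n k) = wp_prefactor q (a * q) (a * q / f) (c * d) c n"
    proof (rule wp_sum_at_reciprocal[OF q nz(1-4) f0 nz(5) sf])
      have "c * d * f * g = c * d * b * (s * g) / (a * q)"
        by (simp add: f_def)
      also have "\<dots> = a\<^sup>2 * q ^ (n + 1)"
        unfolding bal using nz q0 by (simp add: l)
      finally show "c * d * f * g = a\<^sup>2 * q ^ (n + 1)" .
    qed (use reg regf in auto)
    also have "\<dots> = wp_prefactor q (a * q) (l * q) s (a * q / b) n *
        wp_prefactor q (l * q) (l * q / f) (l * c / a * (l * d / a)) (l * c / a) n"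
      using q0 nz(1-4) f0 sf l reg(2,8) regf(3) regs(2) by (rule wp_prefactor_at_reciprocal)
    also have "wp_prefactor q (l * q) (l * q / f) (l * c / a * (l * d / a)) (l * c / a) n =
        (\<Sum>k\<le>n. ?V k * wp_pair q l s (l * q / (l * b / a)) n k)"
    proof (rule wp_sum_at_reciprocal[symmetric, OF q l0 _ _ _ f0 nz(5)])
      show "s = l * q * f / (l * b / a)"
        using nz l0 by (simp add: sf)
      have "l * c / a * (l * d / a) * f * g = l\<^sup>2 * (c * d * b * (s * g)) / (a\<^sup>2 * (a * q))"
        by (simp add: f_def power2_eq_square)
      also have "\<dots> = l\<^sup>2 * q ^ (n + 1)"
        unfolding bal using nz q0 by (simp add: l power2_eq_square mult_ac)
      finally show "l * c / a * (l * d / a) * f * g = l\<^sup>2 * q ^ (n + 1)" .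
      show "regular q (l * c / a * (l * d / a))"
        by (rule regular_shift[OF reg(9) q0, of _ 0 1]) (use nz q0 in \<open>simp add: l power2_eq_square mult_ac\<close>)
      show "regular q (l / (l * c / a * (l * d / a)))"
        by (rule regular_shift[OF reg(8) q0, of _ 1 0]) (use nz q0 in \<open>simp add: l power2_eq_square\<close>)
    qed (use reg regf regb' nz l0 in auto)
    also have "l * q / (l * b / a) = a * q / b"
      using nz l0 by simp
    finally have "(\<Sum>k\<le>n. ?W k * wp_pair q a s (a * q / b) n k) =
      wp_prefactor q (a * q) (l * q) s (a * q / b) n * (\<Sum>k\<le>n. ?V k * wp_pair q l s (a * q / b) n k)" .
    moreover have "pairfac q s (a * q) (a * q / b) n \<noteq> 0"
      using regular_tfac[OF reg(8) q0, of b 0 0 n] regular_tfac[OF regs(5) q0, of "a * q * (a * q / b) / s" 0 2 n]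
        nz s q0 by (simp add: pairfac_def power2_eq_square mult_ac)
    moreover have "pairfac q s (l * q) (a * q / b) n \<noteq> 0"
      using regular_tfac[OF regb' q0, of "l * b / a" 0 0 n] regular_tfac[OF regs(6) q0, of "l * q * (a * q / b) / s" 0 2 n]
        nz s q0 by (simp add: pairfac_def power2_eq_square mult_ac)
    ultimately show "G (a * q / b) = 0"
      using G0 by simp
  qed
  then show ?case using G0[OF den] by simp
qed

subsection \<open>The cubic series\<close>

lemma tfac_triple: "tfac q x (3 * n) = tfac (q ^ 3) x n * tfac (q ^ 3) (x * q) n * tfac (q ^ 3) (x * q ^ 2) n"
proof (induction n)
  case (Suc n)
  have "3 * Suc n = Suc (Suc (Suc (3 * n)))" by simp
  then have T: "tfac q x (3 * Suc n) =
      tfac q x (3 * n) * \<theta> (x * q ^ (3 * n)) * \<theta> (x * q ^ (3 * n + 1)) * \<theta> (x * q ^ (3 * n + 2))"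
    by (simp add: tfac_Suc del: mult_Suc_right)
  have P: "x * (q ^ 3) ^ n = x * q ^ (3 * n)" "x * q * (q ^ 3) ^ n = x * q ^ (3 * n + 1)"
    "x * q ^ 2 * (q ^ 3) ^ n = x * q ^ (3 * n + 2)"
    unfolding power_add power_mult by (simp_all add: mult_ac)
  show ?case
    unfolding T Suc tfac_Suc P by (simp only: mult_ac)
qed simp

lemma reflect_factor_scale:
  assumes "x \<noteq> 0" "y \<noteq> 0" "q \<noteq> 0"
  shows "reflect_factor q x n = (y / x) ^ n * reflect_factor q y n"
proof -
  have "reflect_factor q x n = (\<Prod>j<n. y / x * (- 1 / (y * q ^ j)))"
    unfolding reflect_factor_def using assms by (intro prod.cong) auto
  then show ?thesis
    by (simp only: prod.distrib reflect_factor_def prod_constant card_lessThan)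
qed

lemma regular_power: "regular q x \<Longrightarrow> regular (q ^ k) x"
  unfolding regular_def by (metis power_int_mult power_int_of_nat)

lemma generic_base_power: "generic_base q \<Longrightarrow> k > 0 \<Longrightarrow> generic_base (q ^ k)"
  by (simp add: generic_base_def flip: power_mult)

text \<open>\<open>cubic_coeff\<close> and \<open>base3_coeff\<close> are the summands on the two sides of the theorem for
  \<open>f = a / b\<close> without the factors depending on \<open>b\<close> and \<open>c = a q / (b d)\<close>. The prefactor of
  the theorem becomes \<open>cubic_factor\<close> after reversing four of the products.\<close>

definition cubic_coeff :: "complex \<Rightarrow> complex \<Rightarrow> complex \<Rightarrow> complex \<Rightarrow> nat \<Rightarrow> nat \<Rightarrow> complex" where
  "cubic_coeff q a d e n k = \<theta> (a * q ^ (4 * k)) / \<theta> a *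
     (tfac q d (2 * k) / tfac q (a * q / d) (2 * k)) *
     (tfac (q ^ 3) e k * tfac (q ^ 3) (1 / q ^ (3 * n)) k /
      (tfac q (a * q / e) k * tfac q (a * q ^ (3 * n + 1)) k)) * q ^ k"

definition base3_coeff :: "complex \<Rightarrow> complex \<Rightarrow> complex \<Rightarrow> complex \<Rightarrow> nat \<Rightarrow> nat \<Rightarrow> complex" where
  "base3_coeff q a d e n k = wp_weight (q ^ 3) (a * d / q) [e, d, d * q, d * q ^ 2] k *
     (tfac (q ^ 3) (1 / q ^ (3 * n)) k / tfac (q ^ 3) (a * d * q ^ (3 * n + 2)) k)"

definition cubic_factor :: "complex \<Rightarrow> complex \<Rightarrow> complex \<Rightarrow> nat \<Rightarrow> complex" where
  "cubic_factor q a d n = tfac q (a * q) (3 * n) * tfac (q ^ 3) (a * q ^ 2 / d ^ 2) n /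
     (tfac q (a * q / d) (3 * n) * tfac (q ^ 3) (a * d * q ^ 2) n)"

definition cubic_regular :: "complex \<Rightarrow> complex \<Rightarrow> complex \<Rightarrow> bool" where
  "cubic_regular q a d \<longleftrightarrow> regular q a \<and> regular q d \<and> regular q (a / d) \<and> regular q (a * d) \<and>
     regular q (a\<^sup>2 / d) \<and> regular q (a / d\<^sup>2) \<and> regular q (d\<^sup>2)"

text \<open>Dropping the first \<open>m\<close> terms of the cubic series shifts \<open>a\<close>
  and \<open>d\<close> in this way; each of the seven monomials changes only by a power of
  \<open>q\<close>.\<close>

lemma cubic_regular_shift:
  assumes "cubic_regular q a d" "q \<noteq> 0" "a \<noteq> 0" "d \<noteq> 0"
  shows "cubic_regular q (a * q ^ (4 * m)) (d * q ^ (2 * m))"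
  unfolding cubic_regular_def
proof (intro conjI)
  have r: "regular q a" "regular q d" "regular q (a / d)" "regular q (a * d)"
     "regular q (a\<^sup>2 / d)" "regular q (a / d\<^sup>2)" "regular q (d\<^sup>2)"
    using assms(1) by (simp_all add: cubic_regular_def)
  show "regular q (a * q ^ (4 * m))"
    by (rule regular_shift[OF r(1) assms(2), of _ 0 "4 * m"]) simp
  show "regular q (d * q ^ (2 * m))"
    by (rule regular_shift[OF r(2) assms(2), of _ 0 "2 * m"]) simp
  show "regular q (a * q ^ (4 * m) / (d * q ^ (2 * m)))"
    by (rule regular_shift[OF r(3) assms(2), of _ "2 * m" "4 * m"]) (use assms in simp)
  show "regular q (a * q ^ (4 * m) * (d * q ^ (2 * m)))"
    by (rule regular_shift[OF r(4) assms(2), of _ 0 "6 * m"])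
      (simp add: mult_ac flip: power_add)
  show "regular q ((a * q ^ (4 * m))\<^sup>2 / (d * q ^ (2 * m)))"
    by (rule regular_shift[OF r(5) assms(2), of _ "2 * m" "8 * m"])
      (use assms in \<open>simp add: power_mult_distrib flip: power_mult\<close>)
  show "regular q (a * q ^ (4 * m) / (d * q ^ (2 * m))\<^sup>2)"
    by (rule regular_shift[OF r(6) assms(2), of _ 0 0])
      (use assms in \<open>simp add: power_mult_distrib flip: power_mult\<close>)
  show "regular q ((d * q ^ (2 * m))\<^sup>2)"
    by (rule regular_shift[OF r(7) assms(2), of _ 0 "4 * m"])
      (simp add: power_mult_distrib flip: power_mult)
qed

text \<open>The comparison of coefficients below with every shifted factorial replaced by a
  variable, which leaves pure monomial algebra. The relations \<open>rel\<close> record splittings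
  of products and, last, one relation between reflection scalars.\<close>

lemma coefficient_quotient_identity:
  fixes \<theta>4 :: complex
  assumes rel: "D3 = D2 * Dm" "\<theta>4 * A3 * T3 = \<theta>a * A4" "A4 * Ap = A3n * An" "Ad2 * Adp * Y1 = Ad3"
      "\<alpha>1 * \<alpha>2 * \<theta>\<alpha>2 = \<theta>\<alpha> * W" "W * V' = V * Vm" "U = U' * Y2" "qm * r2 * r4 = Qm * r3 * r1"
    and nz: "\<theta>a \<noteq> 0" "A3 \<noteq> 0" "An \<noteq> 0" "Ad3 \<noteq> 0" "\<theta>\<alpha> \<noteq> 0" "V \<noteq> 0" "Vm \<noteq> 0" "V' \<noteq> 0" "Y2 \<noteq> 0"
      "r1 \<noteq> 0" "r4 \<noteq> 0" "QQ \<noteq> 0"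
  shows "\<theta>4 / \<theta>a * (D2 / Ad2) * (Te * TN / ((r1 * Y1) * An)) * qm * ((r2 * Dm) * T3) * (Ap * U' / (Adp * V')) =
    A3n * U / (Ad3 * V) * (\<theta>\<alpha>2 / \<theta>\<alpha> * Qm * (\<alpha>1 / QQ) * (Te / (r4 * Y2) * (D3 / A3)) * (TN / Vm)) * ((r3 * QQ) * \<alpha>2)"
proof -
  have T3: "\<theta>4 * T3 = \<theta>a * A4 / A3"
    using rel(2) nz by (simp add: field_simps)
  have V1: "1 / V' = W / (V * Vm)"
    using rel(6) nz by (simp add: field_simps)
  have "\<theta>4 / \<theta>a * (D2 / Ad2) * (Te * TN / ((r1 * Y1) * An)) * qm * ((r2 * Dm) * T3) * (Ap * U' / (Adp * V')) =
      (\<theta>4 * T3) * Ap * (D2 * Dm) * Te * TN * (qm * r2) * U' / (\<theta>a * (Ad2 * Adp * Y1) * r1 * An * V')"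
    by (simp add: mult_ac)
  also have "\<dots> = (A4 * Ap) * D3 * Te * TN * (qm * r2) * U' / (A3 * Ad3 * r1 * An * V')"
    unfolding T3 rel(1,4) using nz by (simp add: mult_ac)
  also have "\<dots> = A3n * D3 * Te * TN * U' / (A3 * Ad3 * V') * (qm * r2 / r1)"
    unfolding rel(3) using nz by (simp add: mult_ac)
  also have "qm * r2 / r1 = Qm * r3 / r4"
    using rel(8) nz by (simp add: field_simps)
  also have "A3n * D3 * Te * TN * U' / (A3 * Ad3 * V') = A3n * D3 * Te * TN * U' / (A3 * Ad3) * (W / (V * Vm))"
    by (simp only: V1[symmetric]) simp
  also have "W = \<alpha>1 * \<alpha>2 * \<theta>\<alpha>2 / \<theta>\<alpha>"
    using rel(5) nz by simp
  also have "A3n * D3 * Te * TN * U' / (A3 * Ad3) * (\<alpha>1 * \<alpha>2 * \<theta>\<alpha>2 / \<theta>\<alpha> / (V * Vm)) * (Qm * r3 / r4) =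
    A3n * U / (Ad3 * V) * (\<theta>\<alpha>2 / \<theta>\<alpha> * Qm * (\<alpha>1 / QQ) * (Te / (r4 * Y2) * (D3 / A3)) * (TN / Vm)) * ((r3 * QQ) * \<alpha>2)"
    unfolding rel(7) using nz by (simp add: mult_ac)
  finally show ?thesis .
qed

text \<open>The coefficients of both series evaluated at the interpolation point \<open>b = a q\<^sup>3\<^sup>m\<close>.\<close>

lemma cubic_coefficients_match:
  assumes q: "generic_base q" and nz: "a \<noteq> 0" "d \<noteq> 0"
    and bal: "d * e = a\<^sup>2 * q ^ (3 * n + 1)" and s: "s = a * q / d" and m: "m \<le> n"
    and reg: "cubic_regular q a d"
  shows "cubic_coeff q a d e n m * pairfac q s s (a * q ^ (3 * m)) m *
      cubic_factor q (a * q ^ (4 * m)) (d * q ^ (2 * m)) (n - m) =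
    cubic_factor q a d n * base3_coeff q a d e n m * pairfac (q ^ 3) s a (a * q ^ (3 * m)) m"
proof -
  obtain r where n: "n = m + r" using m le_Suc_ex by blast
  have q0: "q \<noteq> 0" using q by (simp add: generic_base_def)
  have r: "regular q a" "regular q d" "regular q (a / d)" "regular q (a * d)"
     "regular q (a\<^sup>2 / d)" "regular q (a / d\<^sup>2)" "regular q (d\<^sup>2)"
    using reg by (simp_all add: cubic_regular_def)
  have e: "e = a\<^sup>2 * q ^ (3 * n + 1) / d"
    using bal nz by (simp add: field_simps)
  define Q where "Q = q ^ 3"
  have Q0: "Q \<noteq> 0" using q0 by (simp add: Q_def)
  have Qp: "Q ^ k = q ^ (3 * k)" for k by (simp add: Q_def power_mult)
  define \<alpha> where "\<alpha> = a * d / q"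
  \<comment> \<open>\<open>y1\<close> and \<open>y2\<close> start the last \<open>m\<close> factors
    of the denominator and numerator products of \<open>cubic_factor\<close> in
    \<open>a q / d\<close> and \<open>a q^2 / d^2\<close>. Reflected, these factors become the ones
    of \<open>a q / e\<close> in base \<open>q\<close> and of \<open>\<alpha> Q / e\<close> in base
    \<open>Q\<close>.\<close>
  define y1 where "y1 = a / d * q ^ (3 * r + 2 * m + 1)"
  define y2 where "y2 = a / d\<^sup>2 * q ^ (3 * r + 2)"
  let ?r1 = "reflect_factor q y1 m" and ?r2 = "reflect_factor q (d * q ^ (2 * m)) m"
  let ?r3 = "reflect_factor Q Q m" and ?r4 = "reflect_factor Q y2 m"
  let ?Dm = "tfac q (d * q ^ (2 * m)) m" and ?T3 = "tfac q (a * q ^ (3 * m)) m"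
  let ?Ap = "tfac q (a * q ^ (4 * m + 1)) (3 * r)" and ?U' = "tfac Q (a * q ^ 2 / d ^ 2) r"
  let ?Adp = "tfac q (a * q / d * q ^ (2 * m)) (3 * r)" and ?V' = "tfac Q (a * d * q ^ 2 * q ^ (6 * m)) r"
  let ?D3 = "tfac q d (3 * m)" and ?A3 = "tfac q a (3 * m)" and ?An = "tfac q (a * q ^ (3 * n + 1)) m"
  let ?Vm = "tfac Q (a * d * q ^ (3 * n + 2)) m"
  have D3: "?D3 = tfac q d (2 * m) * ?Dm"
    using tfac_add[of q d "2 * m" m] by simp
  have A4: "\<theta> (a * q ^ (4 * m)) * ?A3 * ?T3 = \<theta> a * tfac q (a * q) (4 * m)"
  proof -
    have "tfac q a (3 * m + m) = ?A3 * ?T3" by (rule tfac_add)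
    moreover have "3 * m + m = 4 * m" by simp
    ultimately have "tfac q a (Suc (4 * m)) = ?A3 * ?T3 * \<theta> (a * q ^ (4 * m))"
      by (simp only: tfac_Suc)
    then show ?thesis by (simp only: tfac_Suc_shift mult_ac)
  qed
  have An: "tfac q (a * q) (4 * m) * ?Ap = tfac q (a * q) (3 * n) * ?An"
  proof -
    have "tfac q (a * q) (4 * m) * ?Ap = tfac q (a * q) (4 * m + 3 * r)"
      by (simp add: tfac_add power_add mult_ac)
    also have "4 * m + 3 * r = 3 * n + m" by (simp add: n)
    also have "tfac q (a * q) (3 * n + m) = tfac q (a * q) (3 * n) * ?An"
      by (simp add: tfac_add power_add mult_ac)
    finally show ?thesis .
  qed
  have Ad: "tfac q (a * q / d) (2 * m) * ?Adp * tfac q y1 m = tfac q (a * q / d) (3 * n)"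
  proof -
    have "3 * n = 2 * m + 3 * r + m" by (simp add: n)
    moreover have "a * q / d * q ^ (2 * m + 3 * r) = y1"
      by (simp add: y1_def power_add mult_ac)
    ultimately show ?thesis by (simp only: tfac_add)
  qed
  have W: "tfac Q \<alpha> m * tfac Q (\<alpha> * Q ^ m) m * \<theta> (\<alpha> * Q ^ (2 * m)) = \<theta> \<alpha> * tfac Q (a * d * q ^ 2) (2 * m)"
  proof -
    have "tfac Q \<alpha> (Suc (m + m)) = tfac Q \<alpha> m * tfac Q (\<alpha> * Q ^ m) m * \<theta> (\<alpha> * Q ^ (2 * m))"
      by (simp only: tfac_Suc tfac_add mult_2)
    moreover have "\<alpha> * Q = a * d * q ^ 2"
      using q0 by (simp add: \<alpha>_def Q_def power2_eq_square power3_eq_cube)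
    ultimately show ?thesis by (simp only: tfac_Suc_shift mult_2)
  qed
  have V: "tfac Q (a * d * q ^ 2) (2 * m) * ?V' = tfac Q (a * d * q ^ 2) n * ?Vm"
  proof -
    have "tfac Q (a * d * q ^ 2) (2 * m) * ?V' = tfac Q (a * d * q ^ 2) (2 * m + r)"
      by (simp add: tfac_add Qp)
    also have "2 * m + r = n + m" by (simp add: n)
    also have "tfac Q (a * d * q ^ 2) (n + m) = tfac Q (a * d * q ^ 2) n * ?Vm"
      by (simp add: tfac_add Qp power_add power2_eq_square mult_ac)
    finally show ?thesis .
  qed
  have U: "tfac Q (a * q ^ 2 / d ^ 2) n = ?U' * tfac Q y2 m"
  proof -
    have "a * q ^ 2 / d ^ 2 * Q ^ r = y2"
      by (simp add: y2_def Qp power_add power2_eq_square mult_ac)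
    then show ?thesis by (simp only: n tfac_add add.commute[of m r])
  qed
  have R1: "tfac q (a * q / e) m = ?r1 * tfac q y1 m"
  proof (rule tfac_reflect)
    assume "m > 0"
    then obtain l where "m = Suc l" using gr0_implies_Suc by blast
    then show "y1 * (a * q / e) * q ^ (m - 1) = 1"
      using nz q0 by (simp add: y1_def e n power_add power2_eq_square eval_nat_numeral mult_ac)
  qed (use q0 nz in \<open>auto simp: y1_def\<close>)
  have R2: "tfac q (s / (a * q ^ (3 * m))) m = ?r2 * ?Dm"
  proof (rule tfac_reflect)
    assume "m > 0"
    then obtain l where "m = Suc l" using gr0_implies_Suc by blast
    then show "d * q ^ (2 * m) * (s / (a * q ^ (3 * m))) * q ^ (m - 1) = 1"
      using nz q0 by (simp add: s power_add power2_eq_square eval_nat_numeral mult_ac)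
  qed (use q0 nz in auto)
  have R3: "tfac Q (a / (a * q ^ (3 * m))) m = ?r3 * tfac Q Q m"
  proof (rule tfac_reflect)
    assume "m > 0"
    then obtain l where "m = Suc l" using gr0_implies_Suc by blast
    then show "Q * (a / (a * q ^ (3 * m))) * Q ^ (m - 1) = 1"
      using nz q0 Q0 unfolding Qp[symmetric] by simp
  qed (use Q0 in auto)
  have R4: "tfac Q (\<alpha> * Q / e) m = ?r4 * tfac Q y2 m"
  proof (rule tfac_reflect)
    assume "m > 0"
    then obtain l where "m = Suc l" using gr0_implies_Suc by blast
    then show "y2 * (\<alpha> * Q / e) * Q ^ (m - 1) = 1"
      using nz q0 unfolding Qp
      by (simp add: y2_def \<alpha>_def Q_def e n power_add power2_eq_square eval_nat_numeral mult_ac)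
  qed (use Q0 q0 nz in \<open>auto simp: y2_def\<close>)
  \<comment> \<open>Scalars can be compared only within one base. The ratios that arise in base
    \<open>q\<close> and base \<open>Q\<close> combine, together with \<open>q\<close>, to exactly
    \<open>Q\<close>.\<close>
  have refl: "q ^ m * ?r2 * ?r4 = Q ^ m * ?r3 * ?r1"
  proof -
    have s1: "?r2 = (y1 / (d * q ^ (2 * m))) ^ m * ?r1"
      by (rule reflect_factor_scale) (use nz q0 in \<open>auto simp: y1_def\<close>)
    have s2: "?r4 = (Q / y2) ^ m * ?r3"
      by (rule reflect_factor_scale) (use nz q0 Q0 in \<open>auto simp: y2_def\<close>)
    have "q ^ m * ?r2 * ?r4 = (q * (y1 / (d * q ^ (2 * m))) * (Q / y2)) ^ m * ?r1 * ?r3"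
      unfolding s1 s2 power_mult_distrib by (simp only: mult_ac)
    also have "q * (y1 / (d * q ^ (2 * m))) * (Q / y2) = Q"
      using q0 nz by (simp add: y1_def y2_def power_add power2_eq_square mult_ac)
    finally show ?thesis by (simp only: mult_ac)
  qed
  have E1: "cubic_coeff q a d e n m = \<theta> (a * q ^ (4 * m)) / \<theta> a * (tfac q d (2 * m) / tfac q (a * q / d) (2 * m)) *
      (tfac Q e m * tfac Q (1 / q ^ (3 * n)) m / ((?r1 * tfac q y1 m) * ?An)) * q ^ m"
    by (simp only: cubic_coeff_def R1 Q_def)
  have E2: "pairfac q s s (a * q ^ (3 * m)) m = (?r2 * ?Dm) * ?T3"
  proof -
    have "s * (a * q ^ (3 * m)) / s = a * q ^ (3 * m)"
      using nz q0 by (simp add: s)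
    then show ?thesis by (simp only: pairfac_def R2)
  qed
  have E3: "cubic_factor q (a * q ^ (4 * m)) (d * q ^ (2 * m)) (n - m) = ?Ap * ?U' / (?Adp * ?V')"
  proof -
    have "a * q ^ (4 * m) * q = a * q ^ (4 * m + 1)"
      "a * q ^ (4 * m) * q\<^sup>2 / (d * q ^ (2 * m))\<^sup>2 = a * q ^ 2 / d ^ 2"
      "a * q ^ (4 * m) * q / (d * q ^ (2 * m)) = a * q / d * q ^ (2 * m)"
      "a * q ^ (4 * m) * (d * q ^ (2 * m)) * q\<^sup>2 = a * d * q ^ 2 * q ^ (6 * m)" "n - m = r"
      using q0 by (simp_all add: n power_add power2_eq_square eval_nat_numeral mult_ac)
    then show ?thesis by (simp only: cubic_factor_def Q_def)
  qed
  have E4: "cubic_factor q a d n = tfac q (a * q) (3 * n) * tfac Q (a * q ^ 2 / d ^ 2) n /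
     (tfac q (a * q / d) (3 * n) * tfac Q (a * d * q ^ 2) n)"
    by (simp only: cubic_factor_def Q_def)
  have E5: "base3_coeff q a d e n m = \<theta> (\<alpha> * Q ^ (2 * m)) / \<theta> \<alpha> * Q ^ m * (tfac Q \<alpha> m / tfac Q Q m) *
      (tfac Q e m / (?r4 * tfac Q y2 m) * (?D3 / ?A3)) * (tfac Q (1 / q ^ (3 * n)) m / ?Vm)"
  proof -
    have "\<alpha> * Q / d = a * q ^ 2" "\<alpha> * Q / (d * q) = a * q" "\<alpha> * Q / (d * q ^ 2) = a"
      using q0 nz by (simp_all add: \<alpha>_def Q_def eval_nat_numeral)
    note arg = this
    have D3': "?D3 = tfac Q d m * tfac Q (d * q) m * tfac Q (d * q ^ 2) m"
      and A3': "?A3 = tfac Q a m * tfac Q (a * q) m * tfac Q (a * q ^ 2) m"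
      by (simp_all only: tfac_triple Q_def)
    show ?thesis
      unfolding base3_coeff_def wp_weight_def \<alpha>_def[symmetric] Q_def[symmetric] D3' A3'
      by (simp only: list.map prod_list.Cons prod_list.Nil R4 arg) (simp add: mult_ac)
  qed
  have E6: "pairfac (q ^ 3) s a (a * q ^ (3 * m)) m = (?r3 * tfac Q Q m) * tfac Q (\<alpha> * Q ^ m) m"
  proof -
    have "a * (a * q ^ (3 * m)) / s = \<alpha> * Q ^ m"
      using q0 nz by (simp add: s \<alpha>_def Qp)
    then show ?thesis by (simp only: pairfac_def R3 Q_def[symmetric])
  qed
  have rQ: "tfac Q (x * q ^ k) j \<noteq> 0" if "regular q x" for x k j
    using regular_tfac[OF regular_power[where k = 3, OF regular_shift[OF that q0, of "x * q ^ k" 0 k]], of "x * q ^ k" 0 0 j] q0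
    by (simp add: Q_def)
  have N: "\<theta> a \<noteq> 0" "?A3 \<noteq> 0" "?An \<noteq> 0" "tfac q (a * q / d) (3 * n) \<noteq> 0"
    using regularD0[OF r(1)] regular_tfac[OF r(1) q0, of a 0 0] 
      regular_tfac[OF r(1) q0, of "a * q ^ (3 * n + 1)" 0 "3 * n + 1"]
      regular_tfac[OF r(3) q0, of "a * q / d" 0 1] by simp_all
  have N\<alpha>: "\<theta> \<alpha> \<noteq> 0"
    by (rule regularE[OF r(4) q0, of _ 1 0]) (use q0 in \<open>simp add: \<alpha>_def\<close>)
  have NV: "tfac Q (a * d * q ^ 2) n \<noteq> 0" "?Vm \<noteq> 0" "?V' \<noteq> 0"
    using rQ[OF r(4), of 2] rQ[OF r(4), of "3 * n + 2"] rQ[OF r(4), of "6 * m + 2"]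
    by (simp_all add: power_add power2_eq_square mult_ac)
  have NY: "tfac Q y2 m \<noteq> 0"
    unfolding y2_def by (rule rQ[OF r(6)])
  have y: "y1 \<noteq> 0" "y2 \<noteq> 0"
    using nz q0 by (simp_all add: y1_def y2_def)
  have NQ: "tfac Q Q m \<noteq> 0"
    unfolding Q_def by (rule generic_base_tfac[OF generic_base_power[OF q]]) simp
  show ?thesis
    unfolding E1 E2 E3 E4 E5 E6
    by (rule coefficient_quotient_identity[OF D3 A4 An Ad W V U refl N N\<alpha> NV NY
        reflect_factor_nonzero[OF q0 y(1)] reflect_factor_nonzero[OF Q0 y(2)] NQ])
qed

lemma cubic_coeff_0:
  assumes "\<theta> a \<noteq> 0"
  shows "cubic_coeff q a d e n 0 = 1"
  using assms by (simp add: cubic_coeff_def)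

lemma base3_coeff_0:
  assumes "\<theta> (a * d / q) \<noteq> 0"
  shows "base3_coeff q a d e n 0 = 1"
  using assms by (simp add: base3_coeff_def wp_weight_def)

text \<open>The tail of the cubic series is again a cubic series, of length \<open>r\<close>; the
  shifted parameters satisfy the balancing condition for \<open>r\<close>.\<close>

lemma cubic_coeff_add:
  assumes q: "q \<noteq> 0" and nz: "a \<noteq> 0" "d \<noteq> 0" "e \<noteq> 0" and a: "\<theta> (a * q ^ (4 * m)) \<noteq> 0"
  shows "cubic_coeff q a d e (m + r) (m + i) =
    cubic_coeff q a d e (m + r) m * cubic_coeff q (a * q ^ (4 * m)) (d * q ^ (2 * m)) (e * q ^ (3 * m)) r i"
proof -
  have arg: "1 / q ^ (3 * (m + r)) * q ^ (3 * m) = 1 / q ^ (3 * r)"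
    "a * q / d * q ^ (2 * m) = a * q ^ (4 * m) * q / (d * q ^ (2 * m))"
    "a * q / e * q ^ m = a * q ^ (4 * m) * q / (e * q ^ (3 * m))"
    "a * q ^ (3 * (m + r) + 1) * q ^ m = a * q ^ (4 * m) * q ^ (3 * r + 1)"
    "a * q ^ (4 * (m + i)) = a * q ^ (4 * m) * q ^ (4 * i)"
    using q nz by (simp_all add: power_add eval_nat_numeral mult_ac)
  have arg': "(q ^ 3) ^ m = q ^ (3 * m)" "2 * (m + i) = 2 * m + 2 * i"
    by (simp_all add: power_mult)
  show ?thesis
    using a unfolding cubic_coeff_def arg'(2) tfac_add arg' arg power_add[of q m i]
    by (simp add: mult_ac)
qed

text \<open>At \<open>b = 1\<close> the pair cancels the parameter \<open>d q^2\<close> and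
  contributes \<open>d / q\<close>. Together with \<open>d q\<close> this forms a pair with product
  \<open>d^2\<close>, and the series becomes a Frenkel--Turaev sum in base
  \<open>q^3\<close>.\<close>

lemma cubic_expansion_at_1:
  assumes q: "generic_base q" and nz: "a \<noteq> 0" "d \<noteq> 0" "e \<noteq> 0"
    and bal: "d * e = a\<^sup>2 * q ^ (3 * n + 1)" and s: "s = a * q / d"
    and reg: "cubic_regular q a d"
  shows "cubic_factor q a d n * (\<Sum>j\<le>n. base3_coeff q a d e n j *
      (pairfac (q ^ 3) s a 1 j / pairfac (q ^ 3) s (a * q ^ 3) 1 j)) = 1"
proof -
  have q0: "q \<noteq> 0" using q by (simp add: generic_base_def)
  have r: "regular q a" "regular q d" "regular q (a / d)" "regular q (a * d)"
     "regular q (a\<^sup>2 / d)" "regular q (a / d\<^sup>2)" "regular q (d\<^sup>2)"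
    using reg by (simp_all add: cubic_regular_def)
  have e: "e = a\<^sup>2 * q ^ (3 * n + 1) / d"
    using bal nz by (simp add: field_simps)
  define Q where "Q = q ^ 3"
  have Q0: "Q \<noteq> 0" using q0 by (simp add: Q_def)
  define \<alpha> where "\<alpha> = a * d / q"
  have \<alpha>0: "\<alpha> \<noteq> 0" using nz q0 by (simp add: \<alpha>_def)
  have shift: "regular Q x" if "regular q y" "x * q ^ i = y * q ^ j" for x y i j
    unfolding Q_def by (rule regular_power[OF regular_shift[OF that(1) q0 that(2)]])
  have tf: "tfac Q x k \<noteq> 0" if "regular q y" "x * q ^ i = y * q ^ j" for x y i j k
    using regular_tfac[OF shift[OF that] Q0, of x 0 0] by simp
  have arg: "\<alpha> * Q / d = a * q ^ 2" "\<alpha> * Q / (d * q) = a * q" "\<alpha> * Q / (d * q ^ 2) = a"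
    "\<alpha> * Q * (d / q) / d\<^sup>2 = a * q" "\<alpha> * Q / (d / q) = a * Q" "d\<^sup>2 / (d / q) = d * q"
    "d\<^sup>2 * (d / q) / d\<^sup>2 = d / q" "a / s = d / q" "a * Q / s = d * q ^ 2"
    "\<alpha> * Q ^ (n + 1) = a * d * q ^ (3 * n + 2)" "1 / Q ^ n = 1 / q ^ (3 * n)"
    using q0 nz by (simp_all add: \<alpha>_def Q_def s eval_nat_numeral power_mult_distrib power_add mult_ac)
  have "base3_coeff q a d e n j * (pairfac Q s a 1 j / pairfac Q s (a * Q) 1 j) =
      wp_weight Q \<alpha> [d, e] j * wp_pair Q \<alpha> (d\<^sup>2) (d / q) n j" for j
  proof -
    have "tfac Q a j \<noteq> 0" "tfac Q (d * q ^ 2) j \<noteq> 0"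
      using tf[OF r(1), of a 0 0] tf[OF r(2), of "d * q ^ 2" 0 2] by auto
    then show ?thesis
      unfolding base3_coeff_def wp_pair_def pairfac_def wp_weight_def Q_def[symmetric] \<alpha>_def[symmetric] arg
      by (simp only: list.map prod_list.Cons prod_list.Nil arg div_by_1 mult_1_right) (simp add: mult_ac)
  qed
  then have "(\<Sum>j\<le>n. base3_coeff q a d e n j * (pairfac Q s a 1 j / pairfac Q s (a * Q) 1 j)) =
      (\<Sum>j\<le>n. wp_weight Q \<alpha> [d, e] j * wp_pair Q \<alpha> (d\<^sup>2) (d / q) n j)"
    by simp
  also have "\<dots> = wp_prefactor Q (\<alpha> * Q) (\<alpha> * Q / d) (d\<^sup>2) (d / q) n"
  proof (rule frenkel_turaev)
    show "generic_base Q" unfolding Q_def by (rule generic_base_power[OF q]) simp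
    show "d\<^sup>2 * d * e = \<alpha>\<^sup>2 * Q ^ (n + 1)"
      using nz q0 by (simp add: e \<alpha>_def Q_def eval_nat_numeral power_mult_distrib power_add)
    show "regular Q \<alpha>" by (rule shift[OF r(4), of _ 1 0]) (use q0 in \<open>simp add: \<alpha>_def\<close>)
    show "regular Q d" by (rule shift[OF r(2), of _ 0 0]) simp
    show "regular Q e" by (rule shift[OF r(5), of _ 0 "3 * n + 1"]) (simp add: e)
    show "regular Q (\<alpha> / d)" by (rule shift[OF r(1), of _ 1 0]) (use q0 nz in \<open>simp add: \<alpha>_def\<close>)
    show "regular Q (\<alpha> / e)"
      by (rule shift[OF regular_swap[OF r(6)], of _ "3 * n + 2" 0])
        (use q0 nz in \<open>simp_all add: \<alpha>_def e eval_nat_numeral\<close>)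
    show "regular Q (d\<^sup>2)" by (rule shift[OF r(7), of _ 0 0]) simp
    show "regular Q (\<alpha> / d\<^sup>2)"
      by (rule shift[OF r(3), of _ 1 0]) (use q0 nz in \<open>simp_all add: \<alpha>_def power2_eq_square\<close>)
    show "pairfac Q (d\<^sup>2) (\<alpha> * Q) (d / q) n \<noteq> 0"
      using tf[OF r(1), of "a * Q" 0 3] tf[OF r(1), of "a * q" 0 1] unfolding pairfac_def arg by (simp add: Q_def)
  qed (use nz q0 \<alpha>0 in auto)
  also have "\<dots> = tfac Q (a * d * q ^ 2) n * tfac q (a * q / d) (3 * n) /
      (tfac q (a * q) (3 * n) * tfac Q (a * q ^ 2 / d ^ 2) n)"
  \<comment> \<open>The arguments of three factors above and three below run through the residues
    modulo 3, so they merge into products of length \<open>3 * n\<close> in base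
    \<open>q\<close>.\<close>
  proof -
    have arg2: "\<alpha> * Q = a * d * q ^ 2" "a * d * q ^ 2 / d\<^sup>2 = a * q / d * q" "a * q\<^sup>2 / (d / q) = a * q / d * q ^ 2"
       "a * q\<^sup>2 * (d / q) / d\<^sup>2 = a * q / d" "a * d * q ^ 2 / (d / q) = a * q * q ^ 2" "a * d * q\<^sup>2 * (d / q) / d\<^sup>2 = a * q"
       "a * d * q ^ 2 / d = a * q * q" 
      using q0 nz by (simp_all add: \<alpha>_def Q_def eval_nat_numeral)
    show ?thesis
      unfolding wp_prefactor_def pairfac_def arg(1) arg2(1) tfac_triple Q_def[symmetric]
      using arg2 by (simp add: mult_ac power2_eq_square)
  qed
  finally have "(\<Sum>j\<le>n. base3_coeff q a d e n j * (pairfac Q s a 1 j / pairfac Q s (a * Q) 1 j)) =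
      tfac Q (a * d * q ^ 2) n * tfac q (a * q / d) (3 * n) /
      (tfac q (a * q) (3 * n) * tfac Q (a * q ^ 2 / d ^ 2) n)" .
  moreover have "tfac Q (a * d * q ^ 2) n \<noteq> 0" "tfac Q (a * q ^ 2 / d ^ 2) n \<noteq> 0"
    using tf[OF r(4), of "a * d * q ^ 2" 0 2] tf[OF r(6), of "a * q ^ 2 / d ^ 2" 0 2] by simp_all
  moreover have "tfac q (a * q / d) (3 * n) \<noteq> 0" "tfac q (a * q) (3 * n) \<noteq> 0"
    using regular_tfac[OF r(3) q0, of "a * q / d" 0 1] regular_tfac[OF r(1) q0, of "a * q" 0 1] by simp_all
  ultimately show ?thesis
    by (simp add: cubic_factor_def flip: Q_def)
qed

text \<open>Both sides are theta forms in \<open>b\<close> of degree \<open>n\<close>. At \<open>b = 1\<close> the left side is 1 and the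
  right side is a Frenkel--Turaev sum. At \<open>b = a q\<^sup>3\<^sup>m\<close> the right side has only the term
  \<open>j = m\<close>, while the left side is a shifted series with \<open>b = a\<close>, evaluated by induction.\<close>

lemma cubic_expansion:
  assumes q: "generic_base q" and nz: "a \<noteq> 0" "d \<noteq> 0" "e \<noteq> 0" "b \<noteq> 0"
    and bal: "d * e = a\<^sup>2 * q ^ (3 * n + 1)" and s: "s = a * q / d"
    and reg: "cubic_regular q a d"
    and den: "pairfac (q ^ 3) s (a * q ^ 3) b n \<noteq> 0"
  shows "(\<Sum>k\<le>n. cubic_coeff q a d e n k * (pairfac q s s b k / pairfac (q ^ 3) s (a * q ^ 3) b k)) =
    cubic_factor q a d n * (\<Sum>j\<le>n. base3_coeff q a d e n j *
      (pairfac (q ^ 3) s a b j / pairfac (q ^ 3) s (a * q ^ 3) b j))"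
  using nz bal s reg den
proof (induction n arbitrary: a d e s b rule: less_induct)
  case (less n)
  note nz = less.prems(1-4) and bal = less.prems(5) and s = less.prems(6) and reg = less.prems(7)
    and den = less.prems(8)
  have q0: "q \<noteq> 0" using q by (simp add: generic_base_def)
  define Q where "Q = q ^ 3"
  have Q0: "Q \<noteq> 0" using q0 by (simp add: Q_def)
  have Qp: "Q ^ k = q ^ (3 * k)" for k by (simp add: Q_def power_mult)
  have qQ: "generic_base Q" unfolding Q_def by (rule generic_base_power[OF q]) simp
  have s0: "s \<noteq> 0" using nz q0 s by simp
  have r: "regular q a" "regular q d" "regular q (a / d)" "regular q (a * d)"
    using reg by (simp_all add: cubic_regular_def)
  have tf: "tfac Q x k \<noteq> 0" if "regular q y" "x * q ^ i = y * q ^ j" for x y i j k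
    using regular_tfac[OF regular_power[OF regular_shift[OF that(1) q0 that(2)], of 3], of x 0 0] Q0
    by (simp add: Q_def)
  let ?M = "\<lambda>k y. pairfac q s s y k" and ?N = "\<lambda>k y. pairfac Q s a y k"
  define L where "L = cleared_sum Q s (a * Q) ?M (cubic_coeff q a d e n) n"
  define R where "R = cleared_sum Q s (a * Q) ?N (base3_coeff q a d e n) n"
  define G where "G y = L y - cubic_factor q a d n * R y" for y
  have "theta_form s n L"
    unfolding L_def by (rule theta_form_cleared_sum) (use Q0 q0 nz s0 theta_form_pairfac in auto)
  moreover have "theta_form s n (\<lambda>y. cubic_factor q a d n * R y)"
    unfolding R_def by (intro theta_form.scale theta_form_cleared_sum) (use Q0 q0 nz s0 theta_form_pairfac in auto)
  ultimately have formG: "theta_form s n G"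
    unfolding G_def[abs_def] by (rule theta_form_diff)
  define t where "t m = (if m = 0 then 1 else a * Q ^ m)" for m
  have "G 1 = 0"
  proof -
    have den1: "pairfac Q s (a * Q) 1 n \<noteq> 0"
      using tf[OF r(1), of "a * Q" 0 3] tf[OF r(2), of "a * Q / s" 0 2] nz q0
      by (simp add: pairfac_def s Q_def eval_nat_numeral)
    have "L 1 = pairfac Q s (a * Q) 1 n *
        (\<Sum>k\<le>n. cubic_coeff q a d e n k * (?M k 1 / pairfac Q s (a * Q) 1 k))"
      unfolding L_def by (rule cleared_sum_eq[OF den1])
    also have "(\<Sum>k\<le>n. cubic_coeff q a d e n k * (?M k 1 / pairfac Q s (a * Q) 1 k)) =
        (\<Sum>k\<le>n. if k = 0 then 1 else 0)"
    proof (rule sum.cong)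
      fix k assume "k \<in> {..n}"
      show "cubic_coeff q a d e n k * (?M k 1 / pairfac Q s (a * Q) 1 k) = (if k = 0 then 1 else 0)"
        using tfac_one[of k q] regularD0[OF r(1)] s0 by (cases k) (simp_all add: pairfac_def cubic_coeff_0)
    qed simp
    finally have L1: "L 1 = pairfac Q s (a * Q) 1 n" by simp
    have R1: "cubic_factor q a d n * R 1 = pairfac Q s (a * Q) 1 n * (cubic_factor q a d n *
        (\<Sum>j\<le>n. base3_coeff q a d e n j * (?N j 1 / pairfac Q s (a * Q) 1 j)))"
      unfolding R_def by (subst cleared_sum_eq[OF den1]) (simp only: mult_ac)
    show ?thesis
      unfolding G_def L1 R1 unfolding Q_def cubic_expansion_at_1[OF q nz(1-3) bal s reg] by simp
  qed
  moreover have "G (a * Q ^ m) = 0" if m: "0 < m" "m \<le> n" for m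
  proof -
    let ?y = "a * Q ^ m"
    obtain l where n: "n = m + l" using m(2) le_Suc_ex by blast
    \<comment> \<open>The point is a zero of the common denominator: for \<open>k < m\<close> the
      uncancelled part of it still contains \<open>\<theta> 1\<close>.\<close>
    have vanish: "pairfac Q s (a * Q * Q ^ k) ?y (n - k) = 0" if "k < m" for k
    proof -
      have "m = k + 1 + (m - 1 - k)" using that by simp
      then have "Q ^ m = Q ^ (k + 1 + (m - 1 - k))" by simp
      then have "a * Q * Q ^ k / ?y * Q ^ (m - 1 - k) = 1"
        using nz Q0 by (simp add: power_add)
      moreover have "m - 1 - k < n - k" using m that by simp
      ultimately have "tfac Q (a * Q * Q ^ k / ?y) (n - k) = 0"
        using tfac_eq_0 ellE_1 by metis
      then show ?thesis by (simp add: pairfac_def)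
    qed
    define D where "D = pairfac Q s (a * Q * Q ^ m) ?y l"
    \<comment> \<open>Parameters of the tail that starts at index \<open>m\<close>. Relative to them
      the point \<open>a Q^m\<close> is the value \<open>b = ?a\<close>.\<close>
    let ?a = "a * q ^ (4 * m)" and ?d = "d * q ^ (2 * m)" and ?e = "e * q ^ (3 * m)" and ?s = "s * q ^ (2 * m)"
    have nz': "?a \<noteq> 0" "?d \<noteq> 0" "?e \<noteq> 0" "?s \<noteq> 0" using nz q0 s0 by auto
    have s': "?s = ?a * q / ?d"
      using nz q0 by (simp add: s eval_nat_numeral power_add)
    have reg': "cubic_regular q ?a ?d"
      using cubic_regular_shift[OF reg q0 nz(1,2)] .
    have ra': "regular q ?a" using reg' by (simp add: cubic_regular_def)
    have "L ?y = (\<Sum>k\<le>n. cubic_coeff q a d e n k * (?M k ?y * pairfac Q s (a * Q * Q ^ k) ?y (n - k)))"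
      by (simp add: L_def cleared_sum_def)
    also have "\<dots> = (\<Sum>k\<in>{m..n}. cubic_coeff q a d e n k * (?M k ?y * pairfac Q s (a * Q * Q ^ k) ?y (n - k)))"
      by (rule sum.mono_neutral_right) (use vanish in auto)
    also have "\<dots> = (\<Sum>i\<le>l. cubic_coeff q a d e n (m + i) *
        (?M (m + i) ?y * pairfac Q s (a * Q * Q ^ (m + i)) ?y (n - (m + i))))"
      by (rule sum.reindex_bij_witness[of _ "\<lambda>i. m + i" "\<lambda>k. k - m"]) (auto simp: n)
    also have "\<dots> = (\<Sum>i\<le>l. cubic_coeff q a d e n m * ?M m ?y *
        (cubic_coeff q ?a ?d ?e l i * (pairfac q ?s ?s ?a i * pairfac Q ?s (?a * Q * Q ^ i) ?a (l - i))))"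
    proof (rule sum.cong)
      fix i assume "i \<in> {..l}"
      have "cubic_coeff q a d e n (m + i) = cubic_coeff q a d e n m * cubic_coeff q ?a ?d ?e l i"
        unfolding n by (rule cubic_coeff_add[OF q0 nz(1-3) regularD0[OF ra']])
      moreover have "?M (m + i) ?y = ?M m ?y * pairfac q ?s ?s ?a i"
      proof -
        have "s * q ^ m / ?y = ?s / ?a" "s * q ^ m * ?y / s = ?a" "?s * ?a / ?s = ?a"
          using nz q0 s0 by (simp_all add: Qp eval_nat_numeral power_add)
        then show ?thesis by (simp only: pairfac_add) (simp only: pairfac_def)
      qed
      moreover have "pairfac Q s (a * Q * Q ^ (m + i)) ?y (n - (m + i)) = pairfac Q ?s (?a * Q * Q ^ i) ?a (l - i)"
      proof -
        have "a * Q * Q ^ (m + i) / ?y = ?a * Q * Q ^ i / ?a"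
          using nz q0 Q0 by (simp add: power_add)
        moreover have "a * Q * Q ^ (m + i) * ?y / s = ?a * Q * Q ^ i * ?a / ?s"
          using nz q0 s0 by (simp add: Qp eval_nat_numeral power_add)
        ultimately show ?thesis by (simp only: pairfac_def) (simp add: n)
      qed
      ultimately show "cubic_coeff q a d e n (m + i) *
          (?M (m + i) ?y * pairfac Q s (a * Q * Q ^ (m + i)) ?y (n - (m + i))) =
        cubic_coeff q a d e n m * ?M m ?y *
        (cubic_coeff q ?a ?d ?e l i * (pairfac q ?s ?s ?a i * pairfac Q ?s (?a * Q * Q ^ i) ?a (l - i)))"
        by (simp only: mult_ac)
    qed simp
    also have "\<dots> = cubic_coeff q a d e n m * ?M m ?y *
        cleared_sum Q ?s (?a * Q) (\<lambda>k y. pairfac q ?s ?s y k) (cubic_coeff q ?a ?d ?e l) l ?a"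
      by (simp only: cleared_sum_def sum_distrib_left)
    also have "cleared_sum Q ?s (?a * Q) (\<lambda>k y. pairfac q ?s ?s y k) (cubic_coeff q ?a ?d ?e l) l ?a =
        D * cubic_factor q ?a ?d l"
    proof -
      have D: "pairfac Q ?s (?a * Q) ?a l = D"
      proof -
        have "?a * Q / ?a = a * Q * Q ^ m / ?y" "?a * Q * ?a / ?s = a * Q * Q ^ m * ?y / s"
          using nz q0 Q0 s0 by (simp_all add: Qp eval_nat_numeral power_add)
        then show ?thesis by (simp only: pairfac_def D_def)
      qed
      have D0: "pairfac Q ?s (?a * Q) ?a l \<noteq> 0"
        using generic_base_tfac[OF qQ, of l] tf[OF r(4), of "?a * Q * ?a / ?s" 0 "6 * m + 2" l] nz q0
        by (simp add: pairfac_def s Q_def eval_nat_numeral power_add)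
      \<comment> \<open>At \<open>b = ?a\<close> the numerator contains \<open>tfac Q 1 j\<close>,
        so only \<open>j = 0\<close> survives and the induction hypothesis yields a closed
        product.\<close>
      have one: "(\<Sum>j\<le>l. base3_coeff q ?a ?d ?e l j * (pairfac Q ?s ?a ?a j / pairfac Q ?s (?a * Q) ?a j)) = 1"
      proof -
        have "regular q (?a * ?d)" using reg' by (simp add: cubic_regular_def)
        then have "\<theta> (?a * ?d / q) \<noteq> 0"
          by (rule regularE[OF _ q0, of _ _ 1 0]) (use q0 in simp)
        then have "base3_coeff q ?a ?d ?e l j * (pairfac Q ?s ?a ?a j / pairfac Q ?s (?a * Q) ?a j) =
            (if j = 0 then 1 else 0)" for j
          using tfac_one[of j Q] nz' q0 by (cases j) (simp_all add: pairfac_def base3_coeff_0)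
        then show ?thesis by simp
      qed
      have "cleared_sum Q ?s (?a * Q) (\<lambda>k y. pairfac q ?s ?s y k) (cubic_coeff q ?a ?d ?e l) l ?a =
          pairfac Q ?s (?a * Q) ?a l * (\<Sum>k\<le>l. cubic_coeff q ?a ?d ?e l k *
            (pairfac q ?s ?s ?a k / pairfac Q ?s (?a * Q) ?a k))"
        by (rule cleared_sum_eq[OF D0])
      also have "(\<Sum>k\<le>l. cubic_coeff q ?a ?d ?e l k * (pairfac q ?s ?s ?a k / pairfac Q ?s (?a * Q) ?a k)) =
          cubic_factor q ?a ?d l"
        using less.IH[of l ?a ?d ?e ?a ?s] m n nz' s' reg' D0 one bal q0
        by (simp add: Q_def eval_nat_numeral power_add mult_ac)
      finally show ?thesis unfolding D .
    qed
    finally have L: "L ?y = cubic_coeff q a d e n m * ?M m ?y * cubic_factor q ?a ?d (n - m) * D"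
      by (simp add: n mult_ac)
    have "R ?y = (\<Sum>j\<le>n. base3_coeff q a d e n j * (?N j ?y * pairfac Q s (a * Q * Q ^ j) ?y (n - j)))"
      by (simp add: R_def cleared_sum_def)
    \<comment> \<open>Terms with \<open>j < m\<close> vanish as on the left, those with
      \<open>j > m\<close> because the numerator contains the factorial of
      \<open>Q^-m\<close>.\<close>
    also have "\<dots> = (\<Sum>j\<in>{m}. base3_coeff q a d e n j * (?N j ?y * pairfac Q s (a * Q * Q ^ j) ?y (n - j)))"
    proof (rule sum.mono_neutral_right)
      have "?N j ?y = 0" if "m < j" for j
        using tfac_negative_power[OF Q0 that] nz by (simp add: pairfac_def)
      then show "\<forall>j\<in>{..n} - {m}. base3_coeff q a d e n j * (?N j ?y * pairfac Q s (a * Q * Q ^ j) ?y (n - j)) = 0"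
        using vanish by (metis DiffD2 insertI1 mult_zero_left mult_zero_right nat_neq_iff)
    qed (use m in auto)
    finally have R: "R ?y = base3_coeff q a d e n m * ?N m ?y * D"
      by (simp add: D_def n mult_ac)
    show ?thesis
      using cubic_coefficients_match[OF q nz(1,2) bal s m(2) reg]
      by (simp add: G_def L R Qp[symmetric] flip: Q_def)
  qed
  ultimately have Gt: "G (t m) = 0" if "m \<le> n" for m
    using that by (simp add: t_def)
  have "G b = 0"
  proof (rule theta_form_eq_0[OF formG s0 _ Gt _ nz(4)])
    show "t i \<noteq> 0" if "i \<le> n" for i using nz Q0 by (simp add: t_def)
    fix i j assume ij: "i < j" "j \<le> n"
    show "\<theta> (t i / t j) \<noteq> 0 \<and> \<theta> (t i * t j / s) \<noteq> 0"
    proof (cases "i = 0")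
      case True
      have "\<theta> (a * Q ^ j) \<noteq> 0"
        by (rule regularE[OF r(1) q0, of _ 0 "3 * j"]) (simp add: Qp)
      moreover have "\<theta> (a * Q ^ j / s) \<noteq> 0"
        by (rule regularE[OF r(2) q0, of _ 1 "3 * j"]) (use nz q0 in \<open>simp add: Qp s\<close>)
      ultimately show ?thesis
        using True ij ellE_inverse_eq_0_iff[of "a * Q ^ j"] nz Q0 by (simp add: t_def)
    next
      case False
      then have t: "t i / t j = Q ^ i / Q ^ j" "t i * t j / s = a * d * Q ^ (i + j) / q"
        using ij nz q0 by (simp_all add: t_def s power_add)
      have "\<theta> (a * d * Q ^ (i + j) / q) \<noteq> 0"
        by (rule regularE[OF r(4) q0, of _ 1 "3 * (i + j)"]) (use q0 in \<open>simp add: Qp\<close>)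
      then show ?thesis
        unfolding t using generic_base_negative_power[OF qQ ij(1)] by simp
    qed
  qed auto
  then have "L b = cubic_factor q a d n * R b" by (simp add: G_def)
  then show ?case
    using den unfolding L_def R_def Q_def by (subst (asm) (1 2) cleared_sum_eq) auto
qed

subsection \<open>Generic parameters\<close>

definition cubic_lhs ::
    "complex \<Rightarrow> complex \<Rightarrow> complex \<Rightarrow> complex \<Rightarrow> complex \<Rightarrow> complex \<Rightarrow> nat \<Rightarrow> complex"
  where
  "cubic_lhs q a b c d e n =
    (\<Sum>k\<le>n. \<theta> (a * q ^ (4 * k)) / \<theta> a * (tfac q b k * tfac q c k) /
       (tfac (q ^ 3) (a * q ^ 3 / b) k * tfac (q ^ 3) (a * q ^ 3 / c) k)
     * tfac q d (2 * k) / tfac q (a * q / d) (2 * k)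
     * (tfac (q ^ 3) e k * tfac (q ^ 3) (inverse (q ^ (3 * n))) k) /
       (tfac q (a * q / e) k * tfac q (a * q ^ (3 * n + 1)) k) * q ^ k)"

definition cubic_prefactor ::
    "complex \<Rightarrow> complex \<Rightarrow> complex \<Rightarrow> complex \<Rightarrow> complex \<Rightarrow> complex \<Rightarrow> complex \<Rightarrow> nat \<Rightarrow> complex"
  where
  "cubic_prefactor q a b c d e f n =
    (tfac (q ^ 3) (a * q ^ 3) n * tfac (q ^ 3) (a ^ 2 * q ^ 3 / (b * c * e)) n *
     tfac (q ^ 3) (a ^ 2 * q ^ 3 / (b * d * e * f)) n * tfac (q ^ 3) (a * f * q ^ 3 / (c * d)) n) /
    (tfac (q ^ 3) (a ^ 2 * q ^ 3 / (b * e * f)) n * tfac (q ^ 3) (a * f * q ^ 3 / c) n *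
     tfac (q ^ 3) (a * q ^ 3 / d) n * tfac (q ^ 3) (a ^ 2 * q ^ 3 / (b * c * d * e)) n)"

definition omega_term ::
    "complex \<Rightarrow> complex \<Rightarrow> complex list \<Rightarrow> nat \<Rightarrow> complex"
  where
  "omega_term Q A xs k = \<theta> (A * Q ^ (2 * k)) / \<theta> A * (tfac Q A k * (\<Prod>x\<leftarrow>xs. tfac Q x k)) * Q ^ k /
     (tfac Q Q k * (\<Prod>x\<leftarrow>xs. tfac Q (A * Q / x) k))"

definition cubic_rhs ::
    "complex \<Rightarrow> complex \<Rightarrow> complex \<Rightarrow> complex \<Rightarrow> complex \<Rightarrow> complex \<Rightarrow> complex \<Rightarrow> nat \<Rightarrow> complex"
  where
  "cubic_rhs q a b c d e f n = cubic_prefactor q a b c d e f n *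
    (\<Sum>k\<le>n. omega_term (q ^ 3) (a * f / c)
      [a / c, f * q ^ 3 / c, b * e * f / a, d, d * q, f, inverse (q ^ (3 * n))] k)"

lemma epoch_eq_tfac: "epoch p q x (int k) = tfac q x k"
  by (simp add: epoch_def tfac_def)

lemma epochs_eq_tfac: "epochs p q xs (int k) = (\<Prod>x\<leftarrow>xs. tfac q x k)"
  by (simp add: epochs_def epoch_eq_tfac)

lemma omega_terminating:
  assumes "q \<noteq> 0"
  shows "omega p (q ^ 3) A (xs @ [inverse (q ^ (3 * n))]) =
    (\<Sum>k\<le>n. omega_term (q ^ 3) A (xs @ [inverse (q ^ (3 * n))]) k)"
proof -
  have "omega p (q ^ 3) A (xs @ [inverse (q ^ (3 * n))]) =
      (\<Sum>k. omega_term (q ^ 3) A (xs @ [inverse (q ^ (3 * n))]) k)"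
    unfolding omega_def epochs_eq_tfac omega_term_def by (simp only: list.map prod_list.Cons map_map o_def)
  also have "\<dots> = (\<Sum>k\<le>n. omega_term (q ^ 3) A (xs @ [inverse (q ^ (3 * n))]) k)"
  proof (rule suminf_finite)
    fix k assume "k \<notin> {..n}"
    then have "tfac (q ^ 3) (inverse (q ^ (3 * n))) k = 0"
      using tfac_negative_power[of "q ^ 3" n k] assms by (simp add: power_mult inverse_eq_divide)
    then show "omega_term (q ^ 3) A (xs @ [inverse (q ^ (3 * n))]) k = 0"
      by (simp add: omega_term_def)
  qed simp
  finally show ?thesis .
qed

text \<open>Multiplicative independence of \<open>a\<close>, \<open>b\<close>, \<open>c\<close>,
  \<open>q\<close>, modulo powers of \<open>p\<close> when \<open>p\<close> is nonzero. The other
  parameters are monomials in these four, so one condition provides every regularity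
  hypothesis.\<close>

definition generic_parameters :: "complex \<Rightarrow> complex \<Rightarrow> complex \<Rightarrow> complex \<Rightarrow> bool" where
  "generic_parameters q a b c \<longleftrightarrow> (\<forall>i j k m :: int. (i, j, k, m) \<noteq> (0, 0, 0, 0) \<longrightarrow>
     \<theta> (a powi i * b powi j * c powi k * q powi m) \<noteq> 0)"

text \<open>Numerator and denominator exponents are given separately, so a Laurent monomial is
  identified by an equation between natural powers.\<close>

lemma generic_parameters_regular:
  assumes gen: "generic_parameters q a b c" and nz: "q \<noteq> 0" "a \<noteq> 0" "b \<noteq> 0" "c \<noteq> 0"
    and x: "x * (a ^ i' * b ^ j' * c ^ k' * q ^ m') = a ^ i * b ^ j * c ^ k * q ^ m"
    and ne: "(i, j, k) \<noteq> (i', j', k')"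
  shows "regular q x"
  unfolding regular_def
proof
  fix l :: int
  have "x * q powi l = a powi (int i - int i') * b powi (int j - int j') *
      c powi (int k - int k') * q powi (int m - int m' + l)"
    using x nz by (simp add: power_int_add power_int_diff field_simps)
  then show "\<theta> (x * q powi l) \<noteq> 0"
    using gen ne by (auto simp: generic_parameters_def)
qed

lemma generic_parameters_base:
  assumes "generic_parameters q a b c" "q \<noteq> 0"
  shows "generic_base q"
  unfolding generic_base_def
proof (intro conjI allI impI)
  fix k :: nat assume "k > 0"
  then have "\<theta> (a powi 0 * b powi 0 * c powi 0 * q powi int k) \<noteq> 0"
    using assms(1) unfolding generic_parameters_def by (metis of_nat_0_less_iff order_less_irrefl prod.inject)
  then show "\<theta> (q ^ k) \<noteq> 0" by simp
qed (fact assms(2))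

section \<open>The two cases of the theorem for generic parameters\<close>

context
  fixes q a b c d e s :: complex and n :: nat
  assumes gen: "generic_parameters q a b c" and nz: "q \<noteq> 0" "a \<noteq> 0" "b \<noteq> 0" "c \<noteq> 0"
    and d: "d = a * q / (b * c)" and e: "e = a * b * c * q ^ (3 * n)"
    and s_def: "s = a * q / d"
begin

lemma de_nonzero: "d \<noteq> 0" "e \<noteq> 0" using nz by (simp_all add: d e)

lemma base_generic: "generic_base q" using generic_parameters_base[OF gen nz(1)] .

lemmas monomial_regular = generic_parameters_regular[OF gen nz]

lemma parameters_cubic_regular: "cubic_regular q a d"
  unfolding cubic_regular_def
proof (intro conjI)
  show "regular q a" by (rule monomial_regular[of _ 0 0 0 0 1 0 0 0]) (use nz in simp_all)
  show "regular q d" by (rule monomial_regular[of _ 0 1 1 0 1 0 0 1]) (use nz in \<open>simp_all add: d\<close>)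
  show "regular q (a / d)" by (rule monomial_regular[of _ 0 0 0 1 0 1 1 0]) (use nz in \<open>simp_all add: d\<close>)
  show "regular q (a * d)" by (rule monomial_regular[of _ 0 1 1 0 2 0 0 1]) (use nz in \<open>simp_all add: d power2_eq_square\<close>)
  show "regular q (a\<^sup>2 / d)" by (rule monomial_regular[of _ 0 0 0 1 1 1 1 0]) (use nz in \<open>simp_all add: d power2_eq_square\<close>)
  show "regular q (a / d\<^sup>2)" by (rule monomial_regular[of _ 1 0 0 2 0 2 2 0]) (use nz in \<open>simp_all add: d power2_eq_square\<close>)
  show "regular q (d\<^sup>2)" by (rule monomial_regular[of _ 0 2 2 0 2 0 0 2]) (use nz in \<open>simp_all add: d power2_eq_square\<close>)
qed

lemma tfac_cube_nonzero: "regular q y \<Longrightarrow> x * q ^ i = y * q ^ j \<Longrightarrow> tfac (q ^ 3) x k \<noteq> 0"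
  using regular_tfac[OF regular_power[OF regular_shift[OF _ nz(1)], of y x i j 3], of x 0 0] nz by simp

lemma s_eq: "s = b * c" using nz by (simp add: s_def d)

lemma pairfac_den_nonzero: "pairfac (q ^ 3) s (a * q ^ 3) b n \<noteq> 0"
proof -
  have "regular q (a / b)" "regular q (a / c)"
    by (rule monomial_regular[of _ 0 1 0 0 1 0 0 0] monomial_regular[of _ 0 0 1 0 1 0 0 0]; use nz in simp)+
  from tfac_cube_nonzero[OF this(1), of "a * q ^ 3 / b" 0 3] tfac_cube_nonzero[OF this(2), of "a * q ^ 3 / c" 0 3]
  show ?thesis unfolding s_eq using nz by (simp add: pairfac_def)
qed

lemma de_balance: "d * e = a\<^sup>2 * q ^ (3 * n + 1)"
  using nz by (simp add: d e power2_eq_square)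

lemma cubic_lhs_eq: "cubic_lhs q a b c d e n = cubic_factor q a d n *
   (\<Sum>j\<le>n. base3_coeff q a d e n j * (pairfac (q ^ 3) s a b j / pairfac (q ^ 3) s (a * q ^ 3) b j))"
proof -
  have "cubic_lhs q a b c d e n =
      (\<Sum>k\<le>n. cubic_coeff q a d e n k * (pairfac q s s b k / pairfac (q ^ 3) s (a * q ^ 3) b k))"
    unfolding cubic_lhs_def
  proof (rule sum.cong)
    fix k
    have "s / b = c" "s * b / s = b" "a * q ^ 3 * b / s = a * q ^ 3 / c"
      using nz de_nonzero unfolding s_eq by simp_all
    then show "\<theta> (a * q ^ (4 * k)) / \<theta> a * (tfac q b k * tfac q c k) /
       (tfac (q ^ 3) (a * q ^ 3 / b) k * tfac (q ^ 3) (a * q ^ 3 / c) k)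
     * tfac q d (2 * k) / tfac q (a * q / d) (2 * k)
     * (tfac (q ^ 3) e k * tfac (q ^ 3) (inverse (q ^ (3 * n))) k) /
       (tfac q (a * q / e) k * tfac q (a * q ^ (3 * n + 1)) k) * q ^ k =
      cubic_coeff q a d e n k * (pairfac q s s b k / pairfac (q ^ 3) s (a * q ^ 3) b k)"
      unfolding cubic_coeff_def pairfac_def by (simp only: inverse_eq_divide) (simp add: mult_ac)
  qed simp
  then show ?thesis
    using cubic_expansion[OF base_generic nz(2) de_nonzero nz(3) de_balance s_def parameters_cubic_regular pairfac_den_nonzero] by simp
qed

text \<open>The first four rewrite prefactors of the theorem, the last two the prefactor of Bailey's
  transformation.\<close>

lemma reflections:
  "tfac (q ^ 3) (a * d * q ^ 2 / e) n =
    reflect_factor (q ^ 3) (a * q ^ 2 / d ^ 2) n * tfac (q ^ 3) (a * q ^ 2 / d ^ 2) n"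
  "tfac (q ^ 3) (a * q ^ 3 / (d * e)) n = reflect_factor (q ^ 3) (a * q) n * tfac (q ^ 3) (a * q) n"
  "tfac (q ^ 3) (a * q ^ 3 / e) n = reflect_factor (q ^ 3) (a * q / d) n * tfac (q ^ 3) (a * q / d) n"
  "tfac (q ^ 3) (a * q ^ 2 / e) n = reflect_factor (q ^ 3) (a * q ^ 2 / d) n * tfac (q ^ 3) (a * q ^ 2 / d) n"
  "tfac (q ^ 3) (q / (c * q ^ (3 * n))) n = reflect_factor (q ^ 3) (c * q ^ 2) n * tfac (q ^ 3) (c * q ^ 2) n"
  "tfac (q ^ 3) (b / (a * q ^ (3 * n))) n = reflect_factor (q ^ 3) (a * q ^ 3 / b) n * tfac (q ^ 3) (a * q ^ 3 / b) n"
proof -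
  have *: "(q ^ 3) ^ (m - 1) * (q * q * q) = q ^ (3 * m)" if "m > 0" for m
    using that by (cases m) (simp_all add: power_mult eval_nat_numeral power_mult_distrib power_add)
  \<comment> \<open>The reflection condition multiplied by \<open>q^3\<close>, which eliminates the
    exponent \<open>n - 1\<close>.\<close>
  have pw: "x * y * (q ^ 3) ^ (n - 1) = 1" if "x * y * q ^ (3 * n) = q * q * q" "n > 0" for x y
  proof -
    have "x * y * (q ^ 3) ^ (n - 1) * (q * q * q) = 1 * (q * q * q)"
      using that(1) *[OF that(2)] by (simp add: mult.assoc)
    then show ?thesis
      using nz by (metis mult_cancel_right mult_eq_0_iff)
  qed
  show "tfac (q ^ 3) (a * d * q ^ 2 / e) n =
    reflect_factor (q ^ 3) (a * q ^ 2 / d ^ 2) n * tfac (q ^ 3) (a * q ^ 2 / d ^ 2) n"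
    by (rule tfac_reflect[OF _ _ pw]) (use nz in \<open>simp_all add: d e eval_nat_numeral\<close>)
  show "tfac (q ^ 3) (a * q ^ 3 / (d * e)) n = reflect_factor (q ^ 3) (a * q) n * tfac (q ^ 3) (a * q) n"
    by (rule tfac_reflect[OF _ _ pw]) (use nz in \<open>simp_all add: d e eval_nat_numeral\<close>)
  show "tfac (q ^ 3) (a * q ^ 3 / e) n = reflect_factor (q ^ 3) (a * q / d) n * tfac (q ^ 3) (a * q / d) n"
    by (rule tfac_reflect[OF _ _ pw]) (use nz in \<open>simp_all add: d e eval_nat_numeral\<close>)
  show "tfac (q ^ 3) (a * q ^ 2 / e) n = reflect_factor (q ^ 3) (a * q ^ 2 / d) n * tfac (q ^ 3) (a * q ^ 2 / d) n"
    by (rule tfac_reflect[OF _ _ pw]) (use nz in \<open>simp_all add: d e eval_nat_numeral\<close>)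
  show "tfac (q ^ 3) (q / (c * q ^ (3 * n))) n = reflect_factor (q ^ 3) (c * q ^ 2) n * tfac (q ^ 3) (c * q ^ 2) n"
    by (rule tfac_reflect[OF _ _ pw]) (use nz in \<open>simp_all add: eval_nat_numeral\<close>)
  show "tfac (q ^ 3) (b / (a * q ^ (3 * n))) n = reflect_factor (q ^ 3) (a * q ^ 3 / b) n * tfac (q ^ 3) (a * q ^ 3 / b) n"
    by (rule tfac_reflect[OF _ _ pw]) (use nz in \<open>simp_all add: eval_nat_numeral\<close>)
qed

lemma cubic_factor_eq:
  "cubic_factor q a d n = (tfac (q ^ 3) (a * q) n * tfac (q ^ 3) (a * q ^ 2) n * tfac (q ^ 3) (a * q ^ 3) n *
      tfac (q ^ 3) (a * q ^ 2 / d ^ 2) n) /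
     (tfac (q ^ 3) (a * q / d) n * tfac (q ^ 3) (a * q ^ 2 / d) n * tfac (q ^ 3) (a * q ^ 3 / d) n *
      tfac (q ^ 3) (a * d * q ^ 2) n)"
proof -
  have "a * q * q = a * q ^ 2" "a * q * q ^ 2 = a * q ^ 3" "a * q / d * q = a * q ^ 2 / d"
    "a * q / d * q ^ 2 = a * q ^ 3 / d"
    by (simp_all add: eval_nat_numeral)
  then show ?thesis by (simp only: cubic_factor_def tfac_triple)
qed

text \<open>Substituting \<open>b c d = a q\<close> turns the theorem's parameters into those of
  \<open>base3_coeff\<close>. The four reflection scalars cancel since
  \<open>(a q^2 / d^2) (a q) = (a q / d) (a q^2 / d)\<close>.\<close>

lemma generic_case_b: "cubic_lhs q a b c d e n = cubic_rhs q a b c d e (a / b) n"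
proof -
  let ?T = "\<lambda>x. tfac (q ^ 3) x n" and ?r = "\<lambda>x. reflect_factor (q ^ 3) x n"
  have args: "a\<^sup>2 * q ^ 3 / (b * c * e) = a * d * q ^ 2 / e" "a\<^sup>2 * q ^ 3 / (b * d * e * (a / b)) = a * q ^ 3 / (d * e)"
    "a * (a / b) * q ^ 3 / (c * d) = a * q ^ 2" "a\<^sup>2 * q ^ 3 / (b * e * (a / b)) = a * q ^ 3 / e"
    "a * (a / b) * q ^ 3 / c = a * d * q ^ 2" "a\<^sup>2 * q ^ 3 / (b * c * d * e) = a * q ^ 2 / e"
    using nz de_nonzero(2) by (simp_all add: d eval_nat_numeral)
  have r: "?r (a * q ^ 2 / d ^ 2) * ?r (a * q) = ?r (a * q / d) * ?r (a * q ^ 2 / d)"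
    by (rule reflect_factor_mult) (use nz de_nonzero in \<open>simp add: power2_eq_square\<close>)
  have "?r (a * q / d) \<noteq> 0" "?r (a * q ^ 2 / d) \<noteq> 0"
    using nz de_nonzero by (intro reflect_factor_nonzero; simp)+
  then have "(?r (a * q ^ 2 / d ^ 2) * ?r (a * q)) / (?r (a * q / d) * ?r (a * q ^ 2 / d)) = 1"
    unfolding r by simp
  moreover have "cubic_prefactor q a b c d e (a / b) n = cubic_factor q a d n *
      ((?r (a * q ^ 2 / d ^ 2) * ?r (a * q)) / (?r (a * q / d) * ?r (a * q ^ 2 / d)))"
    unfolding cubic_prefactor_def args reflections cubic_factor_eq by (simp add: mult_ac)
  ultimately have pre: "cubic_prefactor q a b c d e (a / b) n = cubic_factor q a d n" by simp
  have "base3_coeff q a d e n k * (pairfac (q ^ 3) s a b k / pairfac (q ^ 3) s (a * q ^ 3) b k) =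
      omega_term (q ^ 3) (a * (a / b) / c)
      [a / c, a / b * q ^ 3 / c, b * e * (a / b) / a, d, d * q, a / b, inverse (q ^ (3 * n))] k" for k
  proof -
    have args: "a * (a / b) / c = a * d / q" "a / b * q ^ 3 / c = d * q ^ 2" "b * e * (a / b) / a = e"
      "a * d / q * q ^ 3 / (a / c) = a * q ^ 3 / b" "a * d / q * q ^ 3 / (a / b) = a * q ^ 3 / c"
      "a * d / q * q ^ 3 / (1 / q ^ (3 * n)) = a * d * q ^ (3 * n + 2)"
      "a * b / s = a / c" "a * q ^ 3 * b / s = a * q ^ 3 / c"
      using nz unfolding s_eq by (simp_all add: d eval_nat_numeral mult_ac)
    show ?thesis
      unfolding base3_coeff_def omega_term_def wp_weight_def pairfac_def args
      by (simp only: list.map prod_list.Cons prod_list.Nil args inverse_eq_divide) (simp add: mult_ac)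
  qed
  then show ?thesis
    unfolding cubic_lhs_eq cubic_rhs_def pre by simp
qed

text \<open>Bailey's transformation in base \<open>q^3\<close> acts on the series with leading
  parameter \<open>a d / q\<close>, keeping \<open>a / c\<close> and the pair \<open>d, d q\<close>.
  The triple \<open>a / b, e, d q^2\<close> goes to \<open>a / e, b, a q^3 / (c e)\<close>, which is
  \<open>f, b e f / a, f q^3 / c\<close> for \<open>f = a / e\<close>; the new leading parameter
  \<open>l\<close> is \<open>a f / c\<close>.\<close>

lemma generic_case_e: "cubic_lhs q a b c d e n = cubic_rhs q a b c d e (a / e) n"
proof -
  let ?T = "\<lambda>x. tfac (q ^ 3) x n" and ?r = "\<lambda>x. reflect_factor (q ^ 3) x n"
  define Q where "Q = q ^ 3"
  define \<alpha> where "\<alpha> = a * d / q"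
  define l where "l = a\<^sup>2 / (c * e)"
  define S where "S = d * (d * q)"
  have l': "l = a / (b * c\<^sup>2 * q ^ (3 * n))"
    using nz by (simp add: l_def e power2_eq_square)
  have \<alpha>': "\<alpha> = a\<^sup>2 / (b * c)"
    using nz by (simp add: \<alpha>_def d power2_eq_square)
  have S': "S = a\<^sup>2 * q ^ 3 / (b\<^sup>2 * c\<^sup>2)"
    using nz by (simp add: S_def d eval_nat_numeral mult_ac)
  have nz': "\<alpha> \<noteq> 0" "l \<noteq> 0" "S \<noteq> 0" "Q \<noteq> 0"
    using nz de_nonzero by (simp_all add: \<alpha>_def l_def S_def Q_def)
  have Qn: "Q ^ (n + 1) = q ^ (3 * n) * q ^ 3" "1 / Q ^ n = 1 / q ^ (3 * n)"
    by (simp_all add: Q_def power_mult)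
  have lpars: "l * (a / b) / \<alpha> = a / e" "l * e / \<alpha> = b" "l * (d * q ^ 2) / \<alpha> = a * q ^ 3 / (c * e)"
    using nz by (simp_all add: l' \<alpha>' d e eval_nat_numeral)
  have sum1: "base3_coeff q a d e n k * (pairfac Q s a b k / pairfac Q s (a * Q) b k) =
      wp_weight Q \<alpha> [a / b, e, d * q ^ 2, a / c] k * wp_pair Q \<alpha> S d n k" for k
  proof -
    have args: "\<alpha> * Q / (a / c) = a * Q / b" "\<alpha> * Q / (a / b) = a * Q / c"
      "\<alpha> * Q ^ (n + 1) = a * d * q ^ (3 * n + 2)"
      "a * b / s = a / c" "a * Q * b / s = a * Q / c" "S / d = d * q" "S * d / S = d"
      "\<alpha> * Q * d / S = \<alpha> * Q / (d * q)"
      using nz de_nonzero nz' unfolding s_eq Qn by (simp_all add: \<alpha>_def Q_def S_def eval_nat_numeral)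
        (simp_all add: d)
    show ?thesis
      unfolding base3_coeff_def wp_weight_def wp_pair_def pairfac_def Q_def[symmetric] \<alpha>_def[symmetric] args
      by (simp only: list.map prod_list.Cons prod_list.Nil args Qn(2)) (simp add: mult_ac)
  qed
  have sum2: "omega_term Q (a * (a / e) / c)
      [a / c, a / e * q ^ 3 / c, b * e * (a / e) / a, d, d * q, a / e, inverse (q ^ (3 * n))] k =
      wp_weight Q l [a / e, b, a * q ^ 3 / (c * e), a / c] k * wp_pair Q l S d n k" for k
  proof -
    have args: "a * (a / e) / c = l" "a / e * q ^ 3 / c = a * q ^ 3 / (c * e)" "b * e * (a / e) / a = b"
      "l * Q / (1 / q ^ (3 * n)) = l * Q ^ (n + 1)" "S / d = d * q" "S * d / S = d"
      "l * Q * d / S = l * Q / (d * q)"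
      using nz de_nonzero nz' unfolding Qn by (simp_all add: l_def Q_def S_def power2_eq_square mult_ac)
    show ?thesis
      unfolding omega_term_def wp_weight_def wp_pair_def pairfac_def args
      by (simp only: list.map prod_list.Cons prod_list.Nil args Qn(2) inverse_eq_divide) (simp add: mult_ac)
  qed
  have R: "regular Q x" if "x * (a ^ i' * b ^ j' * c ^ k' * q ^ m') = a ^ i * b ^ j * c ^ k * q ^ m"
    "(i, j, k) \<noteq> (i', j', k')" for x i' j' k' m' i j k m
    unfolding Q_def by (rule regular_power[OF monomial_regular[OF that]])
  note defs = \<alpha>' l' S' d e Q_def eval_nat_numeral power_add power_mult_distrib
  have "(\<Sum>k\<le>n. wp_weight Q \<alpha> [a / b, e, d * q ^ 2, a / c] k * wp_pair Q \<alpha> S d n k) =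
    wp_prefactor Q (\<alpha> * Q) (l * Q) S d n *
    (\<Sum>k\<le>n. wp_weight Q l [l * (a / b) / \<alpha>, l * e / \<alpha>, l * (d * q ^ 2) / \<alpha>, a / c] k * wp_pair Q l S d n k)"
  proof (rule bailey_transformation)
    show "generic_base Q" unfolding Q_def by (rule generic_base_power[OF base_generic]) simp
    show "l = \<alpha>\<^sup>2 * Q / (a / b * e * (d * q ^ 2))" using nz by (simp add: defs)
    show "S * (a / c) = l * \<alpha> * Q ^ (n + 1)" unfolding Qn using nz by (simp add: defs mult_ac)
    show "regular Q \<alpha>" by (rule R[of _ 0 1 1 0 2 0 0 0]) (use nz in \<open>simp_all add: defs\<close>)
    show "regular Q l" by (rule R[of _ 0 1 2 "3 * n" 1 0 0 0]) (use nz in \<open>simp_all add: defs\<close>)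
    show "regular Q (a / c)" by (rule R[of _ 0 0 1 0 1 0 0 0]) (use nz in \<open>simp_all add: defs\<close>)
    show "regular Q (\<alpha> / (a / c))" by (rule R[of _ 0 1 0 0 1 0 0 0]) (use nz in \<open>simp_all add: defs\<close>)
    show "regular Q (l / (a / c))" by (rule R[of _ 0 1 1 "3 * n" 0 0 0 0]) (use nz in \<open>simp_all add: defs\<close>)
    show "regular Q (e * (d * q ^ 2))" by (rule R[of _ 0 0 0 0 2 0 0 "3 * n + 3"]) (use nz in \<open>simp_all add: defs\<close>)
    show "regular Q (\<alpha> / (e * (d * q ^ 2)))" by (rule R[of _ 0 1 1 "3 * n + 3" 0 0 0 0]) (use nz in \<open>simp_all add: defs\<close>)
    show "regular Q (a / b)" by (rule R[of _ 0 1 0 0 1 0 0 0]) (use nz in \<open>simp_all add: defs\<close>)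
    show "regular Q (l / (a / b))" by (rule R[of _ 0 0 2 "3 * n" 0 0 0 0]) (use nz in \<open>simp_all add: defs\<close>)
    show "regular Q (\<alpha> / (a / b))" by (rule R[of _ 0 0 1 0 1 0 0 0]) (use nz in \<open>simp_all add: defs\<close>)
    show "regular Q (\<alpha> / e)" by (rule R[of _ 0 2 2 "3 * n" 1 0 0 0]) (use nz in \<open>simp_all add: defs\<close>)
    show "regular Q (\<alpha> / (d * q ^ 2))" by (rule R[of _ 0 0 0 3 1 0 0 0]) (use nz in \<open>simp_all add: defs\<close>)
    show "regular Q S" by (rule R[of _ 0 2 2 0 2 0 0 3]) (use nz in \<open>simp_all add: defs\<close>)
    show "regular Q (\<alpha> / S)" by (rule R[of _ 0 0 0 3 0 1 1 0]) (use nz in \<open>simp_all add: defs\<close>)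
    show "regular Q (l / S)" by (rule R[of _ 1 0 0 "3 * n + 3" 0 1 0 0]) (use nz in \<open>simp_all add: defs\<close>)
    show "regular Q (S * (a / b) / \<alpha>)" by (rule R[of _ 0 2 1 0 1 0 0 3]) (use nz in \<open>simp_all add: defs\<close>)
    show "regular Q (\<alpha>\<^sup>2 / (S * (a / b)))" by (rule R[of _ 0 0 0 3 1 1 0 0]) (use nz in \<open>simp_all add: defs\<close>)
    show "regular Q (l * \<alpha> / (S * (a / b)))" by (rule R[of _ 0 0 1 "3 * n + 3" 0 1 0 0]) (use nz in \<open>simp_all add: defs\<close>)
    have ra: "regular q a" by (rule monomial_regular[of _ 0 0 0 0 1 0 0 0]) (use nz in simp_all)
    have rc: "regular q (1 / c)" by (rule monomial_regular[of _ 0 0 1 0 0 0 0 0]) (use nz in simp_all)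
    have "\<alpha> * Q / d = a * q ^ 2" "\<alpha> * Q * d / S = a * q"
      using nz de_nonzero by (simp_all add: \<alpha>_def S_def Q_def eval_nat_numeral)
    then show "pairfac Q S (\<alpha> * Q) d n \<noteq> 0"
      using tfac_cube_nonzero[OF ra, of "a * q ^ 2" 0 2 n] tfac_cube_nonzero[OF ra, of "a * q" 0 1 n]
      by (simp add: pairfac_def Q_def)
    show "pairfac Q S (l * Q) d n \<noteq> 0"
      unfolding pairfac_def Q_def
      using tfac_cube_nonzero[OF rc, of "l * q ^ 3 / d" "3 * n" 2 n] tfac_cube_nonzero[OF rc, of "l * q ^ 3 * d / S" "3 * n" 1 n] nz
      by (simp add: defs)
  qed (use nz de_nonzero nz' in simp_all)
  then have B: "(\<Sum>k\<le>n. base3_coeff q a d e n k * (pairfac Q s a b k / pairfac Q s (a * Q) b k)) =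
     wp_prefactor Q (\<alpha> * Q) (l * Q) S d n * (\<Sum>k\<le>n. omega_term Q (a * (a / e) / c)
      [a / c, a / e * q ^ 3 / c, b * e * (a / e) / a, d, d * q, a / e, inverse (q ^ (3 * n))] k)"
    unfolding sum1 sum2 lpars .
  have wp: "wp_prefactor Q (\<alpha> * Q) (l * Q) S d n =
     ?T (a * d * q ^ 2) * ?T (a * q / d) * (?T (l * q ^ 3 / d) * (?r (c * q ^ 2) * ?T (c * q ^ 2))) /
     (?T (l * q ^ 3) * (?r (a * q ^ 3 / b) * ?T (a * q ^ 3 / b)) * (?T (a * q ^ 2) * ?T (a * q)))"
  proof -
    have args: "\<alpha> * q ^ 3 = a * d * q ^ 2" "a * d * q ^ 2 / S = a * q / d"
      "l * q ^ 3 * d / S = q / (c * q ^ (3 * n))"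
      "l * q ^ 3 / S = b / (a * q ^ (3 * n))" "a * d * q ^ 2 / d = a * q ^ 2" "a * d * q ^ 2 * d / S = a * q"
      using nz by (simp_all add: defs)
    show ?thesis
      unfolding wp_prefactor_def pairfac_def Q_def args reflections(5,6)[symmetric] ..
  qed
  have pre2: "cubic_prefactor q a b c d e (a / e) n =
     (?T (a * q ^ 3) * (?r (a * q ^ 2 / d ^ 2) * ?T (a * q ^ 2 / d ^ 2)) * ?T (c * q ^ 2) * ?T (l * q ^ 3 / d)) /
     (?T (a * q ^ 3 / b) * ?T (l * q ^ 3) * ?T (a * q ^ 3 / d) * (?r (a * q ^ 2 / d) * ?T (a * q ^ 2 / d)))"
  proof -
    have args: "a\<^sup>2 * q ^ 3 / (b * c * e) = a * d * q ^ 2 / e" "a\<^sup>2 * q ^ 3 / (b * d * e * (a / e)) = c * q ^ 2"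
      "a * (a / e) * q ^ 3 / (c * d) = l * q ^ 3 / d" "a\<^sup>2 * q ^ 3 / (b * e * (a / e)) = a * q ^ 3 / b"
      "a * (a / e) * q ^ 3 / c = l * q ^ 3" "a\<^sup>2 * q ^ 3 / (b * c * d * e) = a * q ^ 2 / e"
      using nz by (simp_all add: defs)
    show ?thesis
      unfolding cubic_prefactor_def args reflections(1,4) ..
  qed
  have "?T (a * q) \<noteq> 0" "?T (a * q ^ 2) \<noteq> 0" "?T (a * q / d) \<noteq> 0" "?T (a * d * q ^ 2) \<noteq> 0"
    using parameters_cubic_regular tfac_cube_nonzero[of a "a * q" 0 1] tfac_cube_nonzero[of a "a * q ^ 2" 0 2]
      tfac_cube_nonzero[of "a / d" "a * q / d" 0 1] tfac_cube_nonzero[of "a * d" "a * d * q ^ 2" 0 2]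
    by (simp_all add: cubic_regular_def)
  then have "cubic_factor q a d n * wp_prefactor Q (\<alpha> * Q) (l * Q) S d n =
     ?T (a * q ^ 3) * ?T (a * q ^ 2 / d ^ 2) * ?T (l * q ^ 3 / d) * ?T (c * q ^ 2) /
     (?T (a * q ^ 2 / d) * ?T (a * q ^ 3 / d) * ?T (l * q ^ 3) * ?T (a * q ^ 3 / b)) *
     (?r (c * q ^ 2) / ?r (a * q ^ 3 / b))"
    unfolding wp cubic_factor_eq by (simp add: mult_ac)
  \<comment> \<open>The scalars left by Bailey's prefactor match those of the theorem's prefactor
    because \<open>b c d = a q\<close>.\<close>
  also have "?r (c * q ^ 2) / ?r (a * q ^ 3 / b) = ?r (a * q ^ 2 / d ^ 2) / ?r (a * q ^ 2 / d)"
  proof -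
    have "?r (c * q ^ 2) * ?r (a * q ^ 2 / d) = ?r (a * q ^ 2 / d ^ 2) * ?r (a * q ^ 3 / b)"
      by (rule reflect_factor_mult) (use nz in \<open>simp add: d eval_nat_numeral\<close>)
    moreover have "?r (a * q ^ 3 / b) \<noteq> 0" "?r (a * q ^ 2 / d) \<noteq> 0"
      using nz de_nonzero by (intro reflect_factor_nonzero; simp)+
    ultimately show ?thesis by (simp add: frac_eq_eq)
  qed
  finally have pre: "cubic_factor q a d n * wp_prefactor Q (\<alpha> * Q) (l * Q) S d n = cubic_prefactor q a b c d e (a / e) n"
    unfolding pre2 by (simp add: mult_ac)
  show ?thesis
    unfolding cubic_lhs_eq cubic_rhs_def Q_def[symmetric] B pre[symmetric] by (simp only: mult.assoc)
qed

end

end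

subsection \<open>Removing genericity\<close>

text \<open>The solutions are the roots of \<open>P - w\<close> with \<open>w\<close> running
  through the countably many logarithms of \<open>y\<close>.\<close>

lemma countable_exp_poly_eq:
  fixes P :: "complex poly"
  assumes "degree P \<noteq> 0"
  shows "countable {t. exp (poly P t) = y}"
proof (rule countable_subset)
  let ?E = "{w. exp w = y}"
  have "countable ?E"
  proof (cases "?E = {}")
    case False
    then obtain w0 where w0: "exp w0 = y" by blast
    have "?E \<subseteq> range (\<lambda>n::int. w0 + of_int (2 * n) * of_real pi * \<i>)"
      using w0 exp_eq by (force simp: mult_ac)
    then show ?thesis by (rule countable_subset) simp
  qed simp
  moreover have "finite {t. poly P t = w}" for w
  proof -
    have "P - [:w:] \<noteq> 0"
      using assms by (metis degree_pCons_0 eq_iff_diff_eq_0)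
    then show ?thesis using poly_roots_finite[of "P - [:w:]"] by simp
  qed
  ultimately show "countable (\<Union>w\<in>?E. {t. poly P t = w})"
    by (intro countable_UN) (auto intro: countable_finite)
qed auto

context elliptic_nome
begin

text \<open>Since \<open>t, t\<^sup>2, t\<^sup>3, t\<^sup>4\<close> are linearly independent, only countably many points of
  this curve satisfy a multiplicative relation modulo powers of \<open>p\<close>.\<close>

lemma countable_non_generic:
  assumes nz: "q \<noteq> 0" "a \<noteq> 0" "b \<noteq> 0" "c \<noteq> 0"
  shows "countable {t. \<not> generic_parameters (q * exp t) (a * exp (t ^ 2)) (b * exp (t ^ 3)) (c * exp (t ^ 4))}"
proof (rule countable_subset)
  define I where "I = {x :: int \<times> int \<times> int \<times> int. x \<noteq> (0, 0, 0, 0)}"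
  define M where "M = (\<lambda>(i, j, k, m). a powi i * b powi j * c powi k * q powi m)"
  \<comment> \<open>Along the curve a monomial in the four parameters is multiplied by the
    exponential of this polynomial, which is nonconstant unless all four exponents are 0.\<close>
  define P where "P = (\<lambda>(i, j, k, m). [:0, of_int m, of_int i, of_int j, of_int k :: complex:])"
  define Z where "Z = {z. z \<noteq> 0 \<and> \<theta> z = 0}"
  show "{t. \<not> generic_parameters (q * exp t) (a * exp (t ^ 2)) (b * exp (t ^ 3)) (c * exp (t ^ 4))} \<subseteq>
      (\<Union>x\<in>I. \<Union>z\<in>Z. {t. exp (poly (P x) t) = z / M x})"
  proof
    fix t assume "t \<in> {t. \<not> generic_parameters (q * exp t) (a * exp (t ^ 2)) (b * exp (t ^ 3)) (c * exp (t ^ 4))}"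
    then obtain i j k m :: int where ne: "(i, j, k, m) \<noteq> (0, 0, 0, 0)" and
      zero: "\<theta> ((a * exp (t ^ 2)) powi i * (b * exp (t ^ 3)) powi j * (c * exp (t ^ 4)) powi k * (q * exp t) powi m) = 0"
      by (auto simp: generic_parameters_def)
    let ?x = "(i, j, k, m)"
    let ?z = "(a * exp (t ^ 2)) powi i * (b * exp (t ^ 3)) powi j * (c * exp (t ^ 4)) powi k * (q * exp t) powi m"
    have M0: "M ?x \<noteq> 0" using nz by (simp add: M_def)
    have "poly (P ?x) t = of_int i * t ^ 2 + of_int j * t ^ 3 + of_int k * t ^ 4 + of_int m * t"
      by (simp add: P_def algebra_simps eval_nat_numeral)
    then have "?z = M ?x * exp (poly (P ?x) t)"
      by (simp add: M_def power_int_mult_distrib exp_power_int exp_add mult_ac)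
    moreover have "?z \<noteq> 0" using nz by simp
    ultimately have "?z \<in> Z" "exp (poly (P ?x) t) = ?z / M ?x"
      using zero M0 by (simp_all add: Z_def)
    moreover have "?x \<in> I" using ne by (simp add: I_def)
    ultimately show "t \<in> (\<Union>x\<in>I. \<Union>z\<in>Z. {t. exp (poly (P x) t) = z / M x})"
      by blast
  qed
  show "countable (\<Union>x\<in>I. \<Union>z\<in>Z. {t. exp (poly (P x) t) = z / M x})"
  proof (intro countable_UN countable_exp_poly_eq)
    show "countable Z" unfolding Z_def by (rule countable_ellE_zeros)
    show "degree (P x) \<noteq> 0" if "x \<in> I" for x
      using that by (auto simp: I_def P_def split: prod.splits)
  qed auto
qed

section \<open>Continuity of both sides in the parameters\<close>

lemma tendsto_tfac [tendsto_intros]: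
  assumes "(q \<longlongrightarrow> q0) F" "(x \<longlongrightarrow> x0) F" "q0 \<noteq> 0" "x0 \<noteq> 0"
  shows "((\<lambda>t. tfac (q t) (x t) k) \<longlongrightarrow> tfac q0 x0 k) F"
  unfolding tfac_def by (intro tendsto_intros assms) (use assms in auto)

text \<open>Denominators are required to be nonzero only at the limit point, where the theorem
  grants it.\<close>

lemma tendsto_cubic_lhs:
  assumes t: "(q \<longlongrightarrow> q0) F" "(a \<longlongrightarrow> a0) F" "(b \<longlongrightarrow> b0) F" "(c \<longlongrightarrow> c0) F"
      "(d \<longlongrightarrow> d0) F" "(e \<longlongrightarrow> e0) F"
    and nz: "q0 \<noteq> 0" "a0 \<noteq> 0" "b0 \<noteq> 0" "c0 \<noteq> 0" "d0 \<noteq> 0" "e0 \<noteq> 0"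
    and den: "\<theta> a0 \<noteq> 0"
      "\<And>k. k \<le> n \<Longrightarrow> tfac (q0 ^ 3) (a0 * q0 ^ 3 / b0) k * tfac (q0 ^ 3) (a0 * q0 ^ 3 / c0) k \<noteq> 0"
      "\<And>k. k \<le> n \<Longrightarrow> tfac q0 (a0 * q0 / d0) (2 * k) \<noteq> 0"
      "\<And>k. k \<le> n \<Longrightarrow> tfac q0 (a0 * q0 / e0) k * tfac q0 (a0 * q0 ^ (3 * n + 1)) k \<noteq> 0"
  shows "((\<lambda>t. cubic_lhs (q t) (a t) (b t) (c t) (d t) (e t) n) \<longlongrightarrow> cubic_lhs q0 a0 b0 c0 d0 e0 n) F"
  unfolding cubic_lhs_def
  by (rule tendsto_sum, intro tendsto_intros t) (use nz den in simp_all)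

lemma tendsto_omega_term:
  assumes t: "(Q \<longlongrightarrow> Q0) F" "(A \<longlongrightarrow> A0) F" "list_all2 (\<lambda>x x0. (x \<longlongrightarrow> x0) F) xs xs0"
    and nz: "Q0 \<noteq> 0" "A0 \<noteq> 0" "0 \<notin> set xs0"
    and den: "\<theta> A0 \<noteq> 0" "tfac Q0 Q0 k * (\<Prod>x\<leftarrow>xs0. tfac Q0 (A0 * Q0 / x) k) \<noteq> 0"
  shows "((\<lambda>t. omega_term (Q t) (A t) (map (\<lambda>x. x t) xs) k) \<longlongrightarrow> omega_term Q0 A0 xs0 k) F"
proof -
  have num: "((\<lambda>t. \<Prod>x\<leftarrow>xs. tfac (Q t) (x t) k) \<longlongrightarrow> (\<Prod>x\<leftarrow>xs0. tfac Q0 x k)) F"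
    using t(3) nz(3)
  proof (induction rule: list_all2_induct)
    case (Cons x xs x0 xs0)
    then show ?case by (auto intro!: tendsto_intros t nz)
  qed simp
  have dn: "((\<lambda>t. \<Prod>x\<leftarrow>xs. tfac (Q t) (A t * Q t / x t) k) \<longlongrightarrow> (\<Prod>x\<leftarrow>xs0. tfac Q0 (A0 * Q0 / x) k)) F"
    using t(3) nz(3)
  proof (induction rule: list_all2_induct)
    case (Cons x xs x0 xs0)
    then show ?case using nz by (auto intro!: tendsto_intros t)
  qed simp
  show ?thesis
    unfolding omega_term_def map_map o_def
    by (intro tendsto_intros t num dn) (use nz den in auto)
qed

lemma tendsto_cubic_rhs:
  assumes t: "(q \<longlongrightarrow> q0) F" "(a \<longlongrightarrow> a0) F" "(b \<longlongrightarrow> b0) F" "(c \<longlongrightarrow> c0) F"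
      "(d \<longlongrightarrow> d0) F" "(e \<longlongrightarrow> e0) F" "(f \<longlongrightarrow> f0) F"
    and nz: "q0 \<noteq> 0" "a0 \<noteq> 0" "b0 \<noteq> 0" "c0 \<noteq> 0" "d0 \<noteq> 0" "e0 \<noteq> 0" "f0 \<noteq> 0"
    and pre: "tfac (q0 ^ 3) (a0 ^ 2 * q0 ^ 3 / (b0 * e0 * f0)) n * tfac (q0 ^ 3) (a0 * f0 * q0 ^ 3 / c0) n *
     tfac (q0 ^ 3) (a0 * q0 ^ 3 / d0) n * tfac (q0 ^ 3) (a0 ^ 2 * q0 ^ 3 / (b0 * c0 * d0 * e0)) n \<noteq> 0"
    and den: "\<theta> (a0 * f0 / c0) \<noteq> 0"
      "\<And>k. k \<le> n \<Longrightarrow> tfac (q0 ^ 3) (q0 ^ 3) k * (\<Prod>x\<leftarrow>[a0 / c0, f0 * q0 ^ 3 / c0, b0 * e0 * f0 / a0, d0, d0 * q0, f0, inverse (q0 ^ (3 * n))].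
        tfac (q0 ^ 3) (a0 * f0 / c0 * q0 ^ 3 / x) k) \<noteq> 0"
  shows "((\<lambda>t. cubic_rhs (q t) (a t) (b t) (c t) (d t) (e t) (f t) n) \<longlongrightarrow> cubic_rhs q0 a0 b0 c0 d0 e0 f0 n) F"
proof -
  have "((\<lambda>t. omega_term (q t ^ 3) (a t * f t / c t) (map (\<lambda>x. x t) [\<lambda>t. a t / c t, \<lambda>t. f t * q t ^ 3 / c t,
      \<lambda>t. b t * e t * f t / a t, d, \<lambda>t. d t * q t, f, \<lambda>t. inverse (q t ^ (3 * n))]) k) \<longlongrightarrow>
    omega_term (q0 ^ 3) (a0 * f0 / c0) [a0 / c0, f0 * q0 ^ 3 / c0, b0 * e0 * f0 / a0, d0, d0 * q0, f0,
      inverse (q0 ^ (3 * n))] k) F" if "k \<le> n" for k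
    using nz den(1) den(2)[OF that]
    by (intro tendsto_omega_term) (auto intro!: tendsto_intros t)
  then show ?thesis
    unfolding cubic_rhs_def cubic_prefactor_def
    by (intro tendsto_intros t tendsto_sum) (use nz pre in auto)
qed

lemma cubic_transformation:
  assumes nz: "q \<noteq> 0" "a \<noteq> 0" "b \<noteq> 0" "c \<noteq> 0"
    and d: "d = a * q / (b * c)" and e: "e = a * b * c * q ^ (3 * n)" and f: "f = a / b \<or> f = a / e"
    and den: "\<theta> a \<noteq> 0"
      "\<And>k. k \<le> n \<Longrightarrow> tfac (q ^ 3) (a * q ^ 3 / b) k * tfac (q ^ 3) (a * q ^ 3 / c) k \<noteq> 0"
      "\<And>k. k \<le> n \<Longrightarrow> tfac q (a * q / d) (2 * k) \<noteq> 0"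
      "\<And>k. k \<le> n \<Longrightarrow> tfac q (a * q / e) k * tfac q (a * q ^ (3 * n + 1)) k \<noteq> 0"
    and pre: "tfac (q ^ 3) (a ^ 2 * q ^ 3 / (b * e * f)) n * tfac (q ^ 3) (a * f * q ^ 3 / c) n *
     tfac (q ^ 3) (a * q ^ 3 / d) n * tfac (q ^ 3) (a ^ 2 * q ^ 3 / (b * c * d * e)) n \<noteq> 0"
    and den': "\<theta> (a * f / c) \<noteq> 0"
      "\<And>k. k \<le> n \<Longrightarrow> tfac (q ^ 3) (q ^ 3) k * (\<Prod>x\<leftarrow>[a / c, f * q ^ 3 / c, b * e * f / a, d, d * q, f, inverse (q ^ (3 * n))].
        tfac (q ^ 3) (a * f / c * q ^ 3 / x) k) \<noteq> 0"
  shows "cubic_lhs q a b c d e n = cubic_rhs q a b c d e f n"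
proof -
  \<comment> \<open>A curve through the given parameters at \<open>t = 0\<close>. Only four of them
    move freely; \<open>d'\<close> and \<open>e'\<close> are solved from the balancing conditions,
    which thus hold along the whole curve.\<close>
  define q' where "q' t = q * exp t" for t
  define a' where "a' t = a * exp (t ^ 2)" for t
  define b' where "b' t = b * exp (t ^ 3)" for t
  define c' where "c' t = c * exp (t ^ 4)" for t
  define d' where "d' t = a' t * q' t / (b' t * c' t)" for t
  define e' where "e' t = a' t * b' t * c' t * q' t ^ (3 * n)" for t
  \<comment> \<open>The case satisfied by \<open>f\<close> at \<open>t = 0\<close> is kept along the
    curve; if both hold, the first is taken.\<close>
  define f' where "f' t = (if f = a / b then a' t / b' t else a' t / e' t)" for t
  note prim_defs = q'_def a'_def b'_def c'_def
  have nz': "q' t \<noteq> 0" "a' t \<noteq> 0" "b' t \<noteq> 0" "c' t \<noteq> 0" for t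
    using nz by (simp_all add: prim_defs)
  have at0: "q' 0 = q" "a' 0 = a" "b' 0 = b" "c' 0 = c"
    by (simp_all add: prim_defs)
  then have at0': "d' 0 = d" "e' 0 = e" by (simp_all add: d'_def e'_def d e)
  with at0 have f0: "f' 0 = f" using f by (auto simp: f'_def)
  have dn: "d \<noteq> 0" "e \<noteq> 0" using nz by (simp_all add: d e)
  then have fn: "f \<noteq> 0" using f nz by auto
  have lim: "(q' \<longlongrightarrow> q) (at 0)" "(a' \<longlongrightarrow> a) (at 0)" "(b' \<longlongrightarrow> b) (at 0)" "(c' \<longlongrightarrow> c) (at 0)"
    unfolding prim_defs by (auto intro!: tendsto_eq_intros)
  have lim_d: "(d' \<longlongrightarrow> d) (at 0)"
    unfolding d'_def d by (intro tendsto_intros lim) (use nz in simp)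
  have lim_e: "(e' \<longlongrightarrow> e) (at 0)"
    unfolding e'_def e by (intro tendsto_intros lim)
  have lim_f: "(f' \<longlongrightarrow> f) (at 0)"
  proof (cases "f = a / b")
    case True
    have "((\<lambda>t. a' t / b' t) \<longlongrightarrow> a / b) (at 0)"
      by (intro tendsto_intros lim) (use nz in simp)
    then show ?thesis using True by (simp add: f'_def[abs_def])
  next
    case False
    have "((\<lambda>t. a' t / e' t) \<longlongrightarrow> a / e) (at 0)"
      by (intro tendsto_intros lim lim_e) (use dn in simp)
    then show ?thesis using False f by (simp add: f'_def[abs_def])
  qed
  let ?D = "\<lambda>t. cubic_lhs (q' t) (a' t) (b' t) (c' t) (d' t) (e' t) n -
    cubic_rhs (q' t) (a' t) (b' t) (c' t) (d' t) (e' t) (f' t) n"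
  have "?D 0 = 0"
  proof (rule eq_0_off_countable[where f = ?D])
    show "countable {t. \<not> generic_parameters (q' t) (a' t) (b' t) (c' t)}"
      unfolding prim_defs by (rule countable_non_generic[OF nz])
    show "isCont ?D 0"
      unfolding isCont_def at0 at0' f0
      by (intro tendsto_diff tendsto_cubic_lhs tendsto_cubic_rhs lim lim_d lim_e lim_f nz dn fn den pre den')
    fix t assume "t \<notin> {t. \<not> generic_parameters (q' t) (a' t) (b' t) (c' t)}"
    then have gen: "generic_parameters (q' t) (a' t) (b' t) (c' t)" by simp
    show "?D t = 0"
      using generic_case_b[OF gen nz' d'_def e'_def refl] generic_case_e[OF gen nz' d'_def e'_def refl]
      by (simp add: f'_def)
  qed
  then show ?thesis by (simp add: at0 at0' f0)
qed

end

theorem theorem4p3: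
  fixes a b c d e f p q :: complex and n :: nat
  assumes hp: "norm p < 1"
    and hnz: "q \<noteq> 0" "a \<noteq> 0" "b \<noteq> 0" "c \<noteq> 0" "d \<noteq> 0" "e \<noteq> 0" "f \<noteq> 0"
    and h1: "b * c * d = a * q"
    and h2: "d * e = a ^ 2 * q ^ (3 * n + 1)"
    and hf: "f = a / b \<or> f = a / e"
    and gen_lhs: "ellE p a \<noteq> 0"
      "\<forall>k\<le>n. epochs p (q ^ 3) [a * q ^ 3 / b, a * q ^ 3 / c] (int k) \<noteq> 0"
      "\<forall>k\<le>n. epoch p q (a * q / d) (int (2 * k)) \<noteq> 0"
      "\<forall>k\<le>n. epochs p q [a * q / e, a * q ^ (3 * n + 1)] (int k) \<noteq> 0"
    and gen_rhs:
      "epochs p (q ^ 3) [a ^ 2 * q ^ 3 / (b * e * f), a * f * q ^ 3 / c, a * q ^ 3 / d,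
                         a ^ 2 * q ^ 3 / (b * c * d * e)] (int n) \<noteq> 0"
      "ellE p (a * f / c) \<noteq> 0"
      "\<forall>k\<le>n. epochs p (q ^ 3)
          (q ^ 3 # map (\<lambda>ai. (a * f / c) * q ^ 3 / ai)
             [a / c, f * q ^ 3 / c, b * e * f / a, d, d * q, f, inverse (q ^ (3 * n))]) (int k) \<noteq> 0"
  shows
    "(\<Sum>k\<le>n. ellE p (a * q ^ (4 * k)) / ellE p a
        * epochs p q [b, c] (int k) / epochs p (q ^ 3) [a * q ^ 3 / b, a * q ^ 3 / c] (int k)
        * epoch p q d (int (2 * k)) / epoch p q (a * q / d) (int (2 * k))
        * epochs p (q ^ 3) [e, inverse (q ^ (3 * n))] (int k)
        / epochs p q [a * q / e, a * q ^ (3 * n + 1)] (int k)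
        * q ^ k)
     = epochs p (q ^ 3) [a * q ^ 3, a ^ 2 * q ^ 3 / (b * c * e), a ^ 2 * q ^ 3 / (b * d * e * f),
                         a * f * q ^ 3 / (c * d)] (int n)
       / epochs p (q ^ 3) [a ^ 2 * q ^ 3 / (b * e * f), a * f * q ^ 3 / c, a * q ^ 3 / d,
                           a ^ 2 * q ^ 3 / (b * c * d * e)] (int n)
       * omega p (q ^ 3) (a * f / c)
           [a / c, f * q ^ 3 / c, b * e * f / a, d, d * q, f, inverse (q ^ (3 * n))]"
proof -
  interpret elliptic_nome p by unfold_locales (rule hp)
  note red = epoch_eq_tfac epochs_eq_tfac
  have d: "d = a * q / (b * c)"
    using h1 hnz by (simp add: field_simps)
  have e: "e = a * b * c * q ^ (3 * n)"
    using h2 hnz by (simp add: d field_simps power2_eq_square)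
  have "cubic_lhs q a b c d e n = cubic_rhs q a b c d e f n"
  proof (rule cubic_transformation[OF hnz(1-4) d e hf])
    show "ellE p a \<noteq> 0" "ellE p (a * f / c) \<noteq> 0" by fact+
    show "tfac (q ^ 3) (a ^ 2 * q ^ 3 / (b * e * f)) n * tfac (q ^ 3) (a * f * q ^ 3 / c) n *
      tfac (q ^ 3) (a * q ^ 3 / d) n * tfac (q ^ 3) (a ^ 2 * q ^ 3 / (b * c * d * e)) n \<noteq> 0"
      using gen_rhs(1) unfolding red by simp
    fix k assume k: "k \<le> n"
    then show "tfac (q ^ 3) (a * q ^ 3 / b) k * tfac (q ^ 3) (a * q ^ 3 / c) k \<noteq> 0"
      and "tfac q (a * q / d) (2 * k) \<noteq> 0"
      and "tfac q (a * q / e) k * tfac q (a * q ^ (3 * n + 1)) k \<noteq> 0"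
      using gen_lhs(2-4) unfolding red by simp_all
    show "tfac (q ^ 3) (q ^ 3) k * (\<Prod>x\<leftarrow>[a / c, f * q ^ 3 / c, b * e * f / a, d, d * q, f, inverse (q ^ (3 * n))].
        tfac (q ^ 3) (a * f / c * q ^ 3 / x) k) \<noteq> 0"
      using gen_rhs(3) k unfolding red list.map prod_list.Cons prod_list.Nil by blast
  qed
  moreover have "omega p (q ^ 3) (a * f / c) [a / c, f * q ^ 3 / c, b * e * f / a, d, d * q, f, inverse (q ^ (3 * n))] =
    (\<Sum>k\<le>n. omega_term (q ^ 3) (a * f / c) [a / c, f * q ^ 3 / c, b * e * f / a, d, d * q, f, inverse (q ^ (3 * n))] k)"
    using omega_terminating[OF hnz(1), of "a * f / c" "[a / c, f * q ^ 3 / c, b * e * f / a, d, d * q, f]" n] by simp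
  ultimately show ?thesis
    unfolding cubic_lhs_def cubic_rhs_def cubic_prefactor_def red
    by (simp only: list.map prod_list.Cons prod_list.Nil mult_1_right mult.assoc)
qed

end
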